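(* Let $(M,g,J)$, $\dim M=2n\ge4$, be a Bochner-Kähler manifold and $T=\mathrm{grad}\,\tau$. Then (i) the vector field $\dfrac{T-iJT}2$ is holomorphic; (ii) $\displaystyle (n+2)\nabla_\alpha\tau_{\bar\beta}+2(n+1)\rho^2_{\alpha\bar\beta}-\tau\rho_{\alpha\bar\beta}=\frac{(n+2)\Delta\tau+2(n+1)\|\rho\|^2-\tau^2}{2n}\,g_{\alpha\bar\beta}$, where $\rho^2_{\alpha\bar\beta}=\rho_\alpha^{\varepsilon}\rho_{\varepsilon\bar\beta}$; (iii) $2\rho(X,T)=-X(\Delta\tau)$ for every vector field $X$ on $M$.
   Context: $(M,g,J)$ is Kähler of real dimension $2n$ with Levi-Civita connection $\nabla$; $R(X,Y)Z=\nabla_X\nabla_YZ-\nabla_Y\nabla_XZ-\nabla_{[X,Y]}Z$, $R(X,Y,Z,U)=g(R(X,Y)Z,U)$, $\rho(Y,Z)=\sum_iR(e_i,Y,Z,e_i)$, $\tau=\sum_i\rho(e_i,e_i)$, $\|\rho\|^2=\sum_{i,j}\rho(e_i,e_j)^2$ for an orthonormal basis $e_1,\dots,e_{2n}$ of $T_mM$; $\Delta\tau=\sum_i(\nabla d\tau)(e_i,e_i)$. Indices refer to a complex basis $Z_\alpha$, $\alpha=1,\dots,n$, of $T^{1,0}_mM$ with $Z_{\bar\alpha}=\overline{Z_\alpha}$; tensors are extended complex-multilinearly, $\tau_{\bar\beta}$ are components of $d\tau$, $\nabla_\alpha\tau_{\bar\beta}=(\nabla_{Z_\alpha}d\tau)(Z_{\bar\beta})$,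 and indices are raised with $g$. The manifold is Bochner-Kähler if its Bochner tensor vanishes, i.e. $$R_{\alpha\bar\beta\gamma\bar\delta}=\frac1{n+2}(g_{\alpha\bar\beta}\rho_{\gamma\bar\delta}+g_{\gamma\bar\beta}\rho_{\alpha\bar\delta}+g_{\gamma\bar\delta}\rho_{\alpha\bar\beta}+g_{\alpha\bar\delta}\rho_{\gamma\bar\beta})-\frac{\tau}{2(n+1)(n+2)}(g_{\alpha\bar\beta}g_{\gamma\bar\delta}+g_{\gamma\bar\beta}g_{\alpha\bar\delta}).$$ *)

theory Defs
  imports "HOL-Analysis.Analysis" "HOL-Library.Function_Algebras"
begin

section \<open>Smooth and holomorphic maps between coordinate spaces\<close>

instantiation "fun" :: (type, real_vector) real_vector
begin

definition scaleR_fun_def: "r *\<^sub>R f = (\<lambda>x. r *\<^sub>R f x)"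

instance
  by standard (auto simp: scaleR_fun_def fun_eq_iff algebra_simps)

end

text \<open>
  The set \<open>S\<close> is meant to be open throughout this section.  In finite dimension, class
  \<open>C\<^sup>k\<^sup>+\<^sup>1\<close> amounts to differentiability together with class \<open>C\<^sup>k\<close> of all directional derivatives.
\<close>

primrec Ck_on :: "nat \<Rightarrow> 'e::euclidean_space set \<Rightarrow> ('e \<Rightarrow> 'f::real_normed_vector) \<Rightarrow> bool" where
  "Ck_on 0 S f \<longleftrightarrow> continuous_on S f"
| "Ck_on (Suc k) S f \<longleftrightarrow>
     (\<forall>x\<in>S. f differentiable (at x)) \<and> (\<forall>v. Ck_on k S (\<lambda>x. frechet_derivative f (at x) v))"

definition smooth_on :: "'e::euclidean_space set \<Rightarrow> ('e \<Rightarrow> 'f::real_normed_vector) \<Rightarrow> bool" where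
  "smooth_on S f \<longleftrightarrow> (\<forall>k. Ck_on k S f)"

text \<open>Holomorphic maps of several variables: smooth maps satisfying the Cauchy-Riemann equations,
  i.e. with complex-linear differential.\<close>

definition holomorphic_map_on :: "(complex^'n) set \<Rightarrow> (complex^'n \<Rightarrow> complex^'m) \<Rightarrow> bool" where
  "holomorphic_map_on S f \<longleftrightarrow> smooth_on S f \<and>
     (\<forall>z\<in>S. \<forall>v. frechet_derivative f (at z) (\<i> *s v) = \<i> *s frechet_derivative f (at z) v)"


section \<open>Complex manifolds and tangent vectors\<close>

text \<open>
  A chart is a pair of a domain and a coordinate map; the values of the latter off the domain are
  irrelevant.  A tangent vector is the family of its components in all charts, so it assigns to
  every chart around the base point an element of \<open>complex^'n\<close>, which is regarded as the real vector
  space of dimension \<open>2 * CARD('n)\<close>.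
\<close>

type_synonym ('a, 'n) chart = "'a set \<times> ('a \<Rightarrow> complex^'n)"
type_synonym ('a, 'n) tvec = "('a, 'n) chart \<Rightarrow> complex^'n"
type_synonym ('a, 'n) tfield = "'a \<Rightarrow> ('a, 'n) tvec"

text \<open>
  The underlying space, a holomorphic atlas, the Riemannian metric and the covariant derivative of
  a manifold.  \<open>conn K p v Y\<close> is the covariant derivative at \<open>p\<close>, in the direction \<open>v\<close>, of a vector
  field \<open>Y\<close> defined near \<open>p\<close>.
\<close>

record ('a, 'n) geometry =
  space_of :: "'a topology"
  atlas :: "('a, 'n) chart set"
  metric :: "'a \<Rightarrow> ('a, 'n) tvec \<Rightarrow> ('a, 'n) tvec \<Rightarrow> real"
  conn :: "'a \<Rightarrow> ('a, 'n) tvec \<Rightarrow> ('a, 'n) tfield \<Rightarrow> ('a, 'n) tvec"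

abbreviation points :: "('a, 'n::finite) geometry \<Rightarrow> 'a set" where
  "points K \<equiv> topspace (space_of K)"

definition chart_inv :: "('a, 'n::finite) chart \<Rightarrow> complex^'n \<Rightarrow> 'a" where
  "chart_inv c = inv_into (fst c) (snd c)"

definition transition :: "('a, 'n::finite) chart \<Rightarrow> ('a, 'n) chart \<Rightarrow> complex^'n \<Rightarrow> complex^'n" where
  "transition c d = snd d \<circ> chart_inv c"

definition is_chart :: "'a topology \<Rightarrow> ('a, 'n::finite) chart \<Rightarrow> bool" where
  "is_chart X c \<longleftrightarrow> openin X (fst c) \<and> open (snd c ` fst c) \<and>
     homeomorphic_map (subtopology X (fst c)) (top_of_set (snd c ` fst c)) (snd c)"

definition complex_manifold :: "('a, 'n::finite) geometry \<Rightarrow> bool" where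
  "complex_manifold K \<longleftrightarrow>
     Hausdorff_space (space_of K) \<and> second_countable (space_of K) \<and>
     (\<forall>c\<in>atlas K. is_chart (space_of K) c) \<and> (\<Union>c\<in>atlas K. fst c) = points K \<and>
     (\<forall>c\<in>atlas K. \<forall>d\<in>atlas K.
        holomorphic_map_on (snd c ` (fst c \<inter> fst d)) (transition c d))"

definition tangent_space :: "('a, 'n::finite) geometry \<Rightarrow> 'a \<Rightarrow> ('a, 'n) tvec set" where
  "tangent_space K p = {v.
     (\<forall>c\<in>atlas K. \<forall>d\<in>atlas K. p \<in> fst c \<and> p \<in> fst d \<longrightarrow>
        v d = frechet_derivative (transition c d) (at (snd c p)) (v c)) \<and>
     (\<forall>c. \<not> (c \<in> atlas K \<and> p \<in> fst c) \<longrightarrow> v c = 0)}"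

text \<open>The complex structure \<open>J\<close> determined by the holomorphic atlas.\<close>

definition cstr :: "('a, 'n::finite) tvec \<Rightarrow> ('a, 'n) tvec" where
  "cstr v = (\<lambda>c. \<i> *s v c)"

text \<open>Functions and vector fields are total on the type of points; only their restriction to the
  open set in question is constrained.\<close>

definition smooth_fun :: "('a, 'n::finite) geometry \<Rightarrow> 'a set \<Rightarrow> ('a \<Rightarrow> real) \<Rightarrow> bool" where
  "smooth_fun K U f \<longleftrightarrow>
     (\<forall>c\<in>atlas K. smooth_on (snd c ` (U \<inter> fst c)) (\<lambda>z. f (chart_inv c z)))"

definition smooth_field :: "('a, 'n::finite) geometry \<Rightarrow> 'a set \<Rightarrow> ('a, 'n) tfield \<Rightarrow> bool" where
  "smooth_field K U X \<longleftrightarrow> (\<forall>p\<in>U. X p \<in> tangent_space K p) \<and>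
     (\<forall>c\<in>atlas K. smooth_on (snd c ` (U \<inter> fst c)) (\<lambda>z. X (chart_inv c z) c))"

definition smooth_fun_near :: "('a, 'n::finite) geometry \<Rightarrow> 'a \<Rightarrow> ('a \<Rightarrow> real) \<Rightarrow> bool" where
  "smooth_fun_near K p f \<longleftrightarrow> (\<exists>U. openin (space_of K) U \<and> p \<in> U \<and> smooth_fun K U f)"

definition smooth_field_near :: "('a, 'n::finite) geometry \<Rightarrow> 'a \<Rightarrow> ('a, 'n) tfield \<Rightarrow> bool" where
  "smooth_field_near K p X \<longleftrightarrow> (\<exists>U. openin (space_of K) U \<and> p \<in> U \<and> smooth_field K U X)"

text \<open>\<open>dfun K f p v\<close> is the derivative \<open>df(v)\<close> at \<open>p\<close>; it can be computed in any chart around \<open>p\<close>.\<close>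

definition dfun :: "('a, 'n::finite) geometry \<Rightarrow> ('a \<Rightarrow> real) \<Rightarrow> 'a \<Rightarrow> ('a, 'n) tvec \<Rightarrow> real" where
  "dfun K f p v = (let c = SOME c. c \<in> atlas K \<and> p \<in> fst c in
     frechet_derivative (\<lambda>z. f (chart_inv c z)) (at (snd c p)) (v c))"

definition lie_bracket ::
    "('a, 'n::finite) geometry \<Rightarrow> ('a, 'n) tfield \<Rightarrow> ('a, 'n) tfield \<Rightarrow> ('a, 'n) tfield" where
  "lie_bracket K X Y p = (\<lambda>c. if c \<in> atlas K \<and> p \<in> fst c then
       frechet_derivative (\<lambda>z. Y (chart_inv c z) c) (at (snd c p)) (X p c)
     - frechet_derivative (\<lambda>z. X (chart_inv c z) c) (at (snd c p)) (Y p c)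
     else 0)"


section \<open>Riemannian metric, Levi-Civita connection, Kaehler condition\<close>

definition riemannian :: "('a, 'n::finite) geometry \<Rightarrow> bool" where
  "riemannian K \<longleftrightarrow>
     (\<forall>p\<in>points K. \<forall>u\<in>tangent_space K p. \<forall>v\<in>tangent_space K p. \<forall>w\<in>tangent_space K p. \<forall>a b.
        metric K p (a *\<^sub>R u + b *\<^sub>R v) w = a * metric K p u w + b * metric K p v w) \<and>
     (\<forall>p\<in>points K. \<forall>u\<in>tangent_space K p. \<forall>v\<in>tangent_space K p.
        metric K p u v = metric K p v u) \<and>
     (\<forall>p\<in>points K. \<forall>u\<in>tangent_space K p. u \<noteq> 0 \<longrightarrow> metric K p u u > 0) \<and>
     (\<forall>U X Y. openin (space_of K) U \<and> smooth_field K U X \<and> smooth_field K U Y \<longrightarrow>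
        smooth_fun K U (\<lambda>p. metric K p (X p) (Y p)))"

text \<open>
  Requiring the axioms for all fields defined near a point, instead of global ones only, makes
  \<open>conn\<close> act on local fields; that it depends on the germ of the field alone follows from the
  Leibniz rule, applied to the function that is 1 on an open set and 0 elsewhere.
\<close>

definition affine_connection :: "('a, 'n::finite) geometry \<Rightarrow> bool" where
  "affine_connection K \<longleftrightarrow>
     (\<forall>p\<in>points K. \<forall>v\<in>tangent_space K p. \<forall>Y. smooth_field_near K p Y \<longrightarrow>
        conn K p v Y \<in> tangent_space K p) \<and>
     (\<forall>U X Y. openin (space_of K) U \<and> smooth_field K U X \<and> smooth_field K U Y \<longrightarrow>
        smooth_field K U (\<lambda>p. conn K p (X p) Y)) \<and>
     (\<forall>p\<in>points K. \<forall>u\<in>tangent_space K p. \<forall>v\<in>tangent_space K p. \<forall>a b Y.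
        smooth_field_near K p Y \<longrightarrow>
        conn K p (a *\<^sub>R u + b *\<^sub>R v) Y = a *\<^sub>R conn K p u Y + b *\<^sub>R conn K p v Y) \<and>
     (\<forall>p\<in>points K. \<forall>v\<in>tangent_space K p. \<forall>Y Y'.
        smooth_field_near K p Y \<and> smooth_field_near K p Y' \<longrightarrow>
        conn K p v (\<lambda>q. Y q + Y' q) = conn K p v Y + conn K p v Y') \<and>
     (\<forall>p\<in>points K. \<forall>v\<in>tangent_space K p. \<forall>f Y.
        smooth_fun_near K p f \<and> smooth_field_near K p Y \<longrightarrow>
        conn K p v (\<lambda>q. f q *\<^sub>R Y q) = dfun K f p v *\<^sub>R Y p + f p *\<^sub>R conn K p v Y)"

definition levi_civita :: "('a, 'n::finite) geometry \<Rightarrow> bool" where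
  "levi_civita K \<longleftrightarrow> affine_connection K \<and>
     (\<forall>p\<in>points K. \<forall>X Y. smooth_field_near K p X \<and> smooth_field_near K p Y \<longrightarrow>
        conn K p (X p) Y - conn K p (Y p) X = lie_bracket K X Y p) \<and>
     (\<forall>p\<in>points K. \<forall>v\<in>tangent_space K p. \<forall>Y Z.
        smooth_field_near K p Y \<and> smooth_field_near K p Z \<longrightarrow>
        dfun K (\<lambda>q. metric K q (Y q) (Z q)) p v
          = metric K p (conn K p v Y) (Z p) + metric K p (Y p) (conn K p v Z))"

definition kaehler_manifold :: "('a, 'n::finite) geometry \<Rightarrow> bool" where
  "kaehler_manifold K \<longleftrightarrow> complex_manifold K \<and> riemannian K \<and> levi_civita K \<and>
     (\<forall>p\<in>points K. \<forall>u\<in>tangent_space K p. \<forall>v\<in>tangent_space K p.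
        metric K p (cstr u) (cstr v) = metric K p u v) \<and>
     (\<forall>p\<in>points K. \<forall>v\<in>tangent_space K p. \<forall>Y. smooth_field_near K p Y \<longrightarrow>
        conn K p v (\<lambda>q. cstr (Y q)) = cstr (conn K p v Y))"


section \<open>Curvature, gradient and Laplacian\<close>

definition curv_field :: "('a, 'n::finite) geometry \<Rightarrow> ('a, 'n) tfield \<Rightarrow> ('a, 'n) tfield \<Rightarrow>
    ('a, 'n) tfield \<Rightarrow> ('a, 'n) tfield" where
  "curv_field K X Y Z p =
     conn K p (X p) (\<lambda>q. conn K q (Y q) Z) - conn K p (Y p) (\<lambda>q. conn K q (X q) Z)
     - conn K p (lie_bracket K X Y p) Z"

text \<open>An arbitrary smooth extension of a tangent vector to a local field.  It only occurs in
  expressions that are tensorial, hence independent of the choice.\<close>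

definition extend :: "('a, 'n::finite) geometry \<Rightarrow> 'a \<Rightarrow> ('a, 'n) tvec \<Rightarrow> ('a, 'n) tfield" where
  "extend K p v = (SOME X. smooth_field_near K p X \<and> X p = v)"

definition curv :: "('a, 'n::finite) geometry \<Rightarrow> 'a \<Rightarrow> ('a, 'n) tvec \<Rightarrow> ('a, 'n) tvec \<Rightarrow>
    ('a, 'n) tvec \<Rightarrow> ('a, 'n) tvec" where
  "curv K p x y z = curv_field K (extend K p x) (extend K p y) (extend K p z) p"

definition riem :: "('a, 'n::finite) geometry \<Rightarrow> 'a \<Rightarrow> ('a, 'n) tvec \<Rightarrow> ('a, 'n) tvec \<Rightarrow>
    ('a, 'n) tvec \<Rightarrow> ('a, 'n) tvec \<Rightarrow> real" where
  "riem K p x y z u = metric K p (curv K p x y z) u"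

definition orthonormal_basis ::
    "('a, 'n::finite) geometry \<Rightarrow> 'a \<Rightarrow> (nat \<Rightarrow> ('a, 'n) tvec) \<Rightarrow> bool" where
  "orthonormal_basis K p e \<longleftrightarrow>
     tangent_space K p = span (e ` {..<2 * CARD('n)}) \<and>
     (\<forall>i<2 * CARD('n). \<forall>j<2 * CARD('n). metric K p (e i) (e j) = (if i = j then 1 else 0))"

text \<open>An arbitrary orthonormal basis; the contractions below do not depend on the choice.\<close>

definition frame :: "('a, 'n::finite) geometry \<Rightarrow> 'a \<Rightarrow> nat \<Rightarrow> ('a, 'n) tvec" where
  "frame K p = (SOME e. orthonormal_basis K p e)"

definition ricci ::
    "('a, 'n::finite) geometry \<Rightarrow> 'a \<Rightarrow> ('a, 'n) tvec \<Rightarrow> ('a, 'n) tvec \<Rightarrow> real" where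
  "ricci K p y z = (\<Sum>i<2 * CARD('n). riem K p (frame K p i) y z (frame K p i))"

definition scal :: "('a, 'n::finite) geometry \<Rightarrow> 'a \<Rightarrow> real" where
  "scal K p = (\<Sum>i<2 * CARD('n). ricci K p (frame K p i) (frame K p i))"

definition ricci_norm2 :: "('a, 'n::finite) geometry \<Rightarrow> 'a \<Rightarrow> real" where
  "ricci_norm2 K p =
     (\<Sum>i<2 * CARD('n). \<Sum>j<2 * CARD('n). (ricci K p (frame K p i) (frame K p j))\<^sup>2)"

definition grad :: "('a, 'n::finite) geometry \<Rightarrow> ('a \<Rightarrow> real) \<Rightarrow> ('a, 'n) tfield" where
  "grad K f p = (THE t. t \<in> tangent_space K p \<and>
     (\<forall>v\<in>tangent_space K p. metric K p t v = dfun K f p v))"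

text \<open>\<open>hessian K f p v w\<close> is \<open>(\<nabla>\<^sub>v df)(w)\<close>, where \<open>(\<nabla>\<^sub>v \<omega>)(W) = v(\<omega>(W)) - \<omega>(\<nabla>\<^sub>v W)\<close>.\<close>

definition hessian :: "('a, 'n::finite) geometry \<Rightarrow> ('a \<Rightarrow> real) \<Rightarrow> 'a \<Rightarrow> ('a, 'n) tvec \<Rightarrow>
    ('a, 'n) tvec \<Rightarrow> real" where
  "hessian K f p v w = (let W = extend K p w in
     dfun K (\<lambda>q. dfun K f q (W q)) p v - dfun K f p (conn K p v W))"

definition laplacian :: "('a, 'n::finite) geometry \<Rightarrow> ('a \<Rightarrow> real) \<Rightarrow> 'a \<Rightarrow> real" where
  "laplacian K f p = (\<Sum>i<2 * CARD('n). hessian K f p (frame K p i) (frame K p i))"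


section \<open>Complexified tangent vectors\<close>

text \<open>The pair \<open>(a, b)\<close> stands for \<open>a + \<i> b\<close> in the complexified tangent space.\<close>

type_synonym ('a, 'n) ctvec = "('a, 'n) tvec \<times> ('a, 'n) tvec"

definition cscale :: "complex \<Rightarrow> 'v::real_vector \<times> 'v \<Rightarrow> 'v \<times> 'v" where
  "cscale k W = (Re k *\<^sub>R fst W - Im k *\<^sub>R snd W, Re k *\<^sub>R snd W + Im k *\<^sub>R fst W)"

definition cconj :: "'v::real_vector \<times> 'v \<Rightarrow> 'v \<times> 'v" where
  "cconj W = (fst W, - snd W)"

definition complexify :: "'v::real_vector \<Rightarrow> 'v \<times> 'v" where
  "complexify v = (v, 0)"

text \<open>Complex-multilinear extension of real multilinear forms.\<close>

definition cext :: "('v \<Rightarrow> complex) \<Rightarrow> 'v \<times> 'v \<Rightarrow> complex" where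
  "cext f W = f (fst W) + \<i> * f (snd W)"

definition cext2 :: "('v \<Rightarrow> 'v \<Rightarrow> real) \<Rightarrow> 'v \<times> 'v \<Rightarrow> 'v \<times> 'v \<Rightarrow> complex" where
  "cext2 B V W = cext (\<lambda>v. cext (\<lambda>w. complex_of_real (B v w)) W) V"

definition cext4 :: "('v \<Rightarrow> 'v \<Rightarrow> 'v \<Rightarrow> 'v \<Rightarrow> real) \<Rightarrow>
    'v \<times> 'v \<Rightarrow> 'v \<times> 'v \<Rightarrow> 'v \<times> 'v \<Rightarrow> 'v \<times> 'v \<Rightarrow> complex" where
  "cext4 B X Y Z U = cext (\<lambda>x. cext (\<lambda>y. cext2 (B x y) Z U) Y) X"

text \<open>The space \<open>T\<^sup>1\<^sup>,\<^sup>0\<close> is the \<open>\<i>\<close>-eigenspace of the complex-linear extension of \<open>J\<close>.\<close>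

definition T10 :: "('a, 'n::finite) geometry \<Rightarrow> 'a \<Rightarrow> ('a, 'n) ctvec set" where
  "T10 K p = {W \<in> tangent_space K p \<times> tangent_space K p. map_prod cstr cstr W = cscale \<i> W}"

definition complex_basis ::
    "('a, 'n::finite) geometry \<Rightarrow> 'a \<Rightarrow> ('n \<Rightarrow> ('a, 'n) ctvec) \<Rightarrow> bool" where
  "complex_basis K p Z \<longleftrightarrow> (\<forall>\<alpha>. Z \<alpha> \<in> T10 K p) \<and>
     (\<forall>W\<in>T10 K p. \<exists>!k::'n \<Rightarrow> complex. W = (\<Sum>\<alpha>\<in>UNIV. cscale (k \<alpha>) (Z \<alpha>)))"

text \<open>The matrix of components \<open>B(Z\<^sub>\<alpha>, Z\<^sub>\<beta>')\<close>, where a prime denotes conjugation.\<close>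

definition mixed :: "('v::real_vector \<Rightarrow> 'v \<Rightarrow> real) \<Rightarrow> ('n::finite \<Rightarrow> 'v \<times> 'v) \<Rightarrow> complex^'n^'n" where
  "mixed B Z = (\<chi> \<alpha> \<beta>. cext2 B (Z \<alpha>) (cconj (Z \<beta>)))"

text \<open>The raised index: \<open>ricci_raised K p Z \<alpha> \<epsilon>\<close> are the numbers \<open>r\<^sub>\<alpha>\<^sub>\<epsilon>\<close> determined by
  \<open>(\<Sum>\<epsilon>. r\<^sub>\<alpha>\<^sub>\<epsilon> * g(Z\<^sub>\<epsilon>, Z\<^sub>\<beta>')) = \<rho>(Z\<^sub>\<alpha>, Z\<^sub>\<beta>')\<close>.\<close>

definition ricci_raised :: "('a, 'n::finite) geometry \<Rightarrow> 'a \<Rightarrow> ('n \<Rightarrow> ('a, 'n) ctvec) \<Rightarrow>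
    'n \<Rightarrow> 'n \<Rightarrow> complex" where
  "ricci_raised K p Z \<alpha> \<epsilon> =
     (\<Sum>\<delta>\<in>UNIV. mixed (ricci K p) Z $ \<alpha> $ \<delta> * matrix_inv (mixed (metric K p) Z) $ \<delta> $ \<epsilon>)"

definition ricci_square :: "('a, 'n::finite) geometry \<Rightarrow> 'a \<Rightarrow> ('n \<Rightarrow> ('a, 'n) ctvec) \<Rightarrow>
    'n \<Rightarrow> 'n \<Rightarrow> complex" where
  "ricci_square K p Z \<alpha> \<beta> =
     (\<Sum>\<epsilon>\<in>UNIV. ricci_raised K p Z \<alpha> \<epsilon> * mixed (ricci K p) Z $ \<epsilon> $ \<beta>)"

definition bochner_kaehler :: "('a, 'n::finite) geometry \<Rightarrow> bool" where
  "bochner_kaehler K \<longleftrightarrow> kaehler_manifold K \<and>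
     (\<forall>p\<in>points K. \<forall>Z. complex_basis K p Z \<longrightarrow>
       (let n = of_nat CARD('n);
            \<tau> = complex_of_real (scal K p);
            g = (\<lambda>\<alpha> \<beta>. mixed (metric K p) Z $ \<alpha> $ \<beta>);
            \<rho> = (\<lambda>\<alpha> \<beta>. mixed (ricci K p) Z $ \<alpha> $ \<beta>)
        in \<forall>\<alpha> \<beta> \<gamma> \<delta>.
          cext4 (riem K p) (Z \<alpha>) (cconj (Z \<beta>)) (Z \<gamma>) (cconj (Z \<delta>)) =
            1 / (n + 2) * (g \<alpha> \<beta> * \<rho> \<gamma> \<delta> + g \<gamma> \<beta> * \<rho> \<alpha> \<delta> + g \<gamma> \<delta> * \<rho> \<alpha> \<beta> + g \<alpha> \<delta> * \<rho> \<gamma> \<beta>)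
            - \<tau> / (2 * (n + 1) * (n + 2)) * (g \<alpha> \<beta> * g \<gamma> \<delta> + g \<gamma> \<beta> * g \<alpha> \<delta>)))"

text \<open>
  A complex vector field is holomorphic if it is of type (1,0) and its components with respect to
  \<open>\<partial>/\<partial>z\<^sup>\<alpha>\<close>, i.e. its images under the complex-linearly extended \<open>dz\<^sup>\<alpha>\<close>, are holomorphic in the charts.
\<close>

definition dz :: "('a, 'n::finite) chart \<Rightarrow> ('a, 'n) ctvec \<Rightarrow> complex^'n" where
  "dz c W = (\<chi> \<alpha>. cext (\<lambda>v. v c $ \<alpha>) W)"

definition holomorphic_field :: "('a, 'n::finite) geometry \<Rightarrow> ('a \<Rightarrow> ('a, 'n) ctvec) \<Rightarrow> bool" where
  "holomorphic_field K W \<longleftrightarrow> (\<forall>p\<in>points K. W p \<in> T10 K p) \<and>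
     (\<forall>c\<in>atlas K. holomorphic_map_on (snd c ` fst c) (\<lambda>z. dz c (W (chart_inv c z))))"

end

theory Submission
  imports Defs
begin

text \<open>
  In a holomorphic chart the Levi-Civita connection of a Kaehler metric has complex bilinear Christoffel
  symbols \<open>G\<close>, and with the Hermitian form \<open>h = g + \<i> g(\<cdot>, J \<cdot>)\<close> metric compatibility splits into
  \<open>\<partial>\<^sub>v h(x, y) = h(G v x, y)\<close> and its conjugate.  Hence the curvature is \<open>C = \<partial>b G\<close> (\<open>\<partial>b\<close> the conjugate
  derivative), its (2,0)-part vanishes, and the conjugate derivative of this vanishing is the second
  Bianchi identity.  Inserting the Bochner form of \<open>C\<close> and contracting once shows that the (1,0)-covariant
  derivative of the Ricci form \<open>r\<close> is
  \<open>(\<nabla>\<^sub>v r)(x, y) = (\<partial>\<^sub>v t h(x, y) + \<partial>\<^sub>x t h(v, y)) / (n + 1)\<close>, where \<open>t\<close> is the trace of \<open>r\<close>.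
  Commuting two (1,0)-derivatives of \<open>r\<close> kills the (2,0)-part of the Hessian of \<open>t\<close>, which is (i);
  commuting a (1,0)- with a (0,1)-derivative gives (ii) up to a factor found by taking traces; and (iii)
  follows by differentiating the divergence of the holomorphic field in (i).
\<close>

section \<open>Smooth maps\<close>

text \<open>Types keep the calculus short. A (1,0)-derivative acts on \<open>h\<close> through its
  complex linear slot only, so its covariant version corrects complex linear slots and leaves
  antilinear ones alone; (0,1)-derivatives behave conjugately. Mixed second derivatives of functions
  thus need no correction. Rigidity always comes from a trace. Commuting derivatives gives
  identities such as P(w, x) h(v, y) = P(v, x) h(w, y); contracting over v and y leaves (n - 1) P =
  0, which is where n >= 2 enters. The mixed identity, contracted likewise, makes the tensor in (ii)
  a multiple of \<open>h\<close>. The obstacle is the passage from the manifold: extensions, frames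
  and charts are arbitrary choices there, so each invariant is first given a closed formula in a
  chart. The constants stem from the (1,0)-vectors x - \<i>Jx. On them the extension of Re s is 2 s,
  so metric, Ricci tensor, its square and the Hessian of the scalar curvature have components 2
  \<open>h\<close>, 4 \<open>r\<close>, 8 \<open>q\<close> and 16 \<open>L\<close>, and (ii) is 16
  times an identity between \<open>L\<close>, \<open>q\<close>, \<open>r\<close> and
  \<open>h\<close>.\<close>

abbreviation dd :: "('e::real_normed_vector \<Rightarrow> 'f::real_normed_vector) \<Rightarrow> 'e \<Rightarrow> 'e \<Rightarrow> 'f" where
  "dd f x v \<equiv> frechet_derivative f (at x) v"

lemma dd_eqI: "(f has_derivative f') (at x) \<Longrightarrow> dd f x v = f' v"
  using frechet_derivative_at by metis

section \<open>Classes C^k: locality and closure properties\<close>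

lemma dd_cong:
  assumes "open S" "x \<in> S" "\<And>y. y \<in> S \<Longrightarrow> f y = g y"
  shows "dd f x v = dd g x v"
proof -
  have "(f has_derivative f') (at x) \<longleftrightarrow> (g has_derivative f') (at x)" for f'
    using has_derivative_transform_within_open[OF _ assms(1,2), of f f' UNIV g]
      has_derivative_transform_within_open[OF _ assms(1,2), of g f' UNIV f] assms(3) by auto
  then show ?thesis by (simp add: frechet_derivative_def)
qed

lemma differentiable_cong_open:
  assumes "open S" "x \<in> S" "\<And>y. y \<in> S \<Longrightarrow> f y = g y" "f differentiable (at x)"
  shows "g differentiable (at x)"
  using assms has_derivative_transform_within_open[OF _ assms(1,2), of f _ UNIV g]
  unfolding differentiable_def by blast

lemma Ck_on_cong:
  assumes "open S" "\<And>y. y \<in> S \<Longrightarrow> f y = g y" "Ck_on k S f"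
  shows "Ck_on k S g"
  using assms(2,3)
proof (induction k arbitrary: f g)
  case 0
  then show ?case by (auto cong: continuous_on_cong)
next
  case (Suc k)
  have "g differentiable (at x)" if "x \<in> S" for x
    using differentiable_cong_open[OF assms(1) that Suc.prems(1)] Suc.prems(2) that by auto
  moreover have "Ck_on k S (\<lambda>x. dd g x v)" for v
    by (rule Suc.IH[of "\<lambda>x. dd f x v"])
      (use dd_cong[OF assms(1) _ Suc.prems(1)] Suc.prems(2) in auto)
  ultimately show ?case by simp
qed

lemma Ck_on_subset: "Ck_on k S f \<Longrightarrow> T \<subseteq> S \<Longrightarrow> Ck_on k T f"
  by (induction k arbitrary: f) (auto intro: continuous_on_subset)

lemma Ck_on_SucD: "Ck_on (Suc k) S f \<Longrightarrow> Ck_on k S f"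
proof (induction k arbitrary: f)
  case 0
  then show ?case
    by (auto intro!: continuous_at_imp_continuous_on differentiable_imp_continuous_within)
next
  case (Suc k)
  then show ?case using Suc.IH by (metis Ck_on.simps(2))
qed

lemma Ck_on_const: "Ck_on k S (\<lambda>x. c)"
proof (induction k arbitrary: c)
  case (Suc k)
  then show ?case by (auto simp: frechet_derivative_const)
qed auto

lemma Ck_on_linear:
  assumes L: "bounded_linear L" and "open S" and "Ck_on k S f"
  shows "Ck_on k S (\<lambda>x. L (f x))"
  using assms(3)
proof (induction k arbitrary: f)
  case 0
  then show ?case using L by (simp add: bounded_linear.continuous_on)
next
  case (Suc k)
  have D: "((\<lambda>x. L (f x)) has_derivative (\<lambda>v. L (dd f x v))) (at x)" if "x \<in> S" for x
    using Suc.prems that by (intro bounded_linear.has_derivative[OF L]) (auto simp: frechet_derivative_works)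
  then have "\<forall>x\<in>S. (\<lambda>x. L (f x)) differentiable (at x)"
    by (auto simp: differentiable_def)
  moreover have "Ck_on k S (\<lambda>x. dd (\<lambda>x. L (f x)) x v)" for v
    by (rule Ck_on_cong[OF assms(2) _ Suc.IH[of "\<lambda>x. dd f x v"]])
      (use dd_eqI[OF D] Suc.prems in auto)
  ultimately show ?case by simp
qed

lemma Ck_on_add:
  assumes "open S" and "Ck_on k S f" "Ck_on k S g"
  shows "Ck_on k S (\<lambda>x. f x + g x)"
  using assms(2,3)
proof (induction k arbitrary: f g)
  case 0
  then show ?case by (simp add: continuous_on_add)
next
  case (Suc k)
  have D: "((\<lambda>x. f x + g x) has_derivative (\<lambda>v. dd f x v + dd g x v)) (at x)" if "x \<in> S" for x
    using Suc.prems that by (intro has_derivative_add) (auto simp: frechet_derivative_works)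
  then have "\<forall>x\<in>S. (\<lambda>x. f x + g x) differentiable (at x)"
    by (auto simp: differentiable_def)
  moreover have "Ck_on k S (\<lambda>x. dd (\<lambda>x. f x + g x) x v)" for v
    by (rule Ck_on_cong[OF assms(1) _ Suc.IH[of "\<lambda>x. dd f x v" "\<lambda>x. dd g x v"]])
      (use dd_eqI[OF D] Suc.prems in auto)
  ultimately show ?case by simp
qed

text \<open>The Leibniz rule expresses directional derivatives by the same \<open>B\<close> with one
  argument differentiated, so the induction runs over all \<open>f\<close> and \<open>g\<close>; the
  undifferentiated factor is lowered to class C^k by \<open>Ck_on_SucD\<close>.\<close>

lemma Ck_on_bilinear:
  assumes B: "bounded_bilinear B" and "open S" and "Ck_on k S f" "Ck_on k S g"
  shows "Ck_on k S (\<lambda>x. B (f x) (g x))"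
  using assms(3,4)
proof (induction k arbitrary: f g)
  case 0
  then show ?case using B by (simp add: bounded_bilinear.continuous_on)
next
  case (Suc k)
  have D: "((\<lambda>x. B (f x) (g x)) has_derivative (\<lambda>v. B (f x) (dd g x v) + B (dd f x v) (g x))) (at x)"
    if "x \<in> S" for x
    using Suc.prems that
    by (intro bounded_bilinear.FDERIV[OF B]) (auto simp: frechet_derivative_works)
  then have "\<forall>x\<in>S. (\<lambda>x. B (f x) (g x)) differentiable (at x)"
    by (auto simp: differentiable_def)
  moreover have "Ck_on k S (\<lambda>x. dd (\<lambda>x. B (f x) (g x)) x v)" for v
    by (rule Ck_on_cong[OF assms(2) _ Ck_on_add[OF assms(2) Suc.IH[of f "\<lambda>x. dd g x v"] Suc.IH[of "\<lambda>x. dd f x v" g]]])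
      (use dd_eqI[OF D] Suc.prems Ck_on_SucD[OF Suc.prems(1)] Ck_on_SucD[OF Suc.prems(2)] in auto)
  ultimately show ?case by simp
qed

lemma Ck_on_sum:
  assumes "open S" and "\<And>i. i \<in> I \<Longrightarrow> Ck_on k S (f i)"
  shows "Ck_on k S (\<lambda>x. \<Sum>i\<in>I. f i x)"
  using assms(2)
  by (induction I rule: infinite_finite_induct) (auto simp: Ck_on_const intro!: Ck_on_add assms(1))

text \<open>The derivative contains the inverse itself, which is of class C^k by the induction
  hypothesis; hence \<open>f\<close> stays fixed during the induction, unlike for sums and
  products.\<close>

lemma Ck_on_inverse:
  fixes f :: "'e::euclidean_space \<Rightarrow> 'a::real_normed_field"
  assumes "open S" and "\<And>x. x \<in> S \<Longrightarrow> f x \<noteq> 0" and "Ck_on k S f"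
  shows "Ck_on k S (\<lambda>x. inverse (f x))"
  using assms(3)
proof (induction k)
  case 0
  then show ?case using assms(2) by (simp add: continuous_on_inverse)
next
  case (Suc k)
  have D: "((\<lambda>x. inverse (f x)) has_derivative (\<lambda>v. - (inverse (f x) * dd f x v * inverse (f x)))) (at x)"
    if "x \<in> S" for x
    by (rule Deriv.has_derivative_inverse[where f = f, OF assms(2)[OF that]])
      (use Suc.prems that in \<open>auto simp: frechet_derivative_works\<close>)
  then have "\<forall>x\<in>S. (\<lambda>x. inverse (f x)) differentiable (at x)"
    by (auto simp: differentiable_def)
  moreover have "Ck_on k S (\<lambda>x. dd (\<lambda>x. inverse (f x)) x v)" for v
  proof (rule Ck_on_cong[OF assms(1)])
    have i: "Ck_on k S (\<lambda>x. inverse (f x))" using Suc Ck_on_SucD by blast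
    then have "Ck_on k S (\<lambda>x. inverse (f x) * dd f x v * inverse (f x))"
      using Suc.prems by (intro Ck_on_bilinear[OF bounded_bilinear_mult assms(1)]) auto
    then show "Ck_on k S (\<lambda>x. - (inverse (f x) * dd f x v * inverse (f x)))"
      using Ck_on_linear[OF bounded_linear_minus[OF bounded_linear_ident] assms(1)] by auto
  qed (use dd_eqI[OF D] in auto)
  ultimately show ?case by simp
qed

lemma linear_euclidean_expand:
  fixes v :: "'e::euclidean_space"
  assumes "linear f" shows "f v = (\<Sum>b\<in>Basis. (v \<bullet> b) *\<^sub>R f b)"
proof -
  have "f v = f (\<Sum>b\<in>Basis. (v \<bullet> b) *\<^sub>R b)" by (simp add: euclidean_representation)
  then show ?thesis using assms by (simp add: linear_sum linear_cmul)
qed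

text \<open>The chain rule yields the derivative of \<open>g\<close> in the moving direction
  \<open>dd f x v\<close>, whereas class C^k controls fixed directions only. Expanding that
  direction in the basis separates the two dependences.\<close>

lemma Ck_on_compose:
  fixes f :: "'e::euclidean_space \<Rightarrow> 'f::euclidean_space" and g :: "'f \<Rightarrow> 'h::real_normed_vector"
  assumes "open S" and "f ` S \<subseteq> T" and "Ck_on k S f" "Ck_on k T g"
  shows "Ck_on k S (\<lambda>x. g (f x))"
  using assms(3,4)
proof (induction k arbitrary: g)
  case 0
  then show ?case using assms(2) by (auto intro: continuous_on_compose2)
next
  case (Suc k)
  have D: "((\<lambda>x. g (f x)) has_derivative (\<lambda>v. dd g (f x) (dd f x v))) (at x)" if "x \<in> S" for x
  proof -
    have 1: "(f has_derivative dd f x) (at x)"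
      using Suc.prems(1) that by (simp flip: frechet_derivative_works)
    have "f x \<in> T" using assms(2) that by blast
    then have 2: "(g has_derivative dd g (f x)) (at (f x))"
      using Suc.prems(2) by (simp flip: frechet_derivative_works)
    show ?thesis using has_derivative_compose[OF 1 2] .
  qed
  then have "\<forall>x\<in>S. (\<lambda>x. g (f x)) differentiable (at x)"
    by (auto simp: differentiable_def)
  moreover have "Ck_on k S (\<lambda>x. dd (\<lambda>x. g (f x)) x v)" for v
  proof (rule Ck_on_cong[OF assms(1)])
    show "(\<Sum>b\<in>Basis. (dd f x v \<bullet> b) *\<^sub>R dd g (f x) b) = dd (\<lambda>x. g (f x)) x v" if "x \<in> S" for x
    proof -
      have "f x \<in> T" using assms(2) that by blast
      then have "g differentiable (at (f x))" using Suc.prems(2) by simp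
      from linear_euclidean_expand[OF linear_frechet_derivative[OF this], of "dd f x v"]
      show ?thesis using dd_eqI[OF D[OF that]] by simp
    qed
    have "Ck_on k S (\<lambda>x. dd f x v \<bullet> b)" for b
      by (rule Ck_on_linear[OF bounded_linear_inner_left assms(1)]) (use Suc.prems in simp)
    moreover have "Ck_on k S (\<lambda>x. dd g (f x) b)" for b
      by (rule Suc.IH[OF Ck_on_SucD[OF Suc.prems(1)]]) (use Suc.prems(2) in simp)
    ultimately show "Ck_on k S (\<lambda>x. \<Sum>b\<in>Basis. (dd f x v \<bullet> b) *\<^sub>R dd g (f x) b)"
      by (intro Ck_on_sum[OF assms(1)] Ck_on_bilinear[OF bounded_bilinear_scaleR assms(1)]) simp_all
  qed
  ultimately show ?case by simp
qed

lemma smooth_on_cong: "open S \<Longrightarrow> (\<And>y. y \<in> S \<Longrightarrow> f y = g y) \<Longrightarrow> smooth_on S f \<Longrightarrow> smooth_on S g"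
  unfolding smooth_on_def using Ck_on_cong by blast

lemma smooth_on_subset: "smooth_on S f \<Longrightarrow> T \<subseteq> S \<Longrightarrow> smooth_on T f"
  unfolding smooth_on_def using Ck_on_subset by blast

lemma smooth_on_differentiable: "smooth_on S f \<Longrightarrow> x \<in> S \<Longrightarrow> f differentiable (at x)"
  unfolding smooth_on_def by (meson Ck_on.simps(2))

lemma smooth_on_has_derivative: "smooth_on S f \<Longrightarrow> x \<in> S \<Longrightarrow> (f has_derivative dd f x) (at x)"
  using smooth_on_differentiable by (simp flip: frechet_derivative_works)

lemma smooth_on_dd: "smooth_on S f \<Longrightarrow> smooth_on S (\<lambda>x. dd f x v)"
  unfolding smooth_on_def
proof
  fix k assume "\<forall>k. Ck_on k S f"
  then have "Ck_on (Suc k) S f" by blast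
  then show "Ck_on k S (\<lambda>x. dd f x v)" by simp
qed

lemma smooth_on_const: "smooth_on S (\<lambda>x. c)"
  by (simp add: smooth_on_def Ck_on_const)

lemma smooth_on_linear: "bounded_linear L \<Longrightarrow> open S \<Longrightarrow> smooth_on S f \<Longrightarrow> smooth_on S (\<lambda>x. L (f x))"
  by (simp add: smooth_on_def Ck_on_linear)

lemma smooth_on_add: "open S \<Longrightarrow> smooth_on S f \<Longrightarrow> smooth_on S g \<Longrightarrow> smooth_on S (\<lambda>x. f x + g x)"
  by (simp add: smooth_on_def Ck_on_add)

lemma smooth_on_minus: "open S \<Longrightarrow> smooth_on S f \<Longrightarrow> smooth_on S (\<lambda>x. - f x)"
  by (rule smooth_on_linear[OF bounded_linear_minus[OF bounded_linear_ident]])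

lemma smooth_on_diff: "open S \<Longrightarrow> smooth_on S f \<Longrightarrow> smooth_on S g \<Longrightarrow> smooth_on S (\<lambda>x. f x - g x)"
  using smooth_on_add[of S f "\<lambda>x. - g x"] smooth_on_minus by fastforce

lemma smooth_on_sum:
  "open S \<Longrightarrow> (\<And>i. i \<in> I \<Longrightarrow> smooth_on S (f i)) \<Longrightarrow> smooth_on S (\<lambda>x. \<Sum>i\<in>I. f i x)"
  by (simp add: smooth_on_def Ck_on_sum)

lemma smooth_on_bilinear:
  "bounded_bilinear B \<Longrightarrow> open S \<Longrightarrow> smooth_on S f \<Longrightarrow> smooth_on S g \<Longrightarrow> smooth_on S (\<lambda>x. B (f x) (g x))"
  by (simp add: smooth_on_def Ck_on_bilinear)

lemmas smooth_on_mult = smooth_on_bilinear[OF bounded_bilinear_mult]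
lemmas smooth_on_scaleR = smooth_on_bilinear[OF bounded_bilinear_scaleR]

lemma smooth_on_prod:
  fixes f :: "'i \<Rightarrow> 'e::euclidean_space \<Rightarrow> 'a::real_normed_field"
  assumes "open S" "\<And>i. i \<in> I \<Longrightarrow> smooth_on S (f i)" 
  shows "smooth_on S (\<lambda>x. \<Prod>i\<in>I. f i x)"
  using assms(2)
  by (induction I rule: infinite_finite_induct) (auto simp: smooth_on_const intro!: smooth_on_mult assms(1))

lemma smooth_on_inverse:
  fixes f :: "'e::euclidean_space \<Rightarrow> 'a::real_normed_field"
  shows "open S \<Longrightarrow> (\<And>x. x \<in> S \<Longrightarrow> f x \<noteq> 0) \<Longrightarrow> smooth_on S f \<Longrightarrow> smooth_on S (\<lambda>x. inverse (f x))"
  by (simp add: smooth_on_def Ck_on_inverse)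

lemma smooth_on_compose:
  fixes f :: "'e::euclidean_space \<Rightarrow> 'f::euclidean_space"
  shows "open S \<Longrightarrow> f ` S \<subseteq> T \<Longrightarrow> smooth_on S f \<Longrightarrow> smooth_on T g \<Longrightarrow> smooth_on S (\<lambda>x. g (f x))"
  unfolding smooth_on_def using Ck_on_compose by metis

lemma smooth_on_vecI:
  fixes f :: "'e::euclidean_space \<Rightarrow> complex^'n::finite"
  assumes "open S" "\<And>i. smooth_on S (\<lambda>x. f x $ i)"
  shows "smooth_on S f"
proof -
  have "bounded_linear (axis i :: complex \<Rightarrow> complex^'n)" for i
    by (rule linear_conv_bounded_linear[THEN iffD1]) (auto intro!: linearI simp: axis_def vec_eq_iff)
  then have "smooth_on S (\<lambda>x. \<Sum>i\<in>UNIV. axis i (f x $ i))"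
    using assms by (intro smooth_on_sum smooth_on_linear[of "axis _"]) auto
  moreover have "(\<lambda>x. \<Sum>i\<in>UNIV. axis i (f x $ i)) = f"
    by (auto simp: vec_eq_iff fun_eq_iff axis_def if_distrib sum.delta cong: if_cong)
  ultimately show ?thesis by simp
qed

section \<open>Symmetry of second derivatives\<close>

lemma second_difference:
  fixes f :: "'e::euclidean_space \<Rightarrow> real"
  assumes f: "smooth_on S f" and S: "ball x d \<subseteq> S"
    and e: "0 < e" "e * (norm u + norm v) < d"
  obtains y where "norm (y - x) \<le> e * (norm u + norm v)"
    and "f (x + e *\<^sub>R u + e *\<^sub>R v) - f (x + e *\<^sub>R u) - f (x + e *\<^sub>R v) + f x = e\<^sup>2 * dd (\<lambda>z. dd f z u) y v"
proof -
  have n: "norm (s *\<^sub>R u + t *\<^sub>R v) \<le> e * (norm u + norm v)" if "0 \<le> s" "s \<le> e" "0 \<le> t" "t \<le> e" for s t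
  proof -
    have "norm (s *\<^sub>R u + t *\<^sub>R v) \<le> s * norm u + t * norm v"
      using that norm_triangle_ineq[of "s *\<^sub>R u" "t *\<^sub>R v"] by simp
    also have "\<dots> \<le> e * norm u + e * norm v"
      using that by (intro add_mono mult_right_mono) auto
    finally show ?thesis by (simp add: algebra_simps)
  qed
  have inS: "x + s *\<^sub>R u + t *\<^sub>R v \<in> S" if "0 \<le> s" "s \<le> e" "0 \<le> t" "t \<le> e" for s t
  proof -
    have "dist x (x + s *\<^sub>R u + t *\<^sub>R v) = norm (s *\<^sub>R u + t *\<^sub>R v)"
      by (simp add: dist_norm norm_minus_commute add.assoc flip: norm_minus_cancel[of "s *\<^sub>R u + t *\<^sub>R v"])
    then show ?thesis using n[OF that] e(2) S by (auto simp: subset_iff)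
  qed
  have line: "((\<lambda>s. F (a + s *\<^sub>R w)) has_real_derivative dd F (a + s *\<^sub>R w) w) (at s)"
    if "smooth_on S F" "a + s *\<^sub>R w \<in> S" for F :: "'e \<Rightarrow> real" and a w s
  proof -
    have D: "(F has_derivative dd F (a + s *\<^sub>R w)) (at (a + s *\<^sub>R w))"
      using smooth_on_has_derivative that by blast
    have "((\<lambda>s. F (a + s *\<^sub>R w)) has_derivative (\<lambda>h. dd F (a + s *\<^sub>R w) (h *\<^sub>R w))) (at s)"
      by (rule has_derivative_compose[where g = F and f = "\<lambda>s. a + s *\<^sub>R w", OF _ D])
        (auto intro!: derivative_eq_intros)
    then show ?thesis
      using linear_cmul[OF linear_frechet_derivative[OF smooth_on_differentiable[OF that]]]
      by (simp add: has_field_derivative_def mult_commute_abs)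
  qed
  \<comment> \<open>The mean value theorem for \<open>p\<close> in the variable \<open>s\<close>
    produces a derivative along \<open>u\<close>; applied again to the remaining difference along
    \<open>v\<close> it produces the mixed derivative.\<close>
  define p where "p s = f (x + s *\<^sub>R u + e *\<^sub>R v) - f (x + s *\<^sub>R u)" for s
  have p': "(p has_real_derivative dd f (x + s *\<^sub>R u + e *\<^sub>R v) u - dd f (x + s *\<^sub>R u) u) (at s)"
    if "0 \<le> s" "s \<le> e" for s
  proof -
    have 1: "(x + e *\<^sub>R v) + s *\<^sub>R u \<in> S" "x + s *\<^sub>R u \<in> S"
      using inS[of s e] inS[of s 0] that e(1) by (auto simp: algebra_simps)
    show ?thesis
      using DERIV_diff[OF line[OF f 1(1)] line[OF f 1(2)]] unfolding p_def by (simp add: algebra_simps)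
  qed
  obtain s where s: "0 < s" "s < e" "p e - p 0 = (e - 0) * (dd f (x + s *\<^sub>R u + e *\<^sub>R v) u - dd f (x + s *\<^sub>R u) u)"
    using MVT2[OF e(1), of p "\<lambda>s. dd f (x + s *\<^sub>R u + e *\<^sub>R v) u - dd f (x + s *\<^sub>R u) u"] p' by auto
  have "((\<lambda>t. dd f (x + s *\<^sub>R u + t *\<^sub>R v) u) has_real_derivative
      dd (\<lambda>z. dd f z u) (x + s *\<^sub>R u + t *\<^sub>R v) v) (at t)" if "0 \<le> t" "t \<le> e" for t
    using line[OF smooth_on_dd[OF f, of u]] inS[of s t] s that by auto
  then obtain t where t: "0 < t" "t < e" 
    "dd f (x + s *\<^sub>R u + e *\<^sub>R v) u - dd f (x + s *\<^sub>R u + 0 *\<^sub>R v) u = (e - 0) * dd (\<lambda>z. dd f z u) (x + s *\<^sub>R u + t *\<^sub>R v) v"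
    using MVT2[OF e(1), of "\<lambda>t. dd f (x + s *\<^sub>R u + t *\<^sub>R v) u" "\<lambda>t. dd (\<lambda>z. dd f z u) (x + s *\<^sub>R u + t *\<^sub>R v) v"] by blast
  show thesis
  proof (rule that[of "x + s *\<^sub>R u + t *\<^sub>R v"])
    show "norm (x + s *\<^sub>R u + t *\<^sub>R v - x) \<le> e * (norm u + norm v)"
      using n[of s t] s t by (simp add: add.assoc)
    show "f (x + e *\<^sub>R u + e *\<^sub>R v) - f (x + e *\<^sub>R u) - f (x + e *\<^sub>R v) + f x =
      e\<^sup>2 * dd (\<lambda>z. dd f z u) (x + s *\<^sub>R u + t *\<^sub>R v) v"
      using s(3) t(3) by (simp add: p_def power2_eq_square)
  qed
qed

text \<open>The second difference is symmetric in \<open>u\<close> and \<open>v\<close>, so the two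
  mixed derivatives agree at two points as close to \<open>x\<close> as desired; continuity of both
  excludes different values at \<open>x\<close>.\<close>

lemma dd_commute_real:
  fixes f :: "'e::euclidean_space \<Rightarrow> real"
  assumes f: "smooth_on S f" and S: "open S" "x \<in> S"
  shows "dd (\<lambda>z. dd f z u) x v = dd (\<lambda>z. dd f z v) x u"
proof (rule ccontr)
  define A where "A z = dd (\<lambda>z. dd f z u) z v" for z
  define B where "B z = dd (\<lambda>z. dd f z v) z u" for z
  assume "\<not> ?thesis"
  then have ne: "A x \<noteq> B x" by (simp add: A_def B_def)
  have cont: "continuous (at x) A" "continuous (at x) B"
    unfolding A_def B_def
    using S smooth_on_differentiable[OF smooth_on_dd[OF smooth_on_dd[OF f]]]
    by (auto intro: differentiable_imp_continuous_within)
  define \<epsilon> where "\<epsilon> = \<bar>A x - B x\<bar> / 2"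
  have "\<epsilon> > 0" using ne by (simp add: \<epsilon>_def)
  then obtain d1 d2 where d: "d1 > 0" "\<And>y. dist y x < d1 \<Longrightarrow> dist (A y) (A x) < \<epsilon>"
     "d2 > 0" "\<And>y. dist y x < d2 \<Longrightarrow> dist (B y) (B x) < \<epsilon>"
    using cont unfolding continuous_at_eps_delta dist_norm by metis
  obtain d3 where d3: "d3 > 0" "ball x d3 \<subseteq> S" using S openE by blast
  define d where "d = min d1 (min d2 d3)"
  have dpos: "d > 0" using d d3 by (simp add: d_def)
  have ball: "ball x d \<subseteq> S" using d3 by (auto simp: d_def)
  \<comment> \<open>The added 1 keeps the denominator positive when both directions vanish and makes
    the bound by \<open>d\<close> strict.\<close>
  define e where "e = d / (norm u + norm v + 1)"
  have pos: "norm u + norm v + 1 > 0" by (simp add: add_nonneg_pos)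
  have epos: "e > 0" using dpos pos by (simp add: e_def)
  have "e * (norm u + norm v) = d * ((norm u + norm v) / (norm u + norm v + 1))" by (simp add: e_def)
  also have "\<dots> < d * 1" using dpos pos by (intro mult_strict_left_mono) (auto simp: divide_less_eq)
  finally have elt: "e * (norm u + norm v) < d" by simp
  obtain y where y: "norm (y - x) \<le> e * (norm u + norm v)"
    "f (x + e *\<^sub>R u + e *\<^sub>R v) - f (x + e *\<^sub>R u) - f (x + e *\<^sub>R v) + f x = e\<^sup>2 * A y"
    using second_difference[OF f ball epos elt] unfolding A_def by blast
  have elt': "e * (norm v + norm u) < d" using elt by (simp add: add.commute)
  obtain y' where y': "norm (y' - x) \<le> e * (norm v + norm u)"
    "f (x + e *\<^sub>R v + e *\<^sub>R u) - f (x + e *\<^sub>R v) - f (x + e *\<^sub>R u) + f x = e\<^sup>2 * B y'"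
    using second_difference[OF f ball epos elt'] unfolding B_def by blast
  have "e\<^sup>2 * A y = e\<^sup>2 * B y'" using y(2) y'(2) by (simp add: algebra_simps)
  then have eq: "A y = B y'" using epos by simp
  have "dist y x < d1" "dist y' x < d2" using y(1) y'(1) elt elt' by (auto simp: dist_norm d_def)
  then have "\<bar>A y - A x\<bar> < \<epsilon>" "\<bar>B y' - B x\<bar> < \<epsilon>" using d by (auto simp: dist_real_def)
  then have "\<bar>A x - B x\<bar> < 2 * \<epsilon>" using eq by linarith
  then show False by (simp add: \<epsilon>_def)
qed

lemma dd_linear_image:
  assumes "bounded_linear L" "f differentiable (at x)"
  shows "dd (\<lambda>z. L (f z)) x v = L (dd f x v)"
  by (rule dd_eqI[OF bounded_linear.has_derivative[OF assms(1)]])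
    (use assms(2) in \<open>simp flip: frechet_derivative_works\<close>)

lemma dd_commute:
  fixes f :: "'e::euclidean_space \<Rightarrow> 'f::euclidean_space"
  assumes f: "smooth_on S f" and S: "open S" "x \<in> S"
  shows "dd (\<lambda>z. dd f z u) x v = dd (\<lambda>z. dd f z v) x u"
proof (rule euclidean_eqI)
  fix b :: 'f
  note L = bounded_linear_inner_left[of b]
  have *: "dd (\<lambda>z. dd (\<lambda>z. f z \<bullet> b) z u) x v = dd (\<lambda>z. dd f z u) x v \<bullet> b" for u v
  proof -
    have "dd (\<lambda>z. dd (\<lambda>z. f z \<bullet> b) z u) x v = dd (\<lambda>z. dd f z u \<bullet> b) x v"
      by (rule dd_cong[OF S]) (rule dd_linear_image[OF L smooth_on_differentiable[OF f]])
    also have "\<dots> = dd (\<lambda>z. dd f z u) x v \<bullet> b"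
      using dd_linear_image[OF L smooth_on_differentiable[OF smooth_on_dd[OF f] S(2)]] .
    finally show ?thesis .
  qed
  show "dd (\<lambda>z. dd f z u) x v \<bullet> b = dd (\<lambda>z. dd f z v) x u \<bullet> b"
    using dd_commute_real[OF smooth_on_linear[OF L S(1) f] S, of u v] * by simp
qed

text \<open>A basis expansion reduces the rule to products of scalar and vector functions, so
  differentiability is needed only for each fixed vector argument. In this form differentials and
  Christoffel symbols are applied to moving vectors.\<close>

lemma has_derivative_linear_family:
  fixes Y :: "'e::real_normed_vector \<Rightarrow> 'f::euclidean_space" and F :: "'e \<Rightarrow> 'f \<Rightarrow> 'h::real_normed_vector"
  assumes S: "open S" "x \<in> S" and lin: "\<And>z. z \<in> S \<Longrightarrow> linear (F z)"
    and F: "\<And>y. (\<lambda>z. F z y) differentiable (at x)" and Y: "Y differentiable (at x)"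
  shows "((\<lambda>z. F z (Y z)) has_derivative (\<lambda>v. dd (\<lambda>z. F z (Y x)) x v + F x (dd Y x v))) (at x)"
proof -
  have F': "((\<lambda>z. F z y) has_derivative (\<lambda>v. dd (\<lambda>z. F z y) x v)) (at x)" for y
    using F by (simp flip: frechet_derivative_works)
  have Y': "(Y has_derivative (\<lambda>v. dd Y x v)) (at x)" using Y by (simp flip: frechet_derivative_works)
  have "((\<lambda>z. \<Sum>b\<in>Basis. (Y z \<bullet> b) *\<^sub>R F z b) has_derivative 
    (\<lambda>v. \<Sum>b\<in>Basis. (Y x \<bullet> b) *\<^sub>R dd (\<lambda>z. F z b) x v + (dd Y x v \<bullet> b) *\<^sub>R F x b)) (at x)"
    by (intro has_derivative_sum has_derivative_scaleR F' bounded_linear.has_derivative[OF bounded_linear_inner_left Y'])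
  moreover have "(\<lambda>v. \<Sum>b\<in>Basis. (Y x \<bullet> b) *\<^sub>R dd (\<lambda>z. F z b) x v + (dd Y x v \<bullet> b) *\<^sub>R F x b)
    = (\<lambda>v. dd (\<lambda>z. F z (Y x)) x v + F x (dd Y x v))"
  proof
    fix v
    have "dd (\<lambda>z. F z (Y x)) x v = (\<Sum>b\<in>Basis. (Y x \<bullet> b) *\<^sub>R dd (\<lambda>z. F z b) x v)"
    proof (rule dd_eqI)
      have "((\<lambda>z. \<Sum>b\<in>Basis. (Y x \<bullet> b) *\<^sub>R F z b) has_derivative
        (\<lambda>v. \<Sum>b\<in>Basis. (Y x \<bullet> b) *\<^sub>R dd (\<lambda>z. F z b) x v)) (at x)"
        by (intro has_derivative_sum has_derivative_scaleR_right F')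
      then show "((\<lambda>z. F z (Y x)) has_derivative (\<lambda>v. \<Sum>b\<in>Basis. (Y x \<bullet> b) *\<^sub>R dd (\<lambda>z. F z b) x v)) (at x)"
        by (rule has_derivative_transform_within_open[OF _ S]) (use linear_euclidean_expand[OF lin] in auto)
    qed
    then show "(\<Sum>b\<in>Basis. (Y x \<bullet> b) *\<^sub>R dd (\<lambda>z. F z b) x v + (dd Y x v \<bullet> b) *\<^sub>R F x b)
        = dd (\<lambda>z. F z (Y x)) x v + F x (dd Y x v)"
      using linear_euclidean_expand[OF lin[OF S(2)], of "dd Y x v"] by (simp add: sum.distrib)
  qed
  ultimately show ?thesis
    using has_derivative_transform_within_open[OF _ S, where f="\<lambda>z. \<Sum>b\<in>Basis. (Y z \<bullet> b) *\<^sub>R F z b"]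
      linear_euclidean_expand[OF lin] by fastforce
qed

lemma smooth_on_linear_family:
  fixes Y :: "'e::euclidean_space \<Rightarrow> 'f::euclidean_space" and F :: "'e \<Rightarrow> 'f \<Rightarrow> 'h::real_normed_vector"
  assumes S: "open S" and lin: "\<And>z. z \<in> S \<Longrightarrow> linear (F z)"
    and F: "\<And>y. smooth_on S (\<lambda>z. F z y)" and Y: "smooth_on S Y"
  shows "smooth_on S (\<lambda>z. F z (Y z))"
proof (rule smooth_on_cong[OF S])
  show "smooth_on S (\<lambda>z. \<Sum>b\<in>Basis. (Y z \<bullet> b) *\<^sub>R F z b)"
    by (intro smooth_on_sum smooth_on_scaleR S F smooth_on_linear[OF bounded_linear_inner_left] Y)
qed (use linear_euclidean_expand[OF lin] in auto)

section \<open>Wirtinger derivatives\<close>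

text \<open>For \<open>s = -\<i>\<close> and \<open>s = \<i>\<close> these are the directional Wirtinger derivatives, complex linear
  and antilinear in the direction \<open>v\<close>, respectively.\<close>

definition pd :: "complex \<Rightarrow> complex^'n \<Rightarrow> (complex^'n::finite \<Rightarrow> complex) \<Rightarrow> complex^'n \<Rightarrow> complex" where
  "pd s v f z = (dd f z v + s * dd f z (\<i> *s v)) / 2"

abbreviation "del \<equiv> pd (- \<i>)"
abbreviation "delb \<equiv> pd \<i>"

definition pdv :: "complex \<Rightarrow> complex^'n \<Rightarrow> (complex^'n::finite \<Rightarrow> complex^'m) \<Rightarrow> complex^'n \<Rightarrow> complex^'m" where
  "pdv s v Y z = (\<chi> b. pd s v (\<lambda>z. Y z $ b) z)"

definition clin :: "(complex^'n \<Rightarrow> complex) \<Rightarrow> bool" where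
  "clin F \<longleftrightarrow> (\<forall>x y. F (x + y) = F x + F y) \<and> (\<forall>a x. F (a *s x) = a * F x)"

definition alin :: "(complex^'n \<Rightarrow> complex) \<Rightarrow> bool" where
  "alin F \<longleftrightarrow> (\<forall>x y. F (x + y) = F x + F y) \<and> (\<forall>a x. F (a *s x) = cnj a * F x)"

abbreviation ax :: "'n::finite \<Rightarrow> complex^'n" where "ax b \<equiv> axis b 1"

lemma scaleR_eq_vector_smult: "r *\<^sub>R (x::complex^'n) = complex_of_real r *s x"
  by (simp add: vec_eq_iff scaleR_conv_of_real[where 'a = complex])

lemma smult_decomp: "a *s x = Re a *\<^sub>R x + Im a *\<^sub>R (\<i> *s (x :: complex^'n))"
proof -
  have "a = complex_of_real (Re a) + complex_of_real (Im a) * \<i>"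
    using complex_eq[of a] by (simp add: mult.commute)
  then have "a *s x = (complex_of_real (Re a) + complex_of_real (Im a) * \<i>) *s x" by simp
  then show ?thesis by (simp add: vector_sadd_rdistrib scaleR_eq_vector_smult vector_smult_assoc)
qed

lemma axis_expand: "(\<Sum>b\<in>UNIV. x $ b *s ax b) = (x :: complex^'n::finite)"
  by (simp add: basis_expansion)

lemma clin_add: "clin F \<Longrightarrow> F (x + y) = F x + F y" and clin_scale: "clin F \<Longrightarrow> F (a *s x) = a * F x"
  by (auto simp: clin_def)

lemma alin_add: "alin F \<Longrightarrow> F (x + y) = F x + F y" and alin_scale: "alin F \<Longrightarrow> F (a *s x) = cnj a * F x"
  by (auto simp: alin_def)

lemma clin_zero: "clin F \<Longrightarrow> F 0 = 0"
  using clin_scale[of F 0 0] by simp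

lemma alin_zero: "alin F \<Longrightarrow> F 0 = 0"
  using alin_scale[of F 0 0] by simp

lemma clin_minus: "clin F \<Longrightarrow> F (- x) = - F x"
  using clin_scale[of F "-1" x] by simp

lemma alin_minus: "alin F \<Longrightarrow> F (- x) = - F x"
  using alin_scale[of F "-1" x] by simp

lemma clin_diff: "clin F \<Longrightarrow> F (x - y) = F x - F y"
  using clin_add[of F x "- y"] clin_minus by simp

lemma alin_diff: "alin F \<Longrightarrow> F (x - y) = F x - F y"
  using alin_add[of F x "- y"] alin_minus by simp

lemma clin_sum: "clin F \<Longrightarrow> F (\<Sum>i\<in>I. f i) = (\<Sum>i\<in>I. F (f i))"
  by (induction I rule: infinite_finite_induct) (auto simp: clin_zero clin_add)

lemma alin_sum: "alin F \<Longrightarrow> F (\<Sum>i\<in>I. f i) = (\<Sum>i\<in>I. F (f i))"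
  by (induction I rule: infinite_finite_induct) (auto simp: alin_zero alin_add)

lemma clin_expand: "clin F \<Longrightarrow> F x = (\<Sum>b\<in>UNIV. x $ b * F (ax b))"
  using clin_sum[of F "\<lambda>b. x $ b *s ax b" UNIV] by (simp add: axis_expand clin_scale)

lemma alin_expand: "alin F \<Longrightarrow> F x = (\<Sum>b\<in>UNIV. cnj (x $ b) * F (ax b))"
  using alin_sum[of F "\<lambda>b. x $ b *s ax b" UNIV] by (simp add: axis_expand alin_scale)

lemma alin_clin_cnj: "alin F \<Longrightarrow> clin (\<lambda>x. cnj (F x))" and clin_alin_cnj: "clin F \<Longrightarrow> alin (\<lambda>x. cnj (F x))"
  by (auto simp: alin_def clin_def)

text \<open>Both sides are the same double sum over matrix entries. Its use is to remove connection
  terms from traces.\<close>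

lemma trace_commute:
  assumes A: "\<And>b. clin (\<lambda>x. A x $ b)" and B: "\<And>b. clin (\<lambda>x. B x $ b)"
  shows "(\<Sum>b\<in>UNIV. A (B (ax b)) $ b) = (\<Sum>b\<in>UNIV. B (A (ax b)) $ b)"
proof -
  have "(\<Sum>b\<in>UNIV. A (B (ax b)) $ b) = (\<Sum>b\<in>UNIV. \<Sum>c\<in>UNIV. B (ax b) $ c * A (ax c) $ b)"
    by (intro sum.cong refl clin_expand[OF A])
  also have "\<dots> = (\<Sum>c\<in>UNIV. \<Sum>b\<in>UNIV. A (ax c) $ b * B (ax b) $ c)"
    by (subst sum.swap) (simp add: mult.commute)
  also have "\<dots> = (\<Sum>c\<in>UNIV. B (A (ax c)) $ c)"
    by (intro sum.cong refl clin_expand[OF B, symmetric])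
  finally show ?thesis .
qed

lemma dd_linear:
  assumes "f differentiable (at x)"
  shows "dd f x (u + v) = dd f x u + dd f x v" "dd f x (a *\<^sub>R v) = a *\<^sub>R dd f x v" "dd f x (- v) = - dd f x v"
  using linear_frechet_derivative[OF assms] by (simp_all add: linear_add linear_cmul linear_neg)

lemma smooth_on_cnj:
  "open S \<Longrightarrow> smooth_on S f \<Longrightarrow> smooth_on S (\<lambda>x. cnj (f x))"
  by (rule smooth_on_linear[OF bounded_linear_cnj])

lemma dd_cnj: "f differentiable (at x) \<Longrightarrow> dd (\<lambda>z. cnj (f z)) x v = cnj (dd f x v)"
  by (rule dd_linear_image[OF bounded_linear_cnj])

lemma smooth_on_pd: "open S \<Longrightarrow> smooth_on S f \<Longrightarrow> smooth_on S (pd s v f)"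
  unfolding pd_def [abs_def] divide_inverse
  by (intro smooth_on_mult smooth_on_add smooth_on_const smooth_on_dd)

lemma pd_cong: "open S \<Longrightarrow> z \<in> S \<Longrightarrow> (\<And>z. z \<in> S \<Longrightarrow> f z = g z) \<Longrightarrow> pd s v f z = pd s v g z"
  unfolding pd_def using dd_cong[of S z f g] by simp

lemma pd_const [simp]: "pd s v (\<lambda>z. c) z = 0"
  by (simp add: pd_def frechet_derivative_const)

lemma dd_split: "dd f z v = del v f z + delb v f z"
  by (simp add: pd_def field_simps)

context
  fixes f g :: "complex^'n::finite \<Rightarrow> complex" and z
  assumes f: "f differentiable (at z)" and g: "g differentiable (at z)"
begin

lemma
  shows dd_add: "dd (\<lambda>z. f z + g z) z v = dd f z v + dd g z v"
    and dd_diff: "dd (\<lambda>z. f z - g z) z v = dd f z v - dd g z v"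
    and dd_mult: "dd (\<lambda>z. f z * g z) z v = dd f z v * g z + f z * dd g z v"
  using f g unfolding frechet_derivative_works
  by (auto intro!: dd_eqI derivative_eq_intros)

lemma pd_add: "pd s v (\<lambda>z. f z + g z) z = pd s v f z + pd s v g z"
  and pd_diff: "pd s v (\<lambda>z. f z - g z) z = pd s v f z - pd s v g z"
  and pd_mult: "pd s v (\<lambda>z. f z * g z) z = pd s v f z * g z + f z * pd s v g z"
  by (simp_all add: pd_def dd_add dd_diff dd_mult field_simps)

end

context
  fixes f :: "complex^'n::finite \<Rightarrow> complex" and z
  assumes f: "f differentiable (at z)"
begin

lemma pd_cmult: "pd s v (\<lambda>z. c * f z) z = c * pd s v f z"
  using pd_mult[of "\<lambda>z. c" z f] f by simp

lemma pd_minus: "pd s v (\<lambda>z. - f z) z = - pd s v f z"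
  using pd_cmult[of s v "-1"] by simp

lemma pd_cnj: "pd s v (\<lambda>z. cnj (f z)) z = cnj (pd (cnj s) v f z)"
  by (simp add: pd_def dd_cnj f)

lemma pd_dir_add: "pd s (u + v) f z = pd s u f z + pd s v f z"
  by (simp add: pd_def dd_linear[OF f] vector_add_ldistrib field_simps)

lemma dd_smult: "dd f z (a *s v) = complex_of_real (Re a) * dd f z v + complex_of_real (Im a) * dd f z (\<i> *s v)"
  unfolding smult_decomp[of a] by (simp only: dd_linear[OF f]) (simp add: scaleR_conv_of_real)

text \<open>The differential is only real linear; replacing \<open>v\<close> by \<i>v in
  \<open>dd f z v - \<i> * dd f z (\<i> *s v)\<close> exchanges the two terms up to the factor
  \<i>.\<close>

lemma clin_del: "clin (\<lambda>v. del v f z)"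
  unfolding clin_def
proof (intro conjI allI)
  fix a v
  have eq: "dd f z ((\<i> * a) *s v) = - complex_of_real (Im a) * dd f z v + complex_of_real (Re a) * dd f z (\<i> *s v)"
    using dd_smult[of "\<i> * a" v] by simp
  have "del (a *s v) f z = (complex_of_real (Re a) + \<i> * complex_of_real (Im a)) * del v f z"
    unfolding pd_def vector_smult_assoc eq dd_smult[of a v] by (simp add: field_simps)
  then show "del (a *s v) f z = a * del v f z" using complex_eq[of a] by simp
qed (rule pd_dir_add)

lemma alin_delb: "alin (\<lambda>v. delb v f z)"
  unfolding alin_def
proof (intro conjI allI)
  fix a v
  have eq: "dd f z ((\<i> * a) *s v) = - complex_of_real (Im a) * dd f z v + complex_of_real (Re a) * dd f z (\<i> *s v)"
    using dd_smult[of "\<i> * a" v] by simp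
  have "delb (a *s v) f z = (complex_of_real (Re a) - \<i> * complex_of_real (Im a)) * delb v f z"
    unfolding pd_def vector_smult_assoc eq dd_smult[of a v] by (simp add: field_simps)
  moreover have "cnj a = complex_of_real (Re a) - \<i> * complex_of_real (Im a)"
    by (simp add: complex_eq_iff)
  ultimately show "delb (a *s v) f z = cnj a * delb v f z" by simp
qed (rule pd_dir_add)

end

lemma pd_sum:
  fixes f :: "'i \<Rightarrow> complex^'n::finite \<Rightarrow> complex"
  assumes S: "open S" "z \<in> S" and f: "\<And>i. i \<in> I \<Longrightarrow> smooth_on S (f i)"
  shows "pd s v (\<lambda>z. \<Sum>i\<in>I. f i z) z = (\<Sum>i\<in>I. pd s v (f i) z)"
  using f
proof (induction I rule: infinite_finite_induct)
  case (insert i I)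
  then have "pd s v (\<lambda>z. f i z + (\<Sum>i\<in>I. f i z)) z = pd s v (f i) z + pd s v (\<lambda>z. \<Sum>i\<in>I. f i z) z"
    using S by (intro pd_add) (auto intro!: smooth_on_differentiable[of S] smooth_on_sum)
  then show ?case using insert by simp
qed auto

text \<open>Everything expands into mixed real derivatives in the directions of u, \<i>u and v,
  \<i>v, each of them symmetric. As \<open>s\<close> and \<open>s'\<close> are independent, all type
  combinations are covered at once.\<close>

lemma pd_commute:
  assumes f: "smooth_on S f" and S: "open S" "z \<in> S"
  shows "pd s u (pd s' v f) z = pd s' v (pd s u f) z"
proof -
  note d = smooth_on_differentiable[OF _ S(2)] smooth_on_dd f
  have *: "dd (pd s v f) z w = (dd (\<lambda>z. dd f z v) z w + s * dd (\<lambda>z. dd f z (\<i> *s v)) z w) / 2" for s v w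
  proof (rule dd_eqI)
    have "((\<lambda>z. dd f z v) has_derivative dd (\<lambda>z. dd f z v) z) (at z)" for v
      using smooth_on_has_derivative[OF smooth_on_dd[OF f] S(2)] .
    then show "(pd s v f has_derivative (\<lambda>w. (dd (\<lambda>z. dd f z v) z w + s * dd (\<lambda>z. dd f z (\<i> *s v)) z w) / 2)) (at z)"
      unfolding pd_def [abs_def] by (auto intro!: derivative_eq_intros)
  qed
  have c: "dd (\<lambda>z. dd f z a) z b = dd (\<lambda>z. dd f z b) z a" for a b
    by (rule dd_commute[OF f S])
  show ?thesis
    unfolding pd_def[of _ _ "pd _ _ _"] *
    using c[of v u] c[of v "\<i> *s u"] c[of "\<i> *s v" u] c[of "\<i> *s v" "\<i> *s u"]
    by (simp add: field_simps)
qed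

section \<open>Wirtinger product rules for linear and antilinear families\<close>

locale open_domain =
  fixes S :: "(complex^'n::finite) set"
  assumes open_S: "open S"
begin

abbreviation sm :: "(complex^'n \<Rightarrow> complex) \<Rightarrow> bool" where "sm f \<equiv> smooth_on S f"

lemma sm_diff: "sm f \<Longrightarrow> z \<in> S \<Longrightarrow> f differentiable (at z)"
  using smooth_on_differentiable .

lemmas sm_intros = smooth_on_const smooth_on_add[OF open_S] smooth_on_diff[OF open_S] smooth_on_minus[OF open_S]
  smooth_on_mult[OF open_S] smooth_on_sum[OF open_S] smooth_on_cnj[OF open_S] smooth_on_pd[OF open_S]

lemma sm_pdv: "(\<And>b. sm (\<lambda>z. Y z $ b)) \<Longrightarrow> sm (\<lambda>z. pdv s v Y z $ b)"
  by (simp add: pdv_def sm_intros)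

lemma sm_clin:
  assumes "\<And>z. z \<in> S \<Longrightarrow> clin (F z)" "\<And>x. sm (\<lambda>z. F z x)" "\<And>b. sm (\<lambda>z. Y z $ b)"
  shows "sm (\<lambda>z. F z (Y z))"
  by (rule smooth_on_cong[OF open_S, of "\<lambda>z. \<Sum>b\<in>UNIV. Y z $ b * F z (ax b)"])
    (use assms in \<open>auto intro!: sm_intros simp flip: clin_expand\<close>)

lemma sm_alin:
  assumes "\<And>z. z \<in> S \<Longrightarrow> alin (F z)" "\<And>x. sm (\<lambda>z. F z x)" "\<And>b. sm (\<lambda>z. Y z $ b)"
  shows "sm (\<lambda>z. F z (Y z))"
  by (rule smooth_on_cong[OF open_S, of "\<lambda>z. \<Sum>b\<in>UNIV. cnj (Y z $ b) * F z (ax b)"])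
    (use assms in \<open>auto intro!: sm_intros simp flip: alin_expand\<close>)

lemma pd_clin:
  assumes F: "\<And>z. z \<in> S \<Longrightarrow> clin (F z)" "\<And>x. sm (\<lambda>z. F z x)" and Y: "\<And>b. sm (\<lambda>z. Y z $ b)" and z: "z \<in> S"
  shows "pd s v (\<lambda>z. F z (Y z)) z = pd s v (\<lambda>w. F w (Y z)) z + F z (pdv s v Y z)"
proof -
  have "pd s v (\<lambda>z. F z (Y z)) z = pd s v (\<lambda>z. \<Sum>b\<in>UNIV. Y z $ b * F z (ax b)) z"
    by (rule pd_cong[OF open_S z]) (rule clin_expand[OF F(1)])
  also have "\<dots> = (\<Sum>b\<in>UNIV. pd s v (\<lambda>z. Y z $ b * F z (ax b)) z)"
    by (rule pd_sum[OF open_S z]) (intro sm_intros F Y)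
  also have "\<dots> = (\<Sum>b\<in>UNIV. pd s v (\<lambda>z. Y z $ b) z * F z (ax b) + Y z $ b * pd s v (\<lambda>z. F z (ax b)) z)"
    using pd_mult[OF sm_diff[OF Y z] sm_diff[OF F(2) z]] by simp
  also have "\<dots> = (\<Sum>b\<in>UNIV. pd s v (\<lambda>z. Y z $ b) z * F z (ax b)) + (\<Sum>b\<in>UNIV. Y z $ b * pd s v (\<lambda>z. F z (ax b)) z)"
    by (simp add: sum.distrib)
  also have "(\<Sum>b\<in>UNIV. pd s v (\<lambda>z. Y z $ b) z * F z (ax b)) = F z (pdv s v Y z)"
    using clin_expand[OF F(1)[OF z], of "pdv s v Y z"] by (simp add: pdv_def)
  also have "(\<Sum>b\<in>UNIV. Y z $ b * pd s v (\<lambda>z. F z (ax b)) z) = (\<Sum>b\<in>UNIV. pd s v (\<lambda>w. Y z $ b * F w (ax b)) z)"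
    using pd_cmult[OF sm_diff[OF F(2) z]] by simp
  also have "\<dots> = pd s v (\<lambda>w. \<Sum>b\<in>UNIV. Y z $ b * F w (ax b)) z"
    by (rule pd_sum[OF open_S z, symmetric]) (intro sm_intros F)
  also have "\<dots> = pd s v (\<lambda>w. F w (Y z)) z"
    by (rule pd_cong[OF open_S z]) (rule clin_expand[OF F(1), symmetric])
  finally show ?thesis by simp
qed

text \<open>Conjugation makes \<open>F z\<close> complex linear and turns \<open>pd s\<close> into
  \<open>pd (cnj s)\<close>, so \<open>pd_clin\<close> applies. Hence the moving vector in an
  antilinear slot is differentiated by the conjugate operator.\<close>

lemma pd_alin:
  assumes F: "\<And>z. z \<in> S \<Longrightarrow> alin (F z)" "\<And>x. sm (\<lambda>z. F z x)" and Y: "\<And>b. sm (\<lambda>z. Y z $ b)" and z: "z \<in> S"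
  shows "pd s v (\<lambda>z. F z (Y z)) z = pd s v (\<lambda>w. F w (Y z)) z + F z (pdv (cnj s) v Y z)"
proof -
  have sm': "sm (\<lambda>z. F z (Y z))" using F Y by (rule sm_alin)
  have 1: "pd (cnj s) v (\<lambda>z. cnj (F z (Y z))) z = pd (cnj s) v (\<lambda>w. cnj (F w (Y z))) z + cnj (F z (pdv (cnj s) v Y z))"
    by (rule pd_clin) (use F Y z in \<open>auto intro!: sm_intros alin_clin_cnj\<close>)
  have "cnj (pd s v (\<lambda>z. F z (Y z)) z) = pd (cnj s) v (\<lambda>z. cnj (F z (Y z))) z"
    using pd_cnj[OF sm_diff[OF sm' z], of "cnj s" v] by simp
  also have "\<dots> = cnj (pd s v (\<lambda>w. F w (Y z)) z + F z (pdv (cnj s) v Y z))"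
    unfolding 1 using pd_cnj[OF sm_diff[OF F(2) z], of "cnj s" v] by simp
  finally show ?thesis by (simp only: complex_cnj_cancel_iff)
qed

end

section \<open>Kaehler metrics on open subsets of complex coordinate space\<close>

text \<open>Only the (1,0)-half of metric compatibility is assumed; its conjugate is
  \<open>h_compatb\<close>. Symmetry of \<open>G\<close> is vanishing torsion. Complex linearity in
  the second slot, which expresses that J is parallel, follows from linearity in the first by this
  symmetry.\<close>

locale kaehler_domain = open_domain S for S :: "(complex^'n::finite) set" +
  fixes h :: "complex^'n \<Rightarrow> complex^'n \<Rightarrow> complex^'n \<Rightarrow> complex"
    and G :: "complex^'n \<Rightarrow> complex^'n \<Rightarrow> complex^'n \<Rightarrow> complex^'n"
  assumes h_sm: "sm (\<lambda>z. h z x y)"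
    and G_sm: "sm (\<lambda>z. G z x y $ b)"
    and h_clin: "z \<in> S \<Longrightarrow> clin (\<lambda>x. h z x y)"
    and h_herm: "z \<in> S \<Longrightarrow> h z y x = cnj (h z x y)"
    and h_pos: "z \<in> S \<Longrightarrow> x \<noteq> 0 \<Longrightarrow> Re (h z x x) > 0"
    and G_sym: "z \<in> S \<Longrightarrow> G z x y = G z y x"
    and G_clin1: "z \<in> S \<Longrightarrow> clin (\<lambda>x. G z x y $ b)"
    and h_compat: "z \<in> S \<Longrightarrow> del v (\<lambda>z. h z x y) z = h z (G z v x) y"
begin

lemma h_alin: assumes z: "z \<in> S" shows "alin (\<lambda>y. h z x y)"
proof -
  have "(\<lambda>y. h z x y) = (\<lambda>y. cnj (h z y x))" using h_herm[OF z] by blast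
  then show ?thesis using clin_alin_cnj[OF h_clin[OF z, of x]] by simp
qed

lemma G_clin2: "z \<in> S \<Longrightarrow> clin (\<lambda>y. G z x y $ b)"
  using G_clin1[of z x b] G_sym by simp

lemma h_compatb: "z \<in> S \<Longrightarrow> delb v (\<lambda>z. h z x y) z = h z x (G z v y)"
proof -
  assume z: "z \<in> S"
  have "delb v (\<lambda>z. h z x y) z = delb v (\<lambda>z. cnj (h z y x)) z"
    by (rule pd_cong[OF open_S z]) (rule h_herm)
  also have "\<dots> = cnj (h z (G z v y) x)"
    using pd_cnj[OF sm_diff[OF h_sm z]] h_compat[OF z] by simp
  also have "\<dots> = h z x (G z v y)" by (rule h_herm[OF z, symmetric])
  finally show ?thesis .
qed

text \<open>Testing with \<open>u = x - y\<close>, positivity gives nondegeneracy. Vector identities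
  can therefore be proved after pairing with an arbitrary \<open>u\<close>.\<close>

lemma h_cancel: "z \<in> S \<Longrightarrow> (\<And>u. h z x u = h z y u) \<Longrightarrow> x = y"
  using h_pos[of z "x - y"] clin_diff[OF h_clin[of z "x - y"], of x y] by fastforce

lemma h_cancel2: "z \<in> S \<Longrightarrow> (\<And>u. h z u x = h z u y) \<Longrightarrow> x = y"
  using h_pos[of z "x - y"] alin_diff[OF h_alin[of z "x - y"], of x y] by fastforce

lemma del_h: assumes "\<And>b. sm (\<lambda>z. Y z $ b)" "z \<in> S"
  shows "del v (\<lambda>z. h z (Y z) u) z = h z (G z v (Y z)) u + h z (pdv (-\<i>) v Y z) u"
  using pd_clin[of "\<lambda>z x. h z x u" Y z "-\<i>" v] assms h_clin h_sm h_compat by simp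

lemma delb_h: assumes "\<And>b. sm (\<lambda>z. Y z $ b)" "z \<in> S"
  shows "delb v (\<lambda>z. h z (Y z) u) z = h z (Y z) (G z v u) + h z (pdv \<i> v Y z) u"
  using pd_clin[of "\<lambda>z x. h z x u" Y z "\<i>" v] assms h_clin h_sm h_compatb by simp

lemma del_h2: assumes "\<And>b. sm (\<lambda>z. Y z $ b)" "z \<in> S"
  shows "del v (\<lambda>z. h z u (Y z)) z = h z (G z v u) (Y z) + h z u (pdv \<i> v Y z)"
  using pd_alin[of "\<lambda>z x. h z u x" Y z "-\<i>" v] assms h_alin h_sm h_compat by simp

text \<open>The curvature: \<open>R(x, y) w = C x y w - C y x w\<close>, by lemma \<open>flat\<close> below, which says that the
  (2,0)-part vanishes.\<close>

definition C :: "complex^'n \<Rightarrow> complex^'n \<Rightarrow> complex^'n \<Rightarrow> complex^'n \<Rightarrow> complex^'n" where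
  "C z y x w = pdv \<i> y (\<lambda>z. G z x w) z"

lemma C_sm: "sm (\<lambda>z. C z y x w $ b)"
  unfolding C_def by (rule sm_pdv) (rule G_sm)

lemma pdv_cong: "z \<in> S \<Longrightarrow> (\<And>z. z \<in> S \<Longrightarrow> Y z = Y' z) \<Longrightarrow> pdv s v Y z = pdv s v Y' z"
  unfolding pdv_def vec_eq_iff vec_lambda_beta by (intro allI pd_cong[OF open_S]) simp_all

lemma C_sym: "z \<in> S \<Longrightarrow> C z y x w = C z y w x"
  unfolding C_def by (erule pdv_cong) (rule G_sym)

lemma C_clin3: "z \<in> S \<Longrightarrow> clin (\<lambda>w. C z y x w $ b)"
  unfolding clin_def
proof (intro conjI allI)
  fix w w' a assume z: "z \<in> S"
  have "delb y (\<lambda>z. G z x (w + w') $ b) z = delb y (\<lambda>z. G z x w $ b + G z x w' $ b) z"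
    by (rule pd_cong[OF open_S z]) (rule clin_add[OF G_clin2])
  then show "C z y x (w + w') $ b = C z y x w $ b + C z y x w' $ b"
    using pd_add[OF sm_diff[OF G_sm z] sm_diff[OF G_sm z]] by (simp add: C_def pdv_def)
  have "delb y (\<lambda>z. G z x (a *s w) $ b) z = delb y (\<lambda>z. a * G z x w $ b) z"
    by (rule pd_cong[OF open_S z]) (rule clin_scale[OF G_clin2])
  then show "C z y x (a *s w) $ b = a * C z y x w $ b"
    using pd_cmult[OF sm_diff[OF G_sm z]] by (simp add: C_def pdv_def)
qed

lemma C_clin2: "z \<in> S \<Longrightarrow> clin (\<lambda>w. C z y w x $ b)"
  using C_clin3[of z y x b] C_sym[of z y] by simp

lemma C_alin: "z \<in> S \<Longrightarrow> alin (\<lambda>y. C z y x w $ b)"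
  using alin_delb[OF sm_diff[OF G_sm]] by (simp add: C_def pdv_def)

text \<open>Paired with \<open>u\<close>, either side is a second (1,0)-derivative of
  \<open>h z w u\<close>: \<open>del\<close> acts through the complex linear slot alone, so two of
  them produce a derivative of \<open>G\<close> and a product of two \<open>G\<close>. Such
  derivatives commute.\<close>

lemma flat:
  assumes z: "z \<in> S"
  shows "pdv (-\<i>) x (\<lambda>z. G z y w) z + G z x (G z y w) = pdv (-\<i>) y (\<lambda>z. G z x w) z + G z y (G z x w)"
proof (rule h_cancel[OF z])
  fix u
  have *: "h z (pdv (-\<i>) x (\<lambda>z. G z y w) z + G z x (G z y w)) u = del x (del y (\<lambda>z. h z w u)) z" for x y
  proof -
    have "del x (del y (\<lambda>z. h z w u)) z = del x (\<lambda>z. h z (G z y w) u) z"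
      by (rule pd_cong[OF open_S z]) (rule h_compat)
    also have "\<dots> = h z (pdv (-\<i>) x (\<lambda>z. G z y w) z + G z x (G z y w)) u"
      using del_h[OF G_sm z] clin_add[OF h_clin[OF z]] by simp
    finally show ?thesis by simp
  qed
  show "h z (pdv (-\<i>) x (\<lambda>z. G z y w) z + G z x (G z y w)) u = h z (pdv (-\<i>) y (\<lambda>z. G z x w) z + G z y (G z x w)) u"
    unfolding * by (rule pd_commute[OF h_sm open_S z])
qed

text \<open>The curvature with its index lowered: complex linear in \<open>x\<close> and
  \<open>a\<close>, antilinear in \<open>y\<close> and \<open>u\<close>.\<close>

definition k where "k z x y a u = h z (C z y x a) u"

lemma k_sym: "z \<in> S \<Longrightarrow> k z x y a u = k z a y x u"
  using C_sym[of z y x a] by (simp add: k_def)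

text \<open>Commuting \<open>del\<close> and \<open>delb\<close> on \<open>h z a u\<close> puts the
  curvature once into the complex linear and once into the antilinear slot; the product of two
  Christoffel terms is common to both orders.\<close>

lemma k_herm: assumes z: "z \<in> S" shows "k z x y a u = cnj (k z y x u a)"
proof -
  have "delb y (del x (\<lambda>z. h z a u)) z = delb y (\<lambda>z. h z (G z x a) u) z"
    by (rule pd_cong[OF open_S z]) (rule h_compat)
  also have "\<dots> = h z (G z x a) (G z y u) + k z x y a u"
    using delb_h[OF G_sm z] by (simp add: k_def C_def)
  finally have 1: "delb y (del x (\<lambda>z. h z a u)) z = h z (G z x a) (G z y u) + k z x y a u" .
  have "del x (delb y (\<lambda>z. h z a u)) z = del x (\<lambda>z. h z a (G z y u)) z"
    by (rule pd_cong[OF open_S z]) (rule h_compatb)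
  also have "\<dots> = h z (G z x a) (G z y u) + h z a (C z x y u)"
    using del_h2[OF G_sm z] by (simp add: C_def)
  also have "h z a (C z x y u) = cnj (k z y x u a)"
    unfolding k_def by (rule h_herm[OF z])
  finally show ?thesis using 1 pd_commute[OF h_sm open_S z, of \<i> y "-\<i>" x a u] by simp
qed

section \<open>Gram matrix and dual basis of the Hermitian form\<close>

definition hmat where "hmat z = (\<chi> a c. h z (ax a) (ax c))"

lemma hmat_mult: "z \<in> S \<Longrightarrow> (hmat z *v w) $ a = h z (ax a) (\<chi> c. cnj (w $ c))"
  using alin_expand[OF h_alin[of z "ax a"], of "\<chi> c. cnj (w $ c)"]
  by (simp add: hmat_def matrix_vector_mult_def mult.commute)

text \<open>A kernel vector, conjugated because the second slot of \<open>h\<close> is antilinear,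
  is orthogonal to every vector and hence zero.\<close>

lemma det_hmat: assumes z: "z \<in> S" shows "det (hmat z) \<noteq> 0"
proof -
  have "w = 0" if "hmat z *v w = 0" for w
  proof -
    have "h z u (\<chi> c. cnj (w $ c)) = h z u 0" for u
    proof -
      have "h z u (\<chi> c. cnj (w $ c)) = (\<Sum>b\<in>UNIV. u $ b * (hmat z *v w) $ b)"
        using clin_expand[OF h_clin[OF z], of u] by (simp add: hmat_mult[OF z])
      then show ?thesis using that alin_zero[OF h_alin[OF z]] by simp
    qed
    then have "(\<chi> c. cnj (w $ c)) = 0" by (rule h_cancel2[OF z])
    then show ?thesis by (simp add: vec_eq_iff)
  qed
  then show ?thesis
    using matrix_left_invertible_ker[of "hmat z"] invertible_left_inverse[of "hmat z"]
      invertible_det_nz[of "hmat z"] by blast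
qed

text \<open>The basis dual to the coordinate basis with respect to \<open>h\<close>, by Cramer's rule, which makes its
  smoothness evident.\<close>

definition eps where
  "eps z b = (\<chi> m. cnj (det (\<chi> i j. if j = m then ax b $ i else hmat z $ i $ j) / det (hmat z)))"

lemma h_eps: assumes z: "z \<in> S" shows "h z x (eps z b) = x $ b"
proof -
  define w where "w = (\<chi> m. det (\<chi> i j. if j = m then ax b $ i else hmat z $ i $ j) / det (hmat z))"
  have w: "hmat z *v w = ax b"
    using cramer[OF det_hmat[OF z], of w "ax b"] by (simp add: w_def)
  have "eps z b = (\<chi> c. cnj (w $ c))" by (simp add: eps_def w_def)
  then have "h z (ax a) (eps z b) = ax b $ a" for a using hmat_mult[OF z, of w a] w by simp
  then have "h z x (eps z b) = (\<Sum>a\<in>UNIV. x $ a * ax b $ a)"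
    using clin_expand[OF h_clin[OF z], of x] by simp
  then show ?thesis by (simp add: axis_def if_distrib cong: if_cong)
qed

lemma sm_det: "(\<And>i j. sm (\<lambda>z. A z $ i $ j)) \<Longrightarrow> sm (\<lambda>z. det (A z :: complex^'n^'n))"
  unfolding det_def by (intro sm_intros smooth_on_prod[OF open_S])

lemma eps_sm: "sm (\<lambda>z. eps z b $ m)"
proof -
  have H: "sm (\<lambda>z. hmat z $ i $ j)" for i j using h_sm by (simp add: hmat_def)
  have "sm (\<lambda>z. det (\<chi> i j. if j = m then ax b $ i else hmat z $ i $ j))"
  proof (rule sm_det)
    fix i j
    show "sm (\<lambda>z. (\<chi> i j. if j = m then ax b $ i else hmat z $ i $ j) $ i $ j)"
      using H[of i j] by (cases "j = m") (simp_all add: smooth_on_const)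
  qed
  moreover have "sm (\<lambda>z. inverse (det (hmat z)))"
    by (rule smooth_on_inverse[OF open_S det_hmat sm_det[OF H]])
  ultimately have "sm (\<lambda>z. cnj (det (\<chi> i j. if j = m then ax b $ i else hmat z $ i $ j) * inverse (det (hmat z))))"
    by (intro sm_intros)
  then show ?thesis by (simp add: eps_def divide_inverse)
qed

lemma alin_eps: assumes z: "z \<in> S" and F: "alin F" shows "F y = (\<Sum>c\<in>UNIV. h z (ax c) y * F (eps z c))"
proof -
  have "h z x y = h z x (\<Sum>c\<in>UNIV. cnj (h z (ax c) y) *s eps z c)" for x
  proof -
    have "h z x (\<Sum>c\<in>UNIV. cnj (h z (ax c) y) *s eps z c) = (\<Sum>c\<in>UNIV. h z (ax c) y * x $ c)"
      by (simp add: alin_sum[OF h_alin[OF z]] alin_scale[OF h_alin[OF z]] h_eps[OF z])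
    also have "\<dots> = h z x y"
      using clin_expand[OF h_clin[OF z], of x y] by (simp add: mult.commute)
    finally show ?thesis by simp
  qed
  then have "y = (\<Sum>c\<in>UNIV. cnj (h z (ax c) y) *s eps z c)" by (rule h_cancel2[OF z])
  then have "F y = F (\<Sum>c\<in>UNIV. cnj (h z (ax c) y) *s eps z c)" by simp
  then show ?thesis by (simp add: alin_sum[OF F] alin_scale[OF F])
qed

lemma eps_herm: "z \<in> S \<Longrightarrow> eps z b $ c = cnj (eps z c $ b)"
  using h_eps[of z "eps z b" c] h_eps[of z "eps z c" b] h_herm[of z "eps z b" "eps z c"] by simp

text \<open>The coordinates \<open>eps z b $ c\<close> form a Hermitian matrix by
  \<open>eps_herm\<close>, so this matrix can be moved from the antilinear to the linear
  slot.\<close>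

lemma trace_swap:
  assumes z: "z \<in> S" and B: "\<And>y. clin (\<lambda>x. B x y)" "\<And>x. alin (\<lambda>y. B x y)"
  shows "(\<Sum>b\<in>UNIV. B (ax b) (eps z b)) = (\<Sum>b\<in>UNIV. B (eps z b) (ax b))"
proof -
  have "(\<Sum>b\<in>UNIV. B (ax b) (eps z b)) = (\<Sum>b\<in>UNIV. \<Sum>c\<in>UNIV. cnj (eps z b $ c) * B (ax b) (ax c))"
    by (intro sum.cong refl alin_expand[OF B(2)])
  also have "\<dots> = (\<Sum>c\<in>UNIV. \<Sum>b\<in>UNIV. eps z c $ b * B (ax b) (ax c))"
    by (subst sum.swap) (simp only: eps_herm[OF z, symmetric])
  also have "\<dots> = (\<Sum>c\<in>UNIV. B (eps z c) (ax c))"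
    by (intro sum.cong refl clin_expand[OF B(1), symmetric])
  finally show ?thesis .
qed

section \<open>Ricci form, its trace and its closedness\<close>

definition gam where "gam z x = (\<Sum>b\<in>UNIV. G z x (ax b) $ b)"

text \<open>The Ricci tensor is \<open>2 Re r\<close>, and the scalar curvature is four times the trace \<open>t\<close> of \<open>r\<close> below.\<close>

definition r where "r z x y = - delb y (\<lambda>z. gam z x) z"

lemma gam_sm: "sm (\<lambda>z. gam z x)"
  unfolding gam_def by (intro sm_intros G_sm)

lemma gam_clin: "z \<in> S \<Longrightarrow> clin (gam z)"
  using G_clin1[of z] by (auto simp: gam_def clin_def sum.distrib sum_distrib_left)

lemma r_sm: "sm (\<lambda>z. r z x y)"
  unfolding r_def by (intro sm_intros gam_sm)

lemma r_eq: "z \<in> S \<Longrightarrow> r z x y = - (\<Sum>b\<in>UNIV. C z y x (ax b) $ b)"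
  unfolding r_def gam_def C_def pdv_def using pd_sum[OF open_S, of z UNIV "\<lambda>b z. G z x (ax b) $ b" \<i> y] G_sm
  by simp

lemma r_eq_k: "z \<in> S \<Longrightarrow> r z x y = - (\<Sum>b\<in>UNIV. k z x y (ax b) (eps z b))"
  by (simp add: r_eq k_def h_eps)

lemma r_clin: assumes z: "z \<in> S" shows "clin (\<lambda>x. r z x y)"
  using C_clin2[OF z, of y] by (auto simp: r_eq[OF z] clin_def sum.distrib sum_distrib_left)

lemma r_alin: assumes z: "z \<in> S" shows "alin (\<lambda>y. r z x y)"
  using C_alin[OF z, of x] by (auto simp: r_eq[OF z] alin_def sum.distrib sum_distrib_left)

text \<open>Conjugation by \<open>k_herm\<close> exchanges the slots within both pairs of
  \<open>k\<close> and so moves \<open>eps\<close> into the linear slot of the trace;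
  \<open>trace_swap\<close> moves it back.\<close>

lemma r_herm: assumes z: "z \<in> S" shows "r z y x = cnj (r z x y)"
proof -
  have C_add: "C z y x (a + b) = C z y x a + C z y x b" "C z y x (c *s a) = c *s C z y x a" for x y a b c
    using C_clin3[OF z] by (auto simp: vec_eq_iff clin_def)
  have "cnj (r z x y) = - (\<Sum>b\<in>UNIV. k z y x (eps z b) (ax b))"
    by (simp only: r_eq_k[OF z] complex_cnj_minus cnj_sum k_herm[OF z, of y x, symmetric])
  also have "(\<Sum>b\<in>UNIV. k z y x (eps z b) (ax b)) = (\<Sum>b\<in>UNIV. k z y x (ax b) (eps z b))"
    by (rule trace_swap[OF z, symmetric])
      (auto simp: k_def clin_def alin_def C_add clin_add[OF h_clin[OF z]] clin_scale[OF h_clin[OF z]]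
        alin_add[OF h_alin[OF z]] alin_scale[OF h_alin[OF z]])
  finally show ?thesis using r_eq_k[OF z] by simp
qed

definition Q where "Q z x = (\<chi> b. r z x (eps z b))"

lemma h_Q: assumes z: "z \<in> S" shows "h z (Q z x) y = r z x y"
proof -
  have "h z (Q z x) y = (\<Sum>c\<in>UNIV. h z (ax c) y * h z (Q z x) (eps z c))"
    by (rule alin_eps[OF z h_alin[OF z]])
  also have "\<dots> = (\<Sum>c\<in>UNIV. h z (ax c) y * r z x (eps z c))"
    by (simp add: h_eps[OF z] Q_def)
  also have "\<dots> = r z x y" by (rule alin_eps[OF z r_alin[OF z], symmetric])
  finally show ?thesis .
qed

lemma Q_sm: "sm (\<lambda>z. Q z x $ b)"
  using sm_alin[of "\<lambda>z y. r z x y" "\<lambda>z. eps z b"] r_alin r_sm eps_sm by (simp add: Q_def)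

lemma Q_clin: "z \<in> S \<Longrightarrow> clin (\<lambda>x. Q z x $ b)"
  using r_clin by (simp add: Q_def)

definition t where "t z = (\<Sum>b\<in>UNIV. r z (ax b) (eps z b))"

lemma t_sm: "sm t"
proof -
  have "sm (\<lambda>z. \<Sum>b\<in>UNIV. Q z (ax b) $ b)" by (intro sm_intros Q_sm)
  then show ?thesis by (simp add: Q_def t_def [abs_def])
qed

lemma t_real: assumes z: "z \<in> S" shows "cnj (t z) = t z"
proof -
  have "cnj (t z) = (\<Sum>b\<in>UNIV. r z (eps z b) (ax b))"
    unfolding t_def by (simp only: cnj_sum r_herm[OF z, symmetric])
  then show ?thesis using trace_swap[OF z, of "r z"] r_clin[OF z] r_alin[OF z] by (simp add: t_def)
qed

lemma delb_t: assumes z: "z \<in> S" shows "delb v t z = cnj (del v t z)"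
proof -
  have "delb v t z = delb v (\<lambda>z. cnj (t z)) z"
    by (rule pd_cong[OF open_S z]) (simp add: t_real)
  then show ?thesis using pd_cnj[OF sm_diff[OF t_sm z]] by simp
qed

lemma del_r: assumes Y: "\<And>b. sm (\<lambda>z. Y z $ b)" "z \<in> S"
  shows "pd s v (\<lambda>z. r z (Y z) u) z = pd s v (\<lambda>w. r w (Y z) u) z + r z (pdv s v Y z) u"
  using pd_clin[of "\<lambda>z x. r z x u" Y z s v] assms r_clin r_sm by simp

lemma del_r2: assumes Y: "\<And>b. sm (\<lambda>z. Y z $ b)" "z \<in> S"
  shows "pd s v (\<lambda>z. r z u (Y z)) z = pd s v (\<lambda>w. r w u (Y z)) z + r z u (pdv (cnj s) v Y z)"
  using pd_alin[of "\<lambda>z x. r z u x" Y z s v] assms r_alin r_sm by simp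

text \<open>The (1,0)-covariant derivative of \<open>r\<close>.\<close>

definition A where "A z v x y = del v (\<lambda>z. r z x y) z - r z (G z v x) y"

text \<open>This is the trace of \<open>flat\<close>, whose quadratic terms have equal traces by
  \<open>trace_commute\<close>. Classically, \<open>gam z x\<close> is the (1,0)-derivative of log
  det h along x.\<close>

lemma gam_closed: assumes z: "z \<in> S" shows "del v (\<lambda>z. gam z x) z = del x (\<lambda>z. gam z v) z"
proof -
  have *: "del v (\<lambda>z. gam z x) z + (\<Sum>b\<in>UNIV. G z v (G z x (ax b)) $ b) 
    = (\<Sum>b\<in>UNIV. (pdv (-\<i>) v (\<lambda>z. G z x (ax b)) z + G z v (G z x (ax b))) $ b)" for v x
    using pd_sum[OF open_S z, of UNIV "\<lambda>b z. G z x (ax b) $ b"] G_sm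
    by (simp add: gam_def pdv_def sum.distrib)
  have 1: "(\<Sum>b\<in>UNIV. G z v (G z x (ax b)) $ b) = (\<Sum>b\<in>UNIV. G z x (G z v (ax b)) $ b)"
    by (rule trace_commute) (use G_clin2[OF z] in auto)
  have 2: "(\<Sum>b\<in>UNIV. (pdv (-\<i>) v (\<lambda>z. G z x (ax b)) z + G z v (G z x (ax b))) $ b)
    = (\<Sum>b\<in>UNIV. (pdv (-\<i>) x (\<lambda>z. G z v (ax b)) z + G z x (G z v (ax b))) $ b)"
    by (simp only: flat[OF z, of v x])
  have cancel: "a = b" if "a + s = c" "b + s' = c'" "s = s'" "c = c'" for a b s s' c c' :: complex
    using that by (metis add_right_cancel)
  show ?thesis by (rule cancel[OF *[of v x] *[of x v] 1 2])
qed

text \<open>Closedness of the Ricci form: \<open>r\<close> is a \<open>delb\<close>-derivative of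
  \<open>gam\<close>, so \<open>gam_closed\<close> makes its plain (1,0)-derivative symmetric, and
  the correction term is symmetric because \<open>G\<close> is.\<close>

lemma A_sym: assumes z: "z \<in> S" shows "A z v x y = A z x v y"
proof -
  have *: "del v (\<lambda>z. r z x y) z = - delb y (del v (\<lambda>z. gam z x)) z" for v x
    unfolding r_def using pd_minus[OF sm_diff[OF smooth_on_pd[OF open_S gam_sm] z]]
      pd_commute[OF gam_sm open_S z, of "-\<i>" v \<i> y x] by simp
  have "delb y (del v (\<lambda>z. gam z x)) z = delb y (del x (\<lambda>z. gam z v)) z"
    by (rule pd_cong[OF open_S z]) (rule gam_closed)
  then show ?thesis using G_sym[OF z, of v x] by (simp add: A_def *)
qed

lemma A_clin: assumes z: "z \<in> S" shows "clin (\<lambda>v. A z v x y)"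
proof -
  have "G z (v + v') x = G z v x + G z v' x" "G z (a *s v) x = a *s G z v x" for v v' a
    using G_clin1[OF z] by (auto simp: vec_eq_iff clin_def)
  then show ?thesis
    using clin_del[OF sm_diff[OF r_sm z]]
    by (auto simp: A_def clin_def algebra_simps clin_add[OF r_clin[OF z]] clin_scale[OF r_clin[OF z]])
qed

lemma A_alin: assumes z: "z \<in> S" shows "alin (\<lambda>y. A z v x y)"
proof -
  have "del v (\<lambda>z. r z x (y + y')) z = del v (\<lambda>z. r z x y) z + del v (\<lambda>z. r z x y') z" for y y'
    unfolding pd_add[OF sm_diff[OF r_sm z] sm_diff[OF r_sm z], symmetric]
    by (rule pd_cong[OF open_S z]) (rule alin_add[OF r_alin])
  moreover have "del v (\<lambda>z. r z x (a *s y)) z = cnj a * del v (\<lambda>z. r z x y) z" for a y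
    unfolding pd_cmult[OF sm_diff[OF r_sm z], symmetric]
    by (rule pd_cong[OF open_S z]) (rule alin_scale[OF r_alin])
  ultimately show ?thesis using r_alin[OF z]
    by (auto simp: alin_def A_def algebra_simps)
qed

text \<open>Traces commute with covariant differentiation. Writing \<open>t\<close> as the trace of
  the endomorphism \<open>Q\<close> avoids derivatives of \<open>eps\<close>; the connection
  contributes only the trace of a commutator.\<close>

lemma del_t: assumes z: "z \<in> S" shows "del v t z = (\<Sum>b\<in>UNIV. A z v (ax b) (eps z b))"
proof -
  have Qt: "t z = (\<Sum>b\<in>UNIV. Q z (ax b) $ b)" for z by (simp add: t_def Q_def)
  have "del v t z = (\<Sum>b\<in>UNIV. del v (\<lambda>z. Q z (ax b) $ b) z)"
    unfolding Qt [abs_def] by (rule pd_sum[OF open_S z]) (rule Q_sm)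
  also have "\<dots> = (\<Sum>b\<in>UNIV. A z v (ax b) (eps z b) + Q z (G z v (ax b)) $ b - G z v (Q z (ax b)) $ b)"
  proof (rule sum.cong[OF refl])
    fix b
    have "del v (\<lambda>z. h z (Q z (ax b)) (y)) z = del v (\<lambda>z. r z (ax b) y) z" for y
      by (rule pd_cong[OF open_S z]) (rule h_Q)
    then have "h z (G z v (Q z (ax b))) (eps z b) + h z (pdv (-\<i>) v (\<lambda>z. Q z (ax b)) z) (eps z b) 
      = A z v (ax b) (eps z b) + h z (Q z (G z v (ax b))) (eps z b)"
      using del_h[OF Q_sm z] by (simp add: A_def h_Q[OF z])
    then show "del v (\<lambda>z. Q z (ax b) $ b) z = A z v (ax b) (eps z b) + Q z (G z v (ax b)) $ b - G z v (Q z (ax b)) $ b"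
      by (simp add: h_eps[OF z] pdv_def algebra_simps)
  qed
  also have "\<dots> = (\<Sum>b\<in>UNIV. A z v (ax b) (eps z b))"
    using trace_commute[of "Q z" "G z v"] Q_clin[OF z] G_clin2[OF z]
    by (simp add: sum.distrib sum_subtractf)
  finally show ?thesis .
qed

end

section \<open>Bochner-Kaehler metrics on open subsets of complex coordinate space\<close>

context kaehler_domain
begin

lemma bianchi_C:
  assumes z: "z \<in> S"
  shows "pdv (-\<i>) v (\<lambda>z. C z y x a) z + C z y v (G z x a) + G z v (C z y x a)
       = pdv (-\<i>) x (\<lambda>z. C z y v a) z + C z y x (G z v a) + G z x (C z y v a)"
proof (rule vec_eq_iff[THEN iffD2], rule allI)
  fix b
  have *: "delb y (\<lambda>z. (pdv (-\<i>) v (\<lambda>z. G z x a) z + G z v (G z x a)) $ b) z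
    = (pdv (-\<i>) v (\<lambda>z. C z y x a) z + C z y v (G z x a) + G z v (C z y x a)) $ b" for v x
  proof -
    have sm2: "sm (\<lambda>z. G z v (G z x a) $ b)"
      using sm_clin[of "\<lambda>z w. G z v w $ b" "\<lambda>z. G z x a"] G_clin2 G_sm by simp
    have "delb y (\<lambda>z. G z v (G z x a) $ b) z = C z y v (G z x a) $ b + G z v (C z y x a) $ b"
      using pd_clin[of "\<lambda>z w. G z v w $ b" "\<lambda>z. G z x a" z \<i> y] G_clin2 G_sm z
      by (simp add: C_def pdv_def)
    moreover have "delb y (del v (\<lambda>z. G z x a $ b)) z = del v (delb y (\<lambda>z. G z x a $ b)) z"
      by (rule pd_commute[OF G_sm open_S z])
    ultimately show ?thesis
      using pd_add[OF sm_diff[OF smooth_on_pd[OF open_S G_sm] z] sm_diff[OF sm2 z], of \<i> y "-\<i>" v x a b]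
      by (simp add: pdv_def C_def)
  qed
  have "delb y (\<lambda>z. (pdv (-\<i>) v (\<lambda>z. G z x a) z + G z v (G z x a)) $ b) z
      = delb y (\<lambda>z. (pdv (-\<i>) x (\<lambda>z. G z v a) z + G z x (G z v a)) $ b) z"
    by (rule pd_cong[OF open_S z]) (simp only: flat[of _ v x])
  then show "(pdv (-\<i>) v (\<lambda>z. C z y x a) z + C z y v (G z x a) + G z v (C z y x a)) $ b
      = (pdv (-\<i>) x (\<lambda>z. C z y v a) z + C z y x (G z v a) + G z x (C z y v a)) $ b"
    unfolding * .
qed

lemma k_sm: "sm (\<lambda>z. k z x y a u)"
  unfolding k_def using sm_clin[of "\<lambda>z w. h z w u" "\<lambda>z. C z y x a"] h_clin h_sm C_sm by simp

text \<open>In a full covariant derivative along \<open>v\<close> only the slots \<open>x\<close>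
  and \<open>a\<close> would be corrected; the correction of \<open>x\<close> is symmetric in
  \<open>v\<close> and \<open>x\<close>, so it is left out on both sides.\<close>

lemma bianchi_k:
  assumes z: "z \<in> S"
  shows "del v (\<lambda>z. k z x y a u) z - k z x y (G z v a) u = del x (\<lambda>z. k z v y a u) z - k z v y (G z x a) u"
proof -
  have "del v (\<lambda>z. k z x y a u) z = h z (G z v (C z y x a) + pdv (-\<i>) v (\<lambda>z. C z y x a) z) u" for v x
    using del_h[OF C_sm z] clin_add[OF h_clin[OF z]] by (simp add: k_def)
  then have "del v (\<lambda>z. k z x y a u) z + k z v y (G z x a) u
    = h z (pdv (-\<i>) v (\<lambda>z. C z y x a) z + C z y v (G z x a) + G z v (C z y x a)) u" for v x
    using clin_add[OF h_clin[OF z]] by (simp add: k_def)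
  note * = this
  have "del v (\<lambda>z. k z x y a u) z + k z v y (G z x a) u = del x (\<lambda>z. k z v y a u) z + k z x y (G z v a) u"
    unfolding * by (simp only: bianchi_C[OF z, of v y x a])
  then show ?thesis by (simp add: algebra_simps)
qed

end

text \<open>This is the Bochner condition divided by 8: on (1,0)-vectors the curvature is -8
  \<open>k\<close>, the metric 2 \<open>h\<close>, the Ricci tensor 4 \<open>r\<close>, and the
  scalar curvature is 4 \<open>t\<close>, which absorbs the 2 of the last denominator. The parameter
  \<open>N\<close> lets the dimension act as one complex symbol.\<close>

locale bochner_domain = kaehler_domain S h G for S :: "(complex^'n::finite) set" and h and G +
  fixes N :: complex
  assumes bochner: "z \<in> S \<Longrightarrow> - k z x y a u =
      1 / (N + 2) * (h z x y * r z a u + h z a y * r z x u + h z a u * r z x y + h z x u * r z a y)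
      - t z / ((N + 1) * (N + 2)) * (h z x y * h z a u + h z a y * h z x u)"
    and N: "N = of_nat CARD('n)"
    and dim: "CARD('n) \<ge> 2"
begin

lemma N_nz: "N \<noteq> 0" "N + 1 \<noteq> 0" "N + 2 \<noteq> 0" "N \<noteq> 1"
proof -
  have "N + 1 = of_nat (CARD('n) + 1)" "N + 2 = of_nat (CARD('n) + 2)" by (simp_all add: N)
  then show "N \<noteq> 0" "N + 1 \<noteq> 0" "N + 2 \<noteq> 0" "N \<noteq> 1"
    unfolding N using dim by (simp_all only: of_nat_eq_0_iff of_nat_eq_1_iff)
qed

lemma cnj_N [simp]: "cnj N = N"
  by (simp add: N)

lemma bochner':
  assumes "z \<in> S"
  shows "(N + 1) * (N + 2) * (- k z x y a u) =
    (N + 1) * (h z x y * r z a u + h z a y * r z x u + h z a u * r z x y + h z x u * r z a y)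
      - t z * (h z x y * h z a u + h z a y * h z x u)"
proof -
  have clear: "m * n * c = m * A - t * B" if "m \<noteq> 0" "n \<noteq> 0" "c = 1 / n * A - t / (m * n) * B" for m n c t A B :: complex
    using that by (simp add: field_simps)
  show ?thesis by (rule clear[OF _ _ bochner[OF assms]]) (use N_nz in auto)
qed

definition T1 where "T1 z v = del v t z"

lemma T1_clin: "z \<in> S \<Longrightarrow> clin (T1 z)"
  unfolding T1_def [abs_def] by (rule clin_del[OF sm_diff[OF t_sm]])

lemma del_k:
  assumes z: "z \<in> S"
  shows "(N + 1) * (N + 2) * del v (\<lambda>z. - k z x y a u) z =
    (N + 1) * (h z (G z v x) y * r z a u + h z x y * (A z v a u + r z (G z v a) u)
      + (h z (G z v a) y * r z x u + h z a y * (A z v x u + r z (G z v x) u))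
      + (h z (G z v a) u * r z x y + h z a u * (A z v x y + r z (G z v x) y))
      + (h z (G z v x) u * r z a y + h z x u * (A z v a y + r z (G z v a) y)))
    - (T1 z v * (h z x y * h z a u + h z a y * h z x u)
      + t z * (h z (G z v x) y * h z a u + h z x y * h z (G z v a) u + h z (G z v a) y * h z x u + h z a y * h z (G z v x) u))"
proof -
  note d = sm_diff[OF _ z]
  note sms = sm_intros h_sm r_sm t_sm
  have "(N + 1) * (N + 2) * del v (\<lambda>z. - k z x y a u) z = del v (\<lambda>z. (N + 1) * (N + 2) * (- k z x y a u)) z"
    by (rule pd_cmult[symmetric], rule d, intro sm_intros k_sm)
  also have "\<dots> = del v (\<lambda>z. (N + 1) * (h z x y * r z a u + h z a y * r z x u + h z a u * r z x y + h z x u * r z a y)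
      - t z * (h z x y * h z a u + h z a y * h z x u)) z"
    by (rule pd_cong[OF open_S z]) (rule bochner')
  finally show ?thesis
    by (simp add: pd_add pd_diff pd_mult d sms h_compat[OF z] A_def T1_def)
qed

text \<open>The Bochner form is inserted into \<open>bianchi_k\<close>. As \<open>h\<close> is
  parallel, all terms with \<open>G\<close> cancel; terms in which both \<open>v\<close> and
  \<open>x\<close> are arguments of \<open>A\<close> cancel by \<open>A_sym\<close>.\<close>

lemma A_skew:
  assumes z: "z \<in> S"
  shows "(N + 1) * (h z x y * A z v a u + h z x u * A z v a y) - T1 z v * (h z x y * h z a u + h z a y * h z x u)
    = (N + 1) * (h z v y * A z x a u + h z v u * A z x a y) - T1 z x * (h z v y * h z a u + h z a y * h z v u)"
proof -
  have e: "(N + 1) * (N + 2) * (- k z x y (G z v a) u) = 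
    (N + 1) * (h z x y * r z (G z v a) u + h z (G z v a) y * r z x u + h z (G z v a) u * r z x y + h z x u * r z (G z v a) y)
      - t z * (h z x y * h z (G z v a) u + h z (G z v a) y * h z x u)" for x v
    by (rule bochner'[OF z])
  have km: "del v (\<lambda>z. - k z x y a u) z = - del v (\<lambda>z. k z x y a u) z" for v x
    by (rule pd_minus[OF sm_diff[OF k_sm z]])
  have e2: "- a - - b = - (a - b)" for a b :: complex by simp
  have "(N + 1) * (N + 2) * del v (\<lambda>z. - k z x y a u) z - (N + 1) * (N + 2) * (- k z x y (G z v a) u)
    = (N + 1) * (N + 2) * del x (\<lambda>z. - k z v y a u) z - (N + 1) * (N + 2) * (- k z v y (G z x a) u)"
    unfolding km right_diff_distrib[symmetric] e2 by (simp only: bianchi_k[OF z, of v x y a u])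
  then show ?thesis
    unfolding del_k[OF z] e
    using G_sym[OF z, of x v] A_sym[OF z, of x v] by (simp add: algebra_simps)
qed

text \<open>Contraction of \<open>A_skew\<close> over \<open>x\<close> and \<open>y\<close>.\<close>

lemma A_eq:
  assumes z: "z \<in> S"
  shows "(N + 1) * A z v a u = T1 z v * h z a u + T1 z a * h z v u"
proof -
  define X where "X = A z v a u"
  have s1: "(\<Sum>b\<in>UNIV. h z (ax b) (eps z b)) = N" by (simp add: h_eps[OF z] N)
  have s2: "(\<Sum>b\<in>UNIV. h z (ax b) u * F (eps z b)) = F u" if "alin F" for F
    using alin_eps[OF z that, of u] by simp
  have s3: "(\<Sum>b\<in>UNIV. h z w (eps z b) * F (ax b)) = F w" if "clin F" for F w
    using clin_expand[OF that, of w] by (simp add: h_eps[OF z])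
  have s4: "(\<Sum>b\<in>UNIV. A z (ax b) a (eps z b)) = T1 z a"
    using del_t[OF z, of a] A_sym[OF z, of a] by (simp add: T1_def)
  have "(\<Sum>b\<in>UNIV. (N + 1) * (h z (ax b) (eps z b) * A z v a u + h z (ax b) u * A z v a (eps z b))
       - T1 z v * (h z (ax b) (eps z b) * h z a u + h z a (eps z b) * h z (ax b) u))
    = (\<Sum>b\<in>UNIV. (N + 1) * (h z v (eps z b) * A z (ax b) a u + h z v u * A z (ax b) a (eps z b))
       - T1 z (ax b) * (h z v (eps z b) * h z a u + h z a (eps z b) * h z v u))"
    by (intro sum.cong refl A_skew[OF z])
  also have "(\<Sum>b\<in>UNIV. (N + 1) * (h z (ax b) (eps z b) * A z v a u + h z (ax b) u * A z v a (eps z b))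
       - T1 z v * (h z (ax b) (eps z b) * h z a u + h z a (eps z b) * h z (ax b) u))
     = (N + 1) * (N * X + X) - T1 z v * (N * h z a u + h z a u)"
    unfolding X_def sum_subtractf sum.distrib sum_distrib_left[symmetric] sum_distrib_right[symmetric] s1
     s2[OF A_alin[OF z]] s3[OF h_clin[OF z]] ..
  also have "(\<Sum>b\<in>UNIV. (N + 1) * (h z v (eps z b) * A z (ax b) a u + h z v u * A z (ax b) a (eps z b))
       - T1 z (ax b) * (h z v (eps z b) * h z a u + h z a (eps z b) * h z v u))
     = (N + 1) * (X + h z v u * T1 z a) - (T1 z v * h z a u + T1 z a * h z v u)"
  proof -
    have "(\<Sum>b\<in>UNIV. T1 z (ax b) * (h z v (eps z b) * h z a u + h z a (eps z b) * h z v u))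
      = (\<Sum>b\<in>UNIV. h z v (eps z b) * T1 z (ax b)) * h z a u + (\<Sum>b\<in>UNIV. h z a (eps z b) * T1 z (ax b)) * h z v u"
      by (simp add: sum_distrib_left sum_distrib_right sum.distrib algebra_simps)
    then show ?thesis
      unfolding X_def sum_subtractf sum.distrib[where A = UNIV] sum_distrib_left[symmetric]
        s3[OF A_clin[OF z]] s3[OF T1_clin[OF z]] s4
      by simp
  qed
  \<comment> \<open>The terms in \<open>X\<close> leave N copies of (N + 1) X, and either product of
    \<open>T1\<close> and \<open>h\<close> occurs N + 1 times on one side and once on the other, so
    the factor N splits off everywhere.\<close>
  finally have "N * ((N + 1) * X) = N * (T1 z v * h z a u + T1 z a * h z v u)"
    by (simp add: algebra_simps)
  then show ?thesis using N_nz by (simp add: X_def)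
qed

lemma del_r_eq:
  assumes z: "z \<in> S"
  shows "del v (\<lambda>z. r z x y) z = r z (G z v x) y + (T1 z v * h z x y + T1 z x * h z v y) / (N + 1)"
  using A_eq[OF z, of v x y] N_nz by (simp add: A_def field_simps)

lemma del_r_eq':
  assumes z: "z \<in> S"
  shows "(N + 1) * del v (\<lambda>z. r z x y) z = (N + 1) * r z (G z v x) y + (T1 z v * h z x y + T1 z x * h z v y)"
  unfolding del_r_eq[OF z] by (subst distrib_left) (use N_nz in simp)

lemma T1_sm: "sm (\<lambda>z. T1 z x)"
  unfolding T1_def by (intro sm_intros t_sm)

definition T1b where "T1b z v = delb v t z"

lemma T1b_cnj: "z \<in> S \<Longrightarrow> T1b z v = cnj (T1 z v)"
  by (simp add: T1_def T1b_def delb_t)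

lemma T1b_alin: "z \<in> S \<Longrightarrow> alin (T1b z)"
  unfolding T1b_def [abs_def] by (rule alin_delb[OF sm_diff[OF t_sm]])

lemma T1b_sm: "sm (\<lambda>z. T1b z x)"
  unfolding T1b_def by (intro sm_intros t_sm)

lemma delb_r_eq:
  assumes z: "z \<in> S"
  shows "delb v (\<lambda>z. r z x y) z = r z x (G z v y) + (T1b z v * h z x y + T1b z y * h z x v) / (N + 1)"
proof -
  have "delb v (\<lambda>z. r z x y) z = delb v (\<lambda>z. cnj (r z y x)) z"
    by (rule pd_cong[OF open_S z]) (rule r_herm)
  also have "\<dots> = cnj (r z (G z v y) x + (T1 z v * h z y x + T1 z y * h z v x) / (N + 1))"
    using pd_cnj[OF sm_diff[OF r_sm z]] del_r_eq[OF z] by simp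
  also have "\<dots> = r z x (G z v y) + (T1b z v * h z x y + T1b z y * h z x v) / (N + 1)"
    by (simp add: T1b_cnj[OF z] r_herm[OF z, of "G z v y" x] h_herm[OF z, of y x] h_herm[OF z, of v x])
  finally show ?thesis .
qed

text \<open>The (2,0)-part of the Hessian of \<open>t\<close>.\<close>

definition P where "P z w x = del w (\<lambda>z. T1 z x) z - T1 z (G z w x)"

lemma delb_r_eq':
  assumes z: "z \<in> S"
  shows "(N + 1) * delb v (\<lambda>z. r z x y) z = (N + 1) * r z x (G z v y) + (T1b z v * h z x y + T1b z y * h z x v)"
  unfolding delb_r_eq[OF z] by (subst distrib_left) (use N_nz in simp)

lemma r_alin_sm: "(\<And>b. sm (\<lambda>z. Y z $ b)) \<Longrightarrow> sm (\<lambda>z. r z (Y z) y)"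
  using sm_clin[of "\<lambda>z x. r z x y" Y] r_clin r_sm by simp

lemma r_alin_sm2: "(\<And>b. sm (\<lambda>z. Y z $ b)) \<Longrightarrow> sm (\<lambda>z. r z y (Y z))"
  using sm_alin[of "\<lambda>z x. r z y x" Y] r_alin r_sm by simp

lemma P_zero:
  assumes z: "z \<in> S" shows "P z w x = 0"
proof -
  note d = sm_diff[OF _ z]
  have *: "(N + 1) * del w (del v (\<lambda>z. r z x y)) z =
     (N + 1) * r z (pdv (-\<i>) w (\<lambda>z. G z v x) z + G z w (G z v x)) y
      + (T1 z w * h z (G z v x) y + T1 z (G z v x) * h z w y)
      + (del w (\<lambda>z. T1 z v) z * h z x y + T1 z v * h z (G z w x) y + del w (\<lambda>z. T1 z x) z * h z v y
        + T1 z x * h z (G z w v) y)" for w v y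
  proof -
    have "(N + 1) * del w (del v (\<lambda>z. r z x y)) z = del w (\<lambda>z. (N + 1) * del v (\<lambda>z. r z x y) z) z"
      by (rule pd_cmult[symmetric], rule d, intro sm_intros r_sm)
    also have "\<dots> = del w (\<lambda>z. (N + 1) * r z (G z v x) y + (T1 z v * h z x y + T1 z x * h z v y)) z"
      by (rule pd_cong[OF open_S z]) (use N_nz in \<open>simp add: del_r_eq field_simps\<close>)
    also have "\<dots> = (N + 1) * (del w (\<lambda>z'. r z' (G z v x) y) z + r z (pdv (-\<i>) w (\<lambda>z. G z v x) z) y)
      + (del w (\<lambda>z. T1 z v) z * h z x y + T1 z v * h z (G z w x) y + del w (\<lambda>z. T1 z x) z * h z v y
        + T1 z x * h z (G z w v) y)"
      using del_r[OF G_sm z, of "-\<i>" w v x y]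
      by (simp add: pd_add pd_mult d sm_intros h_sm T1_sm r_alin_sm[OF G_sm] h_compat[OF z])
    finally show ?thesis
      unfolding distrib_left[of "N + 1"] del_r_eq'[OF z] clin_add[OF r_clin[OF z]] by (simp add: algebra_simps)
  qed
  \<comment> \<open>By \<open>flat\<close> no curvature acts on \<open>r\<close> here, and the terms
    of first order in \<open>t\<close> without a Hessian are symmetric in \<open>v\<close> and
    \<open>w\<close> apart from the corrections contained in \<open>P\<close>.\<close>
  have key: "P z w x * h z v y = P z v x * h z w y" for w v y
  proof -
    have "(N + 1) * del w (del v (\<lambda>z. r z x y)) z = (N + 1) * del v (del w (\<lambda>z. r z x y)) z"
      using pd_commute[OF r_sm open_S z] by simp
    moreover have "del w (\<lambda>z. T1 z v) z = del v (\<lambda>z. T1 z w) z"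
      unfolding T1_def by (rule pd_commute[OF t_sm open_S z])
    ultimately show ?thesis
      unfolding * P_def using flat[OF z, of w v x] G_sym[OF z, of w v] by (simp add: algebra_simps)
  qed
  have "(\<Sum>b\<in>UNIV. P z w x * h z (ax b) (eps z b)) = (\<Sum>b\<in>UNIV. P z (ax b) x * h z w (eps z b))"
    by (intro sum.cong refl key)
  moreover have "(\<Sum>b\<in>UNIV. P z w x * h z (ax b) (eps z b)) = N * P z w x"
    by (simp add: h_eps[OF z] N)
  moreover have "(\<Sum>b\<in>UNIV. P z (ax b) x * h z w (eps z b)) = P z w x"
  proof -
    have "G z (w + w') x = G z w x + G z w' x" "G z (a *s w) x = a *s G z w x" for w w' a
      using G_clin1[OF z] by (auto simp: vec_eq_iff clin_def)
    then have "clin (\<lambda>w. P z w x)"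
      using clin_del[OF sm_diff[OF T1_sm z], of x] T1_clin[OF z]
      by (auto simp: P_def clin_def algebra_simps)
    from clin_expand[OF this, of w] show ?thesis by (simp add: h_eps[OF z] mult.commute)
  qed
  ultimately have "(N - 1) * P z w x = 0" by (simp add: algebra_simps)
  then show ?thesis using N_nz by simp
qed

text \<open>The (1,1)-part of the Hessian of \<open>t\<close>. There is no Christoffel term because
  \<open>T1b\<close> takes an antilinear argument, which \<open>del\<close> does not
  correct.\<close>

definition L where "L z v w = del v (\<lambda>z. T1b z w) z"

lemma L_alt: "z \<in> S \<Longrightarrow> delb w (\<lambda>z. T1 z v) z = L z v w"
  unfolding L_def T1_def T1b_def using pd_commute[OF t_sm open_S] by simp

lemma L_clin: "z \<in> S \<Longrightarrow> clin (\<lambda>v. L z v w)"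
  unfolding L_def by (rule clin_del[OF sm_diff[OF T1b_sm]])

lemma L_alin: "z \<in> S \<Longrightarrow> alin (\<lambda>w. L z v w)"
  using alin_delb[OF sm_diff[OF T1_sm], of z v] L_alt by simp

lemma L_herm: assumes z: "z \<in> S" shows "L z w v = cnj (L z v w)"
proof -
  have "delb w (\<lambda>z. T1 z v) z = delb w (\<lambda>z. cnj (T1b z v)) z"
    by (rule pd_cong[OF open_S z]) (simp add: T1b_cnj)
  also have "\<dots> = cnj (L z w v)" using pd_cnj[OF sm_diff[OF T1b_sm z]] by (simp add: L_def)
  finally show ?thesis using L_alt[OF z] by simp
qed

text \<open>The commutator of \<open>del\<close> and \<open>delb\<close> on \<open>r\<close> is
  computed twice: as the action of the curvature on both slots, and by differentiating the formulas
  for the first derivatives of \<open>r\<close>, where all first-order terms cancel.\<close>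

lemma L_skew:
  assumes z: "z \<in> S"
  shows "(N + 1) * (r z (C z w v x) y - r z x (C z v w y)) = L z v y * h z x w - L z x w * h z v y"
proof -
  note d = sm_diff[OF _ z]
  have 1: "(N + 1) * delb w (del v (\<lambda>z. r z x y)) z =
     (N + 1) * (delb w (\<lambda>z'. r z' (G z v x) y) z + r z (C z w v x) y)
      + (L z v w * h z x y + T1 z v * h z x (G z w y) + L z x w * h z v y + T1 z x * h z v (G z w y))"
  proof -
    have "(N + 1) * delb w (del v (\<lambda>z. r z x y)) z = delb w (\<lambda>z. (N + 1) * del v (\<lambda>z. r z x y) z) z"
      by (rule pd_cmult[symmetric], rule d, intro sm_intros r_sm)
    also have "\<dots> = delb w (\<lambda>z. (N + 1) * r z (G z v x) y + (T1 z v * h z x y + T1 z x * h z v y)) z"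
      by (rule pd_cong[OF open_S z]) (use N_nz in \<open>simp add: del_r_eq field_simps\<close>)
    finally show ?thesis
      using del_r[OF G_sm z, of "\<i>" w v x y]
      by (simp add: pd_add pd_mult d sm_intros h_sm T1_sm r_alin_sm[OF G_sm] h_compatb[OF z] L_alt[OF z] C_def)
  qed
  have 2: "(N + 1) * del v (delb w (\<lambda>z. r z x y)) z =
     (N + 1) * (del v (\<lambda>z'. r z' x (G z w y)) z + r z x (C z v w y))
      + (L z v w * h z x y + T1b z w * h z (G z v x) y + L z v y * h z x w + T1b z y * h z (G z v x) w)"
  proof -
    have "(N + 1) * del v (delb w (\<lambda>z. r z x y)) z = del v (\<lambda>z. (N + 1) * delb w (\<lambda>z. r z x y) z) z"
      by (rule pd_cmult[symmetric], rule d, intro sm_intros r_sm)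
    also have "\<dots> = del v (\<lambda>z. (N + 1) * r z x (G z w y) + (T1b z w * h z x y + T1b z y * h z x w)) z"
      by (rule pd_cong[OF open_S z]) (use N_nz in \<open>simp add: delb_r_eq field_simps\<close>)
    finally show ?thesis
      using del_r2[OF G_sm z, of "-\<i>" v x w y]
      by (simp add: pd_add pd_mult d sm_intros h_sm T1b_sm r_alin_sm2[OF G_sm] h_compat[OF z] L_def C_def)
  qed
  have "(N + 1) * delb w (del v (\<lambda>z. r z x y)) z = (N + 1) * del v (delb w (\<lambda>z. r z x y)) z"
    using pd_commute[OF r_sm open_S z] by simp
  then have "(N + 1) * (r z (C z w v x) y - r z x (C z v w y)) = (L z v y * h z x w - L z x w * h z v y)
    + ((N + 1) * del v (\<lambda>z'. r z' x (G z w y)) z + T1b z w * h z (G z v x) y + T1b z y * h z (G z v x) w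
      - (N + 1) * delb w (\<lambda>z'. r z' (G z v x) y) z - T1 z v * h z x (G z w y) - T1 z x * h z v (G z w y))"
    unfolding 1 2 by (simp add: algebra_simps)
  also have "((N + 1) * del v (\<lambda>z'. r z' x (G z w y)) z + T1b z w * h z (G z v x) y + T1b z y * h z (G z v x) w
      - (N + 1) * delb w (\<lambda>z'. r z' (G z v x) y) z - T1 z v * h z x (G z w y) - T1 z x * h z v (G z w y)) = 0"
    unfolding del_r_eq'[OF z] delb_r_eq'[OF z] by simp
  finally show ?thesis by simp
qed

text \<open>The square of the Ricci form, one factor being raised to the endomorphism
  \<open>Q\<close>.\<close>

definition q where "q z x y = r z (Q z x) y"

lemma q_herm: assumes z: "z \<in> S" shows "q z y x = cnj (q z x y)"
proof -
  have *: "q z x y = h z (Q z x) (Q z y)" for x y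
    unfolding q_def using r_herm[OF z, of y "Q z x"] h_Q[OF z, of y "Q z x"] h_herm[OF z, of "Q z y" "Q z x"]
    by simp
  show ?thesis unfolding * by (rule h_herm[OF z])
qed

text \<open>Since \<open>Q\<close> is self-adjoint for \<open>h\<close>, pairing by \<open>r\<close>
  with \<open>y\<close> is pairing by \<open>h\<close> with \<open>Q z y\<close>; the Bochner
  identity is then used with this vector in its last slot.\<close>

lemma r_C:
  assumes z: "z \<in> S"
  shows "(N + 1) * (N + 2) * r z (C z w v x) y =
    - ((N + 1) * (h z v w * q z x y + h z x w * q z v y + r z v w * r z x y + r z x w * r z v y)
      - t z * (h z v w * r z x y + h z x w * r z v y))"
proof -
  have hq: "h z a (Q z y) = r z a y" for a
    using h_herm[OF z, of "Q z y" a] r_herm[OF z, of y a] h_Q[OF z, of y a] by simp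
  have rq: "r z a (Q z y) = q z a y" for a
    using hq[of "Q z a"] h_Q[OF z, of a "Q z y"] by (simp add: q_def)
  have r_k: "r z (C z w v x) y = k z v w x (Q z y)"
    by (simp add: k_def hq)
  have "(N + 1) * (N + 2) * r z (C z w v x) y = - ((N + 1) * (N + 2) * (- k z v w x (Q z y)))"
    by (simp add: r_k)
  then show ?thesis
    unfolding bochner'[OF z] hq rq by (simp add: algebra_simps)
qed

text \<open>One sixteenth of the left-hand side of (ii).\<close>

definition M where "M z x y = (N + 2) * L z x y + (N + 1) * q z x y - t z * r z x y"

text \<open>In the difference of the curvature terms of \<open>L_skew\<close> everything with
  \<open>h z v w\<close> and all products of two \<open>r\<close> occur in both and cancel; the rest
  combines with the Hessian terms into \<open>M\<close>.\<close>

lemma M_skew: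
  assumes z: "z \<in> S"
  shows "h z v y * M z x w = h z x w * M z v y"
proof -
  have 2: "(N + 1) * (N + 2) * r z x (C z v w y) =
    - ((N + 1) * (h z v w * q z x y + h z v y * q z x w + r z v w * r z x y + r z v y * r z x w)
      - t z * (h z v w * r z x y + h z v y * r z x w))"
  proof -
    have "(N + 1) * (N + 2) * r z x (C z v w y) = cnj ((N + 1) * (N + 2) * r z (C z v w y) x)"
      using r_herm[OF z, of "C z v w y" x] by simp
    also have "\<dots> = - ((N + 1) * (h z v w * q z x y + h z v y * q z x w + r z v w * r z x y + r z v y * r z x w)
      - t z * (h z v w * r z x y + h z v y * r z x w))"
      unfolding r_C[OF z]
      by (simp add: t_real[OF z] flip: r_herm[OF z] h_herm[OF z] q_herm[OF z])
    finally show ?thesis .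
  qed
  have "(N + 2) * ((N + 1) * (r z (C z w v x) y - r z x (C z v w y))) = (N + 2) * (L z v y * h z x w - L z x w * h z v y)"
    by (simp only: L_skew[OF z])
  then have "(N + 1) * (N + 2) * r z (C z w v x) y - (N + 1) * (N + 2) * r z x (C z v w y)
     = (N + 2) * (L z v y * h z x w - L z x w * h z v y)" by (simp add: algebra_simps)
  then show ?thesis unfolding r_C[OF z] 2 M_def by (simp add: algebra_simps)
qed

lemma M_eq:
  assumes z: "z \<in> S"
  obtains c where "\<And>v y. M z v y = c * h z v y"
proof
  fix v y
  have "(\<Sum>b\<in>UNIV. h z v y * M z (ax b) (eps z b)) = (\<Sum>b\<in>UNIV. h z (ax b) (eps z b) * M z v y)"
    by (intro sum.cong refl M_skew[OF z])
  then have "h z v y * (\<Sum>b\<in>UNIV. M z (ax b) (eps z b)) = N * M z v y"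
    by (simp add: h_eps[OF z] sum_distrib_left N)
  then show "M z v y = ((\<Sum>b\<in>UNIV. M z (ax b) (eps z b)) / N) * h z v y"
    using N_nz by (simp add: field_simps)
qed

text \<open>The gradient of the scalar curvature \<open>4 t\<close>.\<close>

definition T where "T z = (\<chi> b. 8 * T1b z (eps z b))"

lemma T_sm: "sm (\<lambda>z. T z $ b)"
  using sm_alin[of T1b "\<lambda>z. eps z b"] T1b_alin T1b_sm eps_sm
  by (simp add: T_def sm_intros)

text \<open>The coefficient 8 makes \<open>T\<close> the gradient of 4 \<open>t\<close> for the
  metric Re \<open>h\<close>: the differential of 4 \<open>t\<close> is 4 Re (\<open>T1\<close> +
  \<open>T1b\<close>), which is 8 Re \<open>T1b\<close> as the two are conjugate.\<close>

lemma h_T: assumes z: "z \<in> S" shows "h z (T z) y = 8 * T1b z y"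
proof -
  have "h z (T z) y = (\<Sum>c\<in>UNIV. h z (ax c) y * h z (T z) (eps z c))"
    by (rule alin_eps[OF z h_alin[OF z]])
  also have "\<dots> = 8 * (\<Sum>c\<in>UNIV. h z (ax c) y * T1b z (eps z c))"
    by (simp add: h_eps[OF z] T_def sum_distrib_left mult.left_commute)
  also have "\<dots> = 8 * T1b z y" by (simp only: alin_eps[OF z T1b_alin[OF z], symmetric])
  finally show ?thesis .
qed

text \<open>Applying \<open>delb\<close> to \<open>h_T\<close> gives the derivative of
  \<open>T\<close> and a correction in the antilinear slot; the conjugate of \<open>P_zero\<close>
  says that the right-hand side equals this correction.\<close>

lemma T_holomorphic:
  assumes z: "z \<in> S" shows "pdv \<i> w T z = 0"
proof (rule h_cancel[OF z])
  fix u
  have "delb w (\<lambda>z. h z (T z) u) z = delb w (\<lambda>z. 8 * T1b z u) z"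
    by (rule pd_cong[OF open_S z]) (rule h_T)
  also have "\<dots> = 8 * delb w (\<lambda>z. cnj (T1 z u)) z"
    unfolding pd_cmult[OF sm_diff[OF T1b_sm z]]
    using pd_cong[OF open_S z, of "\<lambda>z. T1b z u" "\<lambda>z. cnj (T1 z u)"] T1b_cnj by simp
  also have "\<dots> = 8 * cnj (T1 z (G z w u))"
    using pd_cnj[OF sm_diff[OF T1_sm z], of \<i> w u] P_zero[OF z, of w u] by (simp add: P_def)
  also have "\<dots> = h z (T z) (G z w u)"
    by (simp add: h_T[OF z] T1b_cnj[OF z])
  finally show "h z (pdv \<i> w T z) u = h z 0 u"
    using delb_h[OF T_sm z, of w u] clin_zero[OF h_clin[OF z]] by simp
qed

text \<open>The left-hand side is a multiple of the Laplacian, the right-hand side the divergence of \<open>T\<close>.\<close>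

lemma trace_L:
  assumes z: "z \<in> S"
  shows "8 * (\<Sum>b\<in>UNIV. L z (ax b) (eps z b)) = (\<Sum>b\<in>UNIV. del (ax b) (\<lambda>z. T z $ b) z) + gam z (T z)"
proof -
  have "8 * L z v u = h z (G z v (T z)) u + h z (pdv (-\<i>) v T z) u" for v u
  proof -
    have "8 * L z v u = del v (\<lambda>z. 8 * T1b z u) z"
      unfolding L_def by (rule pd_cmult[OF sm_diff[OF T1b_sm z], symmetric])
    also have "\<dots> = del v (\<lambda>z. h z (T z) u) z"
      by (rule pd_cong[OF open_S z]) (rule h_T[symmetric])
    finally show ?thesis using del_h[OF T_sm z, of v u] by simp
  qed
  then have "8 * (\<Sum>b\<in>UNIV. L z (ax b) (eps z b)) = (\<Sum>b\<in>UNIV. G z (ax b) (T z) $ b + pdv (-\<i>) (ax b) T z $ b)"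
    by (simp add: sum_distrib_left h_eps[OF z])
  then show ?thesis
    using G_sym[OF z, of "T z"] by (simp add: gam_def pdv_def sum.distrib)
qed

text \<open>In the divergence formula the derivative term is annihilated, because \<open>T\<close>
  is holomorphic and Wirtinger derivatives commute; in \<open>gam z (T z)\<close> only
  \<open>gam\<close> is differentiated, which gives minus the Ricci form.\<close>

lemma delb_trace_L:
  assumes z: "z \<in> S"
  shows "delb w (\<lambda>z. 16 * (\<Sum>b\<in>UNIV. L z (ax b) (eps z b))) z = - 2 * r z (T z) w"
proof -
  have g: "sm (\<lambda>z. gam z (T z))"
    using sm_clin[of gam T] gam_clin gam_sm T_sm by simp
  have "delb w (\<lambda>z. 16 * (\<Sum>b\<in>UNIV. L z (ax b) (eps z b))) z
      = delb w (\<lambda>z. 2 * ((\<Sum>b\<in>UNIV. del (ax b) (\<lambda>z. T z $ b) z) + gam z (T z))) z"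
    by (rule pd_cong[OF open_S z]) (simp flip: trace_L)
  also have "\<dots> = 2 * (delb w (\<lambda>z. \<Sum>b\<in>UNIV. del (ax b) (\<lambda>z. T z $ b) z) z + delb w (\<lambda>z. gam z (T z)) z)"
  proof -
    have s: "sm (\<lambda>z. \<Sum>b\<in>UNIV. del (ax b) (\<lambda>z. T z $ b) z)" by (intro sm_intros T_sm)
    show ?thesis
      using pd_cmult[OF sm_diff[OF smooth_on_add[OF open_S s g] z], of \<i> w 2]
        pd_add[OF sm_diff[OF s z] sm_diff[OF g z], of \<i> w] by simp
  qed
  also have "delb w (\<lambda>z. \<Sum>b\<in>UNIV. del (ax b) (\<lambda>z. T z $ b) z) z = 0"
  proof -
    have "delb w (\<lambda>z. \<Sum>b\<in>UNIV. del (ax b) (\<lambda>z. T z $ b) z) z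
        = (\<Sum>b\<in>UNIV. delb w (\<lambda>z. del (ax b) (\<lambda>z. T z $ b) z) z)"
      by (rule pd_sum[OF open_S z]) (intro sm_intros T_sm)
    also have "\<dots> = (\<Sum>b\<in>UNIV. del (ax b) (delb w (\<lambda>z. T z $ b)) z)"
      using pd_commute[OF T_sm open_S z] by simp
    also have "\<dots> = (\<Sum>b\<in>UNIV. del (ax b) (\<lambda>z. 0) z)"
    proof (intro sum.cong refl pd_cong[OF open_S z])
      fix b z assume "z \<in> S"
      from T_holomorphic[OF this, of w] show "delb w (\<lambda>z. T z $ b) z = 0"
        by (simp add: pdv_def vec_eq_iff)
    qed
    finally show ?thesis by simp
  qed
  also have "delb w (\<lambda>z. gam z (T z)) z = - r z (T z) w"
    using pd_clin[of gam T z \<i> w] gam_clin gam_sm T_sm z T_holomorphic[OF z, of w] clin_zero[OF gam_clin[OF z]]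
    by (simp add: r_def)
  finally show ?thesis by simp
qed

end

section \<open>Tangent vectors and fields in charts\<close>

locale complex_mfd =
  fixes K :: "('a, 'n::finite) geometry"
  assumes cm: "complex_manifold K"
begin

context
  fixes c assumes c: "c \<in> atlas K"
begin

lemma chart: "is_chart (space_of K) c"
  using cm c by (auto simp: complex_manifold_def)

lemma openin_chart: "openin (space_of K) (fst c)"
  using chart by (simp add: is_chart_def)

lemma chart_subset: "fst c \<subseteq> points K"
  using openin_chart openin_subset by blast

lemma inj_chart: "inj_on (snd c) (fst c)"
proof -
  have "topspace (subtopology (space_of K) (fst c)) = fst c"
    using chart_subset by auto
  then show ?thesis
    using chart homeomorphic_imp_injective_map[of "subtopology (space_of K) (fst c)"] by (auto simp: is_chart_def)
qed

lemma chart_inv_chart [simp]: "p \<in> fst c \<Longrightarrow> chart_inv c (snd c p) = p"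
  unfolding chart_inv_def by (rule inv_into_f_f[OF inj_chart])

lemma chart_chart_inv: "V \<subseteq> fst c \<Longrightarrow> z \<in> snd c ` V \<Longrightarrow> snd c (chart_inv c z) = z \<and> chart_inv c z \<in> V"
  by auto

lemma open_chart_image:
  assumes "openin (space_of K) V" "V \<subseteq> fst c" shows "open (snd c ` V)"
proof -
  have "openin (subtopology (space_of K) (fst c)) V"
    using assms by (metis inf.absorb1 openin_subtopology)
  then have "openin (top_of_set (snd c ` fst c)) (snd c ` V)"
    using chart homeomorphic_imp_open_map[of _ _ "snd c"] by (auto simp: is_chart_def open_map_def)
  moreover have "open (snd c ` fst c)" using chart by (simp add: is_chart_def)
  ultimately show ?thesis by (simp add: openin_open_eq)
qed

lemma open_chart_overlap: "openin (space_of K) V \<Longrightarrow> open (snd c ` (V \<inter> fst c))"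
  by (rule open_chart_image) (auto simp: openin_chart)

end

section \<open>Differentials of transition maps and coordinate vector fields\<close>

lemma transition_holomorphic:
  "c \<in> atlas K \<Longrightarrow> d \<in> atlas K \<Longrightarrow> holomorphic_map_on (snd c ` (fst c \<inter> fst d)) (transition c d)"
  using cm by (auto simp: complex_manifold_def)

lemma transition_smooth:
  "c \<in> atlas K \<Longrightarrow> d \<in> atlas K \<Longrightarrow> smooth_on (snd c ` (fst c \<inter> fst d)) (transition c d)"
  using transition_holomorphic by (auto simp: holomorphic_map_on_def)

lemma transition_diff:
  "c \<in> atlas K \<Longrightarrow> d \<in> atlas K \<Longrightarrow> p \<in> fst c \<Longrightarrow> p \<in> fst d \<Longrightarrow> transition c d differentiable (at (snd c p))"
  by (rule smooth_on_differentiable[OF transition_smooth]) auto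

lemma transition_cong:
  assumes c: "c \<in> atlas K" and d: "d \<in> atlas K" and p: "p \<in> fst c" "p \<in> fst d"
    and V: "openin (space_of K) V" "p \<in> V" and eq: "\<And>q. q \<in> V \<inter> fst c \<inter> fst d \<Longrightarrow> f (snd c q) = g (snd c q)"
  shows "dd f (snd c p) w = dd g (snd c p) w"
proof (rule dd_cong)
  show "open (snd c ` (V \<inter> fst d \<inter> fst c))"
    by (rule open_chart_overlap[OF c]) (intro openin_Int V openin_chart d)
qed (use p V eq in auto)

lemma transition_chain:
  assumes c: "c \<in> atlas K" and d: "d \<in> atlas K" and e: "e \<in> atlas K" and p: "p \<in> fst c" "p \<in> fst d" "p \<in> fst e"
  shows "dd (transition c e) (snd c p) w = dd (transition d e) (snd d p) (dd (transition c d) (snd c p) w)"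
proof -
  have "dd (transition c e) (snd c p) w = dd (transition d e \<circ> transition c d) (snd c p) w"
    by (rule transition_cong[OF c d p(1,2) openin_chart[OF e] p(3)])
      (auto simp: transition_def c d e)
  also have "\<dots> = (dd (transition d e) (transition c d (snd c p)) \<circ> dd (transition c d) (snd c p)) w"
    by (subst frechet_derivative_compose) (use transition_diff c d e p in \<open>auto simp: transition_def\<close>)
  finally show ?thesis using c p by (simp add: transition_def)
qed

lemma transition_self: "c \<in> atlas K \<Longrightarrow> p \<in> fst c \<Longrightarrow> dd (transition c c) (snd c p) w = w"
  using transition_cong[of c c p "fst c" "transition c c" "\<lambda>x. x" w] openin_chart
  by (auto simp: transition_def frechet_derivative_ident)

text \<open>The vector with components \<open>w\<close> in \<open>c\<close>, transported to all
  other charts. The default 0 is what \<open>tangent_space\<close> demands at charts not around the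
  point.\<close>

definition lift :: "('a, 'n) chart \<Rightarrow> complex^'n \<Rightarrow> ('a, 'n) tfield" where
  "lift c w p = (\<lambda>d. if p \<in> fst c \<and> d \<in> atlas K \<and> p \<in> fst d then dd (transition c d) (snd c p) w else 0)"

lemma tangentD:
  "v \<in> tangent_space K p \<Longrightarrow> c \<in> atlas K \<Longrightarrow> d \<in> atlas K \<Longrightarrow> p \<in> fst c \<Longrightarrow> p \<in> fst d
    \<Longrightarrow> v d = dd (transition c d) (snd c p) (v c)"
  "v \<in> tangent_space K p \<Longrightarrow> \<not> (d \<in> atlas K \<and> p \<in> fst d) \<Longrightarrow> v d = 0"
  unfolding tangent_space_def by blast+

lemma lift_tangent: assumes "c \<in> atlas K" "p \<in> fst c" shows "lift c w p \<in> tangent_space K p"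
  unfolding tangent_space_def
proof (intro CollectI conjI ballI impI allI)
  fix d e assume "d \<in> atlas K" "e \<in> atlas K" "p \<in> fst d \<and> p \<in> fst e"
  then show "lift c w p e = dd (transition d e) (snd d p) (lift c w p d)"
    using transition_chain[of c d e p w] assms by (simp add: lift_def)
qed (auto simp: lift_def)

lemma lift_same [simp]: "c \<in> atlas K \<Longrightarrow> p \<in> fst c \<Longrightarrow> lift c w p c = w"
  by (simp add: lift_def transition_self)

lemma tangent_eq_lift:
  assumes "v \<in> tangent_space K p" "c \<in> atlas K" "p \<in> fst c" shows "lift c (v c) p = v"
proof
  fix d
  show "lift c (v c) p d = v d"
    using tangentD(1)[OF assms(1,2), of d] tangentD(2)[OF assms(1), of d] assms(3)
    by (cases "d \<in> atlas K \<and> p \<in> fst d") (auto simp: lift_def)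
qed

lemma lift_linear: "c \<in> atlas K \<Longrightarrow> linear (\<lambda>w. lift c w p)"
  unfolding linear_iff
  using linear_frechet_derivative[OF transition_diff]
  by (auto simp: lift_def fun_eq_iff scaleR_fun_def linear_add linear_cmul)

lemma cstr_lift: "c \<in> atlas K \<Longrightarrow> cstr (lift c w p) = lift c (\<i> *s w) p"
  using transition_holomorphic by (auto simp: cstr_def lift_def holomorphic_map_on_def fun_eq_iff)

lemma tangent_iff: "c \<in> atlas K \<Longrightarrow> p \<in> fst c \<Longrightarrow> v \<in> tangent_space K p \<longleftrightarrow> (\<exists>w. v = lift c w p)"
  using lift_tangent tangent_eq_lift by metis

lemma zero_tangent: "0 \<in> tangent_space K p"
  unfolding tangent_space_def using linear_0[OF linear_frechet_derivative[OF transition_diff]] by simp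

lemma ex_chart: "p \<in> points K \<Longrightarrow> \<exists>c\<in>atlas K. p \<in> fst c"
  using cm by (auto simp: complex_manifold_def)

lemma subspace_tangent: "p \<in> points K \<Longrightarrow> subspace (tangent_space K p)"
proof -
  assume "p \<in> points K"
  then obtain c where c: "c \<in> atlas K" "p \<in> fst c" using ex_chart by blast
  have "tangent_space K p = range (\<lambda>w. lift c w p)" using tangent_iff[OF c] by blast
  then show ?thesis using linear_subspace_image[OF lift_linear[OF c(1)] subspace_UNIV] by simp
qed

text \<open>In another chart the components are the differential of the transition map applied to
  \<open>f\<close>, precomposed with the reverse transition; both are smooth on the overlap.\<close>

lemma smooth_field_lift:
  assumes c: "c \<in> atlas K" and V: "openin (space_of K) V" "V \<subseteq> fst c" and f: "smooth_on (snd c ` V) f"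
  shows "smooth_field K V (\<lambda>p. lift c (f (snd c p)) p)"
  unfolding smooth_field_def
proof (intro conjI ballI)
  fix p assume "p \<in> V"
  then show "lift c (f (snd c p)) p \<in> tangent_space K p" using lift_tangent c V by blast
next
  fix d assume d: "d \<in> atlas K"
  define W where "W = V \<inter> fst d"
  have W: "openin (space_of K) W" "W \<subseteq> fst c" "W \<subseteq> fst d"
    using V openin_chart[OF d] by (auto simp: W_def)
  have o: "open (snd d ` W)" "open (snd c ` W)" using W open_chart_image c d by auto
  have "smooth_on (snd c ` W) (\<lambda>y. dd (transition c d) y (f y))"
  proof (rule smooth_on_linear_family[OF o(2), where F = "\<lambda>y. dd (transition c d) y" and Y = f])
    show "linear (dd (transition c d) y)" if "y \<in> snd c ` W" for y
      using that W linear_frechet_derivative[OF transition_diff[OF c d]] by blast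
    have "snd c ` W \<subseteq> snd c ` (fst c \<inter> fst d)" using W by blast
    then show "smooth_on (snd c ` W) (\<lambda>y. dd (transition c d) y w)" for w
      using smooth_on_subset[OF smooth_on_dd[OF transition_smooth[OF c d]]] by blast
    show "smooth_on (snd c ` W) f" by (rule smooth_on_subset[OF f]) (auto simp: W_def)
  qed
  moreover have "smooth_on (snd d ` W) (transition d c)"
    by (rule smooth_on_subset[OF transition_smooth[OF d c]]) (use W in blast)
  moreover have "transition d c ` snd d ` W \<subseteq> snd c ` W"
    using W d by (auto simp: transition_def subset_iff)
  ultimately have "smooth_on (snd d ` W) (\<lambda>z. dd (transition c d) (transition d c z) (f (transition d c z)))"
    using smooth_on_compose[OF o(1)] by blast
  then show "smooth_on (snd d ` (V \<inter> fst d)) (\<lambda>z. lift c (f (snd c (chart_inv d z))) (chart_inv d z) d)"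
    unfolding W_def[symmetric]
    by (rule smooth_on_cong[OF o(1), rotated]) (use W d in \<open>auto simp: lift_def transition_def subset_iff\<close>)
qed

lemma smooth_fun_chart:
  assumes c: "c \<in> atlas K" and V: "openin (space_of K) V" "V \<subseteq> fst c" and f: "smooth_on (snd c ` V) f"
  shows "smooth_fun K V (\<lambda>p. f (snd c p))"
  unfolding smooth_fun_def
proof
  fix d assume d: "d \<in> atlas K"
  define W where "W = V \<inter> fst d"
  have W: "openin (space_of K) W" "W \<subseteq> fst c" "W \<subseteq> fst d"
    using V openin_chart[OF d] by (auto simp: W_def)
  have o: "open (snd d ` W)" using W open_chart_image d by auto
  have f': "smooth_on (snd c ` W) f" by (rule smooth_on_subset[OF f]) (auto simp: W_def)
  have t: "smooth_on (snd d ` W) (transition d c)"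
    by (rule smooth_on_subset[OF transition_smooth[OF d c]]) (use W in blast)
  have "transition d c ` snd d ` W \<subseteq> snd c ` W"
    using W d by (auto simp: transition_def subset_iff)
  from smooth_on_compose[OF o this t f']
  show "smooth_on (snd d ` (V \<inter> fst d)) (\<lambda>z. f (snd c (chart_inv d z)))"
    unfolding W_def[symmetric]
    by (rule smooth_on_cong[OF o, rotated]) (simp add: transition_def)
qed

lemma smooth_fun_mono: "smooth_fun K V f \<Longrightarrow> V' \<subseteq> V \<Longrightarrow> smooth_fun K V' f"
  unfolding smooth_fun_def by (blast intro: smooth_on_subset)

lemma smooth_field_mono: "smooth_field K V X \<Longrightarrow> V' \<subseteq> V \<Longrightarrow> smooth_field K V' X"
  unfolding smooth_field_def by (blast intro: smooth_on_subset)

lemma smooth_fun_cong: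
  assumes "openin (space_of K) V" "\<And>p. p \<in> V \<Longrightarrow> f p = g p" "smooth_fun K V f"
  shows "smooth_fun K V g"
  unfolding smooth_fun_def
proof
  fix c assume c: "c \<in> atlas K"
  show "smooth_on (snd c ` (V \<inter> fst c)) (\<lambda>z. g (chart_inv c z))"
    by (rule smooth_on_cong[OF open_chart_overlap[OF c assms(1)], of "\<lambda>z. f (chart_inv c z)"])
     (use assms c in \<open>auto simp: smooth_fun_def\<close>)
qed

lemma smooth_field_cong:
  assumes "openin (space_of K) V" "\<And>p. p \<in> V \<Longrightarrow> X p = Y p" "smooth_field K V X"
  shows "smooth_field K V Y"
  unfolding smooth_field_def
proof (intro conjI ballI)
  fix p assume "p \<in> V" then show "Y p \<in> tangent_space K p" using assms by (auto simp: smooth_field_def)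
next
  fix c assume c: "c \<in> atlas K"
  show "smooth_on (snd c ` (V \<inter> fst c)) (\<lambda>z. Y (chart_inv c z) c)"
    by (rule smooth_on_cong[OF open_chart_overlap[OF c assms(1)], of "\<lambda>z. X (chart_inv c z) c"])
     (use assms c in \<open>auto simp: smooth_field_def\<close>)
qed

lemma smooth_fun_nearE:
  assumes "smooth_fun_near K p f" "c \<in> atlas K" "p \<in> fst c"
  obtains V where "openin (space_of K) V" "p \<in> V" "V \<subseteq> fst c" "smooth_fun K V f"
    "smooth_on (snd c ` V) (\<lambda>z. f (chart_inv c z))"
proof -
  obtain U where U: "openin (space_of K) U" "p \<in> U" "smooth_fun K U f"
    using assms by (auto simp: smooth_fun_near_def)
  have "smooth_on (snd c ` (U \<inter> fst c)) (\<lambda>z. f (chart_inv c z))"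
    using U(3) assms(2) by (simp add: smooth_fun_def)
  with U assms show thesis
    by (intro that[of "U \<inter> fst c"]) (auto simp: openin_chart intro: smooth_fun_mono)
qed

lemma smooth_field_nearE:
  assumes "smooth_field_near K p X" "c \<in> atlas K" "p \<in> fst c"
  obtains V where "openin (space_of K) V" "p \<in> V" "V \<subseteq> fst c" "smooth_field K V X"
    "smooth_on (snd c ` V) (\<lambda>z. X (chart_inv c z) c)"
proof -
  obtain U where U: "openin (space_of K) U" "p \<in> U" "smooth_field K U X"
    using assms by (auto simp: smooth_field_near_def)
  have "smooth_on (snd c ` (U \<inter> fst c)) (\<lambda>z. X (chart_inv c z) c)"
    using U(3) assms(2) by (simp add: smooth_field_def)
  with U assms show thesis
    by (intro that[of "U \<inter> fst c"]) (auto simp: openin_chart intro: smooth_field_mono)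
qed

lemma smooth_fun_nearI: "openin (space_of K) U \<Longrightarrow> p \<in> U \<Longrightarrow> smooth_fun K U f \<Longrightarrow> smooth_fun_near K p f"
  by (auto simp: smooth_fun_near_def)

lemma smooth_field_nearI: "openin (space_of K) U \<Longrightarrow> p \<in> U \<Longrightarrow> smooth_field K U f \<Longrightarrow> smooth_field_near K p f"
  by (auto simp: smooth_field_near_def)

lemma smooth_field_lift_const: "c \<in> atlas K \<Longrightarrow> smooth_field K (fst c) (lift c w)"
  using smooth_field_lift[of c "fst c" "\<lambda>z. w", OF _ openin_chart _ smooth_on_const] by simp

lemma lift_near: "c \<in> atlas K \<Longrightarrow> p \<in> fst c \<Longrightarrow> smooth_field_near K p (lift c w)"
  using smooth_field_lift_const openin_chart smooth_field_nearI by metis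

text \<open>\<open>dfun\<close> uses an arbitrarily chosen chart; the chain rule for the transition
  map and the transformation law of \<open>v\<close> make the choice immaterial.\<close>

lemma dfun_eq:
  assumes f: "smooth_fun_near K p f" and c: "c \<in> atlas K" "p \<in> fst c" and v: "v \<in> tangent_space K p"
  shows "dfun K f p v = dd (\<lambda>z. f (chart_inv c z)) (snd c p) (v c)"
proof -
  define d where "d = (SOME c. c \<in> atlas K \<and> p \<in> fst c)"
  have d: "d \<in> atlas K" "p \<in> fst d"
    using someI[of "\<lambda>c. c \<in> atlas K \<and> p \<in> fst c" c] c by (auto simp: d_def)
  obtain V where V: "openin (space_of K) V" "p \<in> V" "V \<subseteq> fst c" "smooth_on (snd c ` V) (\<lambda>z. f (chart_inv c z))"
    using smooth_fun_nearE[OF f c] by metis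
  have D: "(\<lambda>z. f (chart_inv c z)) differentiable (at (snd c p))"
    by (rule smooth_on_differentiable[OF V(4)]) (use V in auto)
  have "dfun K f p v = dd (\<lambda>z. f (chart_inv d z)) (snd d p) (v d)"
    by (simp add: dfun_def d_def Let_def)
  also have "\<dots> = dd ((\<lambda>z. f (chart_inv c z)) \<circ> transition d c) (snd d p) (v d)"
    by (rule transition_cong[OF d(1) c(1) d(2) c(2) V(1,2)]) (auto simp: transition_def c d)
  also have "\<dots> = (dd (\<lambda>z. f (chart_inv c z)) (transition d c (snd d p)) \<circ> dd (transition d c) (snd d p)) (v d)"
    by (subst frechet_derivative_compose) (use transition_diff c d D in \<open>auto simp: transition_def\<close>)
  also have "\<dots> = dd (\<lambda>z. f (chart_inv c z)) (snd c p) (v c)"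
    using tangentD(1)[OF v d(1) c(1) d(2) c(2)] d by (simp add: transition_def)
  finally show ?thesis .
qed

lemma dfun_cong:
  assumes "openin (space_of K) V" "p \<in> V" "\<And>q. q \<in> V \<Longrightarrow> f q = g q"
  shows "dfun K f p v = dfun K g p v"
proof -
  define d where "d = (SOME c. c \<in> atlas K \<and> p \<in> fst c)"
  have "p \<in> points K" using assms openin_subset by blast
  then have d: "d \<in> atlas K" "p \<in> fst d"
    unfolding d_def using someI_ex[of "\<lambda>c. c \<in> atlas K \<and> p \<in> fst c"] ex_chart by blast+
  have "dd (\<lambda>z. f (chart_inv d z)) (snd d p) (v d) = dd (\<lambda>z. g (chart_inv d z)) (snd d p) (v d)"
    by (rule transition_cong[OF d(1,1,2,2) assms(1,2)]) (use assms(3) d in auto)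
  then show ?thesis by (simp add: dfun_def d_def Let_def)
qed

lemma smooth_field_add:
  assumes "openin (space_of K) V" "smooth_field K V X" "smooth_field K V Y"
  shows "smooth_field K V (\<lambda>p. X p + Y p)"
  unfolding smooth_field_def
proof (intro conjI ballI)
  fix p assume p: "p \<in> V"
  then have "p \<in> points K" using assms openin_subset by blast
  then show "X p + Y p \<in> tangent_space K p"
    using subspace_tangent subspace_add assms(2,3) p by (metis smooth_field_def)
next
  fix c assume c: "c \<in> atlas K"
  have "smooth_on (snd c ` (V \<inter> fst c)) (\<lambda>z. X (chart_inv c z) c)"
    "smooth_on (snd c ` (V \<inter> fst c)) (\<lambda>z. Y (chart_inv c z) c)"
    using assms(2,3) c by (auto simp: smooth_field_def)
  from smooth_on_add[OF open_chart_overlap[OF c assms(1)] this]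
  show "smooth_on (snd c ` (V \<inter> fst c)) (\<lambda>z. (X (chart_inv c z) + Y (chart_inv c z)) c)" by simp
qed

lemma smooth_field_scale:
  assumes "openin (space_of K) V" "smooth_fun K V f" "smooth_field K V Y"
  shows "smooth_field K V (\<lambda>p. f p *\<^sub>R Y p)"
  unfolding smooth_field_def
proof (intro conjI ballI)
  fix p assume p: "p \<in> V"
  then have "p \<in> points K" using assms openin_subset by blast
  then show "f p *\<^sub>R Y p \<in> tangent_space K p"
    using subspace_tangent subspace_scale assms(3) p by (metis smooth_field_def)
next
  fix c assume c: "c \<in> atlas K"
  have "smooth_on (snd c ` (V \<inter> fst c)) (\<lambda>z. f (chart_inv c z))"
    "smooth_on (snd c ` (V \<inter> fst c)) (\<lambda>z. Y (chart_inv c z) c)"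
    using assms(2,3) c by (auto simp: smooth_field_def smooth_fun_def)
  from smooth_on_scaleR[OF open_chart_overlap[OF c assms(1)] this]
  show "smooth_on (snd c ` (V \<inter> fst c)) (\<lambda>z. (f (chart_inv c z) *\<^sub>R Y (chart_inv c z)) c)"
    by (simp add: scaleR_fun_def)
qed

end

section \<open>Locality of the connection and extension of tangent vectors\<close>

locale kaehler_mfd = complex_mfd K for K :: "('a, 'n::finite) geometry" +
  assumes km: "kaehler_manifold K"
begin

lemma levi_civita: "levi_civita K" and riemannian: "riemannian K" and affine_connection: "affine_connection K"
  using km by (auto simp: kaehler_manifold_def levi_civita_def)

lemma conn_tangent: "p \<in> points K \<Longrightarrow> v \<in> tangent_space K p \<Longrightarrow> smooth_field_near K p Y \<Longrightarrow> conn K p v Y \<in> tangent_space K p"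
  using affine_connection by (simp add: affine_connection_def)

lemma conn_smooth: "openin (space_of K) U \<Longrightarrow> smooth_field K U X \<Longrightarrow> smooth_field K U Y
    \<Longrightarrow> smooth_field K U (\<lambda>p. conn K p (X p) Y)"
  using affine_connection by (simp add: affine_connection_def)

lemma conn_lin1: "p \<in> points K \<Longrightarrow> u \<in> tangent_space K p \<Longrightarrow> v \<in> tangent_space K p \<Longrightarrow> smooth_field_near K p Y \<Longrightarrow>
   conn K p (a *\<^sub>R u + b *\<^sub>R v) Y = a *\<^sub>R conn K p u Y + b *\<^sub>R conn K p v Y"
  using affine_connection by (simp add: affine_connection_def)

lemma conn_add: "p \<in> points K \<Longrightarrow> v \<in> tangent_space K p \<Longrightarrow> smooth_field_near K p Y \<Longrightarrow> smooth_field_near K p Y' \<Longrightarrow>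
   conn K p v (\<lambda>q. Y q + Y' q) = conn K p v Y + conn K p v Y'"
  using affine_connection by (simp add: affine_connection_def)

lemma conn_leibniz: "p \<in> points K \<Longrightarrow> v \<in> tangent_space K p \<Longrightarrow> smooth_fun_near K p f \<Longrightarrow> smooth_field_near K p Y \<Longrightarrow>
   conn K p v (\<lambda>q. f q *\<^sub>R Y q) = dfun K f p v *\<^sub>R Y p + f p *\<^sub>R conn K p v Y"
  using affine_connection by (simp add: affine_connection_def)

lemma dfun_const: "p \<in> points K \<Longrightarrow> dfun K (\<lambda>q. a) p v = 0"
  by (simp add: dfun_def Let_def frechet_derivative_const)

lemma smooth_fun_const: "smooth_fun K V (\<lambda>p. a)"
  by (simp add: smooth_fun_def smooth_on_const)

text \<open>The indicator function of \<open>V\<close> serves as a cutoff: it is smooth near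
  \<open>p\<close> with value 1 and derivative 0, and multiplication by it makes the two fields
  equal everywhere. The Leibniz rule then returns the original derivatives.\<close>

lemma conn_cong:
  assumes V: "openin (space_of K) V" "p \<in> V" and eq: "\<And>q. q \<in> V \<Longrightarrow> Y q = Y' q"
    and v: "v \<in> tangent_space K p" and Y: "smooth_field_near K p Y"
  shows "conn K p v Y = conn K p v Y'"
proof -
  obtain U where U: "openin (space_of K) U" "p \<in> U" "smooth_field K U Y"
    using Y by (auto simp: smooth_field_near_def)
  have UV: "openin (space_of K) (U \<inter> V)" "p \<in> U \<inter> V" using U V by auto
  have Y': "smooth_field_near K p Y'"
    using smooth_field_nearI[OF UV smooth_field_cong[OF UV(1) _ smooth_field_mono[OF U(3)]]] eq by auto
  have p: "p \<in> points K" using V openin_subset by blast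
  define ch :: "'a \<Rightarrow> real" where "ch q = (if q \<in> V then 1 else 0)" for q
  have ch: "smooth_fun_near K p ch"
    by (rule smooth_fun_nearI[OF V], rule smooth_fun_cong[OF V(1) _ smooth_fun_const[of V 1]]) (simp add: ch_def)
  have d: "dfun K ch p v = 0"
    using dfun_cong[OF V, of ch "\<lambda>_. 1" v] dfun_const[OF p] by (simp add: ch_def)
  have "(\<lambda>q. ch q *\<^sub>R Y q) = (\<lambda>q. ch q *\<^sub>R Y' q)" using eq by (auto simp: ch_def)
  then have "conn K p v (\<lambda>q. ch q *\<^sub>R Y q) = conn K p v (\<lambda>q. ch q *\<^sub>R Y' q)" by simp
  then show ?thesis
    unfolding conn_leibniz[OF p v ch Y] conn_leibniz[OF p v ch Y'] d using V by (simp add: ch_def)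
qed

lemma extend_props:
  assumes p: "p \<in> points K" "v \<in> tangent_space K p"
  shows "smooth_field_near K p (extend K p v)" "extend K p v p = v"
proof -
  obtain c where c: "c \<in> atlas K" "p \<in> fst c" using ex_chart p by blast
  have "smooth_field_near K p (lift c (v c)) \<and> lift c (v c) p = v"
    using lift_near[OF c] tangent_eq_lift[OF p(2) c] by auto
  then have "smooth_field_near K p (extend K p v) \<and> extend K p v p = v"
    unfolding extend_def by (rule someI[of "\<lambda>X. smooth_field_near K p X \<and> X p = v"])
  then show "smooth_field_near K p (extend K p v)" "extend K p v p = v" by auto
qed

end

section \<open>The metric and the connection in a chart\<close>

context kaehler_mfd
begin

lemma metric_smooth: "openin (space_of K) U \<Longrightarrow> smooth_field K U X \<Longrightarrow> smooth_field K U Y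
    \<Longrightarrow> smooth_fun K U (\<lambda>p. metric K p (X p) (Y p))"
  using riemannian by (simp add: riemannian_def)

lemma metric_linear: "p \<in> points K \<Longrightarrow> u \<in> tangent_space K p \<Longrightarrow> v \<in> tangent_space K p \<Longrightarrow> w \<in> tangent_space K p \<Longrightarrow>
    metric K p (a *\<^sub>R u + b *\<^sub>R v) w = a * metric K p u w + b * metric K p v w"
  using riemannian by (simp add: riemannian_def)

lemma metric_sym: "p \<in> points K \<Longrightarrow> u \<in> tangent_space K p \<Longrightarrow> v \<in> tangent_space K p \<Longrightarrow> metric K p u v = metric K p v u"
  using riemannian[unfolded riemannian_def, THEN conjunct2, THEN conjunct1, rule_format] .

lemma metric_pos: "p \<in> points K \<Longrightarrow> u \<in> tangent_space K p \<Longrightarrow> u \<noteq> 0 \<Longrightarrow> metric K p u u > 0"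
  using riemannian by (simp add: riemannian_def)

lemma metric_cstr: "p \<in> points K \<Longrightarrow> u \<in> tangent_space K p \<Longrightarrow> v \<in> tangent_space K p
    \<Longrightarrow> metric K p (cstr u) (cstr v) = metric K p u v"
  using km by (simp add: kaehler_manifold_def)

lemma conn_cstr: "p \<in> points K \<Longrightarrow> v \<in> tangent_space K p \<Longrightarrow> smooth_field_near K p Y
    \<Longrightarrow> conn K p v (\<lambda>q. cstr (Y q)) = cstr (conn K p v Y)"
  using km by (simp add: kaehler_manifold_def)

lemma conn_torsion: "p \<in> points K \<Longrightarrow> smooth_field_near K p X \<Longrightarrow> smooth_field_near K p Y
    \<Longrightarrow> conn K p (X p) Y - conn K p (Y p) X = lie_bracket K X Y p"
  using levi_civita by (simp add: levi_civita_def)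

lemma conn_metric: "p \<in> points K \<Longrightarrow> v \<in> tangent_space K p \<Longrightarrow> smooth_field_near K p Y \<Longrightarrow> smooth_field_near K p Z \<Longrightarrow>
    dfun K (\<lambda>q. metric K q (Y q) (Z q)) p v = metric K p (conn K p v Y) (Z p) + metric K p (Y p) (conn K p v Z)"
  using levi_civita by (simp add: levi_civita_def)

lemma smooth_field_near_add:
  assumes "smooth_field_near K p X" "smooth_field_near K p Y"
  shows "smooth_field_near K p (\<lambda>q. X q + Y q)"
proof -
  obtain U V where U: "openin (space_of K) U" "p \<in> U" "smooth_field K U X"
    and V: "openin (space_of K) V" "p \<in> V" "smooth_field K V Y"
    using assms by (auto simp: smooth_field_near_def)
  have o: "openin (space_of K) (U \<inter> V)" using U V by auto
  have "smooth_field K (U \<inter> V) (\<lambda>q. X q + Y q)"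
    by (rule smooth_field_add[OF o smooth_field_mono[OF U(3)] smooth_field_mono[OF V(3)]]) auto
  then show ?thesis using smooth_field_nearI[OF o] U V by auto
qed

lemma smooth_field_near_scale:
  assumes "smooth_fun_near K p f" "smooth_field_near K p Y"
  shows "smooth_field_near K p (\<lambda>q. f q *\<^sub>R Y q)"
proof -
  obtain U V where U: "openin (space_of K) U" "p \<in> U" "smooth_fun K U f"
    and V: "openin (space_of K) V" "p \<in> V" "smooth_field K V Y"
    using assms by (auto simp: smooth_fun_near_def smooth_field_near_def)
  have o: "openin (space_of K) (U \<inter> V)" using U V by auto
  have "smooth_field K (U \<inter> V) (\<lambda>q. f q *\<^sub>R Y q)"
    by (rule smooth_field_scale[OF o smooth_fun_mono[OF U(3)] smooth_field_mono[OF V(3)]]) auto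
  then show ?thesis using smooth_field_nearI[OF o] U V by auto
qed

lemma smooth_field_near_tangent: "smooth_field_near K p X \<Longrightarrow> X p \<in> tangent_space K p"
  by (auto simp: smooth_field_near_def smooth_field_def)

lemma smooth_field_near_conn:
  assumes "smooth_field_near K p X" "smooth_field_near K p Y"
  shows "smooth_field_near K p (\<lambda>q. conn K q (X q) Y)"
proof -
  obtain U V where U: "openin (space_of K) U" "p \<in> U" "smooth_field K U X"
    and V: "openin (space_of K) V" "p \<in> V" "smooth_field K V Y"
    using assms by (auto simp: smooth_field_near_def)
  have o: "openin (space_of K) (U \<inter> V)" using U V by auto
  have "smooth_field K (U \<inter> V) (\<lambda>q. conn K q (X q) Y)"
    by (rule conn_smooth[OF o smooth_field_mono[OF U(3)] smooth_field_mono[OF V(3)]]) auto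
  then show ?thesis using smooth_field_nearI[OF o] U V by auto
qed

lemma smooth_fun_near_const: "p \<in> points K \<Longrightarrow> smooth_fun_near K p (\<lambda>q. a)"
  using smooth_fun_nearI[of "points K"] smooth_fun_const by auto

lemma zero_near: "p \<in> points K \<Longrightarrow> smooth_field_near K p (\<lambda>q. 0)"
  by (rule smooth_field_nearI[of "points K"])
    (auto simp: smooth_field_def zero_tangent smooth_on_const)

lemma conn_scale: "p \<in> points K \<Longrightarrow> v \<in> tangent_space K p \<Longrightarrow> smooth_field_near K p Y \<Longrightarrow>
   conn K p v (\<lambda>q. a *\<^sub>R Y q) = a *\<^sub>R conn K p v Y"
  using conn_leibniz[of p v "\<lambda>q. a" Y] smooth_fun_near_const dfun_const by simp

text \<open>Smoothness of the partial sums is part of the claim because additivity of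
  \<open>conn\<close> requires it of both summands in the induction.\<close>

lemma conn_sum:
  assumes p: "p \<in> points K" "v \<in> tangent_space K p" and "finite I" "\<And>i. i \<in> I \<Longrightarrow> smooth_field_near K p (Y i)"
  shows "smooth_field_near K p (\<lambda>q. \<Sum>i\<in>I. Y i q) \<and> conn K p v (\<lambda>q. \<Sum>i\<in>I. Y i q) = (\<Sum>i\<in>I. conn K p v (Y i))"
  using assms(3,4)
proof (induction I rule: finite_induct)
  case empty
  have "conn K p v (\<lambda>q. 0) = 0" using conn_scale[OF p zero_near[OF p(1)], of 0] by simp
  then show ?case unfolding sum.empty using zero_near[OF p(1)] by blast
next
  case (insert i I)
  have i: "smooth_field_near K p (Y i)" and I: "smooth_field_near K p (\<lambda>q. \<Sum>i\<in>I. Y i q)"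
    and IH: "conn K p v (\<lambda>q. \<Sum>i\<in>I. Y i q) = (\<Sum>i\<in>I. conn K p v (Y i))"
    using insert by blast+
  show ?case
    unfolding sum.insert[OF insert(1,2)] IH[symmetric]
    by (intro conjI smooth_field_near_add[OF i I] conn_add[OF p i I])
qed

end

locale kaehler_chart = kaehler_mfd K for K :: "('a, 'n::finite) geometry" +
  fixes c :: "('a, 'n) chart"
  assumes c: "c \<in> atlas K"
begin

abbreviation "\<phi> \<equiv> snd c"
abbreviation "\<psi> \<equiv> chart_inv c"

definition "S = snd c ` fst c"

lemma S_open: "open S" unfolding S_def by (rule open_chart_image[OF c openin_chart[OF c]]) simp

lemma in_S: "p \<in> fst c \<Longrightarrow> \<phi> p \<in> S" by (simp add: S_def)

lemma psi_phi: "p \<in> fst c \<Longrightarrow> \<psi> (\<phi> p) = p" using c by simp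

lemma psi_in: "z \<in> S \<Longrightarrow> \<psi> z \<in> fst c" and phi_psi: "z \<in> S \<Longrightarrow> \<phi> (\<psi> z) = z"
  using chart_chart_inv[OF c, of "fst c" z] by (auto simp: S_def)

lemma pts: "p \<in> fst c \<Longrightarrow> p \<in> points K" using chart_subset[OF c] by blast

abbreviation e :: "complex^'n \<Rightarrow> ('a, 'n) tfield" where "e \<equiv> lift c"

lemma e_tan: "p \<in> fst c \<Longrightarrow> e x p \<in> tangent_space K p" by (rule lift_tangent[OF c])

lemma e_c: "p \<in> fst c \<Longrightarrow> e x p c = x" by (rule lift_same[OF c])

lemma e_add: "e (x + y) p = e x p + e y p" and e_scale: "e (a *\<^sub>R x) p = a *\<^sub>R e x p"
  using lift_linear[OF c, of p] by (auto simp: linear_iff)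

lemma tan_e: "p \<in> fst c \<Longrightarrow> v \<in> tangent_space K p \<Longrightarrow> v = e (v c) p"
  by (rule tangent_eq_lift[OF _ c, symmetric])

lemma e_J: "cstr (e x p) = e (\<i> *s x) p" by (rule cstr_lift[OF c])

definition g :: "complex^'n \<Rightarrow> complex^'n \<Rightarrow> complex^'n \<Rightarrow> real" where
  "g z x y = metric K (\<psi> z) (e x (\<psi> z)) (e y (\<psi> z))"

definition G :: "complex^'n \<Rightarrow> complex^'n \<Rightarrow> complex^'n \<Rightarrow> complex^'n" where
  "G z x y = conn K (\<psi> z) (e x (\<psi> z)) (e y) c"

lemma metric_e: "p \<in> fst c \<Longrightarrow> metric K p (e x p) (e y p) = g (\<phi> p) x y"
  by (simp add: g_def psi_phi)

lemma metric_eq: "p \<in> fst c \<Longrightarrow> v \<in> tangent_space K p \<Longrightarrow> w \<in> tangent_space K p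
    \<Longrightarrow> metric K p v w = g (\<phi> p) (v c) (w c)"
  using metric_e[of p "v c" "w c"] by (simp only: tan_e[symmetric])

lemma g_smooth: "smooth_on S (\<lambda>z. g z x y)"
proof -
  have "smooth_fun K (fst c) (\<lambda>p. metric K p (e x p) (e y p))"
    by (rule metric_smooth[OF openin_chart[OF c] smooth_field_lift_const[OF c] smooth_field_lift_const[OF c]])
  then have "smooth_on (snd c ` (fst c \<inter> fst c)) (\<lambda>z. metric K (\<psi> z) (e x (\<psi> z)) (e y (\<psi> z)))"
    unfolding smooth_fun_def using c by blast
  then show ?thesis by (simp add: g_def S_def)
qed

lemma g_lin1: assumes z: "z \<in> S" shows "g z (a *\<^sub>R x + b *\<^sub>R y) w = a * g z x w + b * g z y w"
proof -
  have "metric K (\<psi> z) (a *\<^sub>R e x (\<psi> z) + b *\<^sub>R e y (\<psi> z)) (e w (\<psi> z))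
     = a * metric K (\<psi> z) (e x (\<psi> z)) (e w (\<psi> z)) + b * metric K (\<psi> z) (e y (\<psi> z)) (e w (\<psi> z))"
    by (intro metric_linear e_tan[OF psi_in[OF z]] pts[OF psi_in[OF z]])
  then show ?thesis by (simp add: g_def e_add e_scale)
qed

lemma g_sym: assumes z: "z \<in> S" shows "g z x y = g z y x"
  unfolding g_def by (intro metric_sym e_tan[OF psi_in[OF z]] pts[OF psi_in[OF z]])

lemma g_add: "z \<in> S \<Longrightarrow> g z (x + y) w = g z x w + g z y w" and g_scale: "z \<in> S \<Longrightarrow> g z (a *\<^sub>R x) w = a * g z x w"
  using g_lin1[of z 1 x 1 y w] g_lin1[of z a x 0 x w] by auto

lemma g_scale2: "z \<in> S \<Longrightarrow> g z w (a *\<^sub>R x) = a * g z w x"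
  using g_scale[of z a x w] by (simp add: g_sym[of z w])

lemma g_minus: "z \<in> S \<Longrightarrow> g z (- x) w = - g z x w" "z \<in> S \<Longrightarrow> g z w (- x) = - g z w x"
  using g_scale[of z "-1" x w] g_scale2[of z w "-1" x] by auto

lemma g_pos: assumes z: "z \<in> S" and x: "x \<noteq> 0" shows "g z x x > 0"
proof -
  have "e x (\<psi> z) \<noteq> 0" using e_c[OF psi_in[OF z], of x] x by auto
  then show ?thesis
    unfolding g_def by (intro metric_pos e_tan[OF psi_in[OF z]] pts[OF psi_in[OF z]])
qed

lemma g_J: assumes z: "z \<in> S" shows "g z (\<i> *s x) (\<i> *s y) = g z x y"
  using metric_cstr[OF pts e_tan e_tan, OF psi_in psi_in psi_in, OF z z z, of x y]
  by (simp add: g_def e_J)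

lemma smult_i_i: "\<i> *s (\<i> *s x) = - (x :: complex^'n)"
  by (simp add: vec_eq_iff)

lemma g_J2: assumes z: "z \<in> S" shows "g z (\<i> *s x) y = - g z x (\<i> *s y)"
  using g_J[OF z, of x "\<i> *s y"] g_minus[OF z] by (simp add: smult_i_i)

lemma e_near: "p \<in> fst c \<Longrightarrow> smooth_field_near K p (e x)" by (rule lift_near[OF c])

lemma conn_e: assumes p: "p \<in> fst c" shows "conn K p (e x p) (e y) = e (G (\<phi> p) x y) p"
  unfolding G_def psi_phi[OF p] by (rule tan_e[OF p conn_tangent[OF pts[OF p] e_tan[OF p] e_near[OF p]]])

lemma G_smooth: "smooth_on S (\<lambda>z. G z x y)"
proof -
  have "smooth_field K (fst c) (\<lambda>p. conn K p (e x p) (e y))"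
    by (rule conn_smooth[OF openin_chart[OF c] smooth_field_lift_const[OF c] smooth_field_lift_const[OF c]])
  then have "smooth_on (snd c ` (fst c \<inter> fst c)) (\<lambda>z. conn K (\<psi> z) (e x (\<psi> z)) (e y) c)"
    unfolding smooth_field_def using c by blast
  then show ?thesis by (simp add: G_def S_def)
qed

lemma G_lin1: assumes z: "z \<in> S" shows "G z (a *\<^sub>R x + b *\<^sub>R y) w = a *\<^sub>R G z x w + b *\<^sub>R G z y w"
proof -
  note p = psi_in[OF z]
  show ?thesis
    using conn_lin1[OF pts[OF p] e_tan[OF p] e_tan[OF p] e_near[OF p], of a x b y w]
    by (simp add: G_def e_add e_scale scaleR_fun_def)
qed

lemma conn_linear2:
  assumes "p \<in> fst c" "v \<in> tangent_space K p"
  shows "linear (\<lambda>y. conn K p v (e y))"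
proof
  fix x y a
  have "e (x + y) = (\<lambda>q. e x q + e y q)" "e (a *\<^sub>R x) = (\<lambda>q. a *\<^sub>R e x q)"
    by (auto simp: e_add e_scale fun_eq_iff)
  then show "conn K p v (e (x + y)) = conn K p v (e x) + conn K p v (e y)"
    "conn K p v (e (a *\<^sub>R x)) = a *\<^sub>R conn K p v (e x)"
    using conn_add[OF pts[OF assms(1)] assms(2) e_near[OF assms(1)] e_near[OF assms(1)]]
      conn_scale[OF pts[OF assms(1)] assms(2) e_near[OF assms(1)]] by simp_all
qed

lemma G_linear: assumes z: "z \<in> S" shows "linear (G z x)" "linear (\<lambda>x. G z x y)"
proof -
  show "linear (G z x)"
    using conn_linear2[OF psi_in[OF z] e_tan[OF psi_in[OF z]], of x]
    by (auto simp: linear_iff G_def scaleR_fun_def)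
  show "linear (\<lambda>x. G z x y)"
    using G_lin1[OF z, of 1 _ 1 _ y] G_lin1[OF z, of _ _ 0 _ y] by (auto simp: linear_iff)
qed

text \<open>Near \<open>p\<close> the field is a combination of coordinate fields with smooth
  coefficients, so locality, additivity and the Leibniz rule apply; reading the basis expansion
  backwards reassembles a derivative and a Christoffel term.\<close>

lemma conn_eq:
  assumes p: "p \<in> fst c" and v: "v \<in> tangent_space K p" and Y: "smooth_field_near K p Y"
  shows "conn K p v Y c = dd (\<lambda>z. Y (\<psi> z) c) (\<phi> p) (v c) + G (\<phi> p) (v c) (Y p c)"
proof -
  obtain V where V: "openin (space_of K) V" "p \<in> V" "V \<subseteq> fst c" "smooth_field K V Y"
    "smooth_on (\<phi> ` V) (\<lambda>z. Y (\<psi> z) c)"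
    using smooth_field_nearE[OF Y c p] by metis
  have D: "(\<lambda>z. Y (\<psi> z) c) differentiable (at (\<phi> p))"
    by (rule smooth_on_differentiable[OF V(5)]) (use V in auto)
  define f where "f b q = Y q c \<bullet> b" for b q
  have f: "smooth_fun_near K p (f b)" for b
  proof (rule smooth_fun_nearI[OF V(1,2)])
    have "smooth_on (\<phi> ` V) (\<lambda>z. Y (\<psi> z) c \<bullet> b)"
      by (rule smooth_on_linear[OF bounded_linear_inner_left open_chart_image[OF c V(1,3)] V(5)])
    from smooth_fun_cong[OF V(1) _ smooth_fun_chart[OF c V(1,3) this]]
    show "smooth_fun K V (f b)" using V(3) c by (auto simp: f_def subset_iff)
  qed
  have eq: "Y q = (\<Sum>b\<in>Basis. f b q *\<^sub>R e b q)" if "q \<in> V" for q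
  proof -
    have "Y q = e (Y q c) q" using V(3,4) that by (intro tan_e) (auto simp: smooth_field_def)
    also have "\<dots> = (\<Sum>b\<in>Basis. f b q *\<^sub>R e b q)"
      unfolding f_def by (rule linear_euclidean_expand[OF lift_linear[OF c]])
    finally show ?thesis .
  qed
  have "conn K p v Y = conn K p v (\<lambda>q. \<Sum>b\<in>Basis. f b q *\<^sub>R e b q)"
    by (rule conn_cong[OF V(1,2) _ v Y]) (rule eq)
  also have "\<dots> = (\<Sum>b\<in>Basis. conn K p v (\<lambda>q. f b q *\<^sub>R e b q))"
    using conn_sum[OF pts[OF p] v finite_Basis, of "\<lambda>b q. f b q *\<^sub>R e b q"]
      smooth_field_near_scale[OF f e_near[OF p]] by blast
  also have "\<dots> = (\<Sum>b\<in>Basis. dfun K (f b) p v *\<^sub>R e b p + f b p *\<^sub>R conn K p v (e b))"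
    by (intro sum.cong refl conn_leibniz pts p v f e_near)
  also have "\<dots> = (\<Sum>b\<in>Basis. (dd (\<lambda>z. Y (\<psi> z) c) (\<phi> p) (v c) \<bullet> b) *\<^sub>R e b p + (Y p c \<bullet> b) *\<^sub>R conn K p v (e b))"
  proof (intro sum.cong refl arg_cong2[where f = "(+)"])
    fix b :: "complex^'n"
    have "dfun K (f b) p v = dd (\<lambda>z. Y (\<psi> z) c) (\<phi> p) (v c) \<bullet> b"
      unfolding dfun_eq[OF f c p v] unfolding f_def
      by (rule dd_linear_image[OF bounded_linear_inner_left D])
    then show "dfun K (f b) p v *\<^sub>R e b p = (dd (\<lambda>z. Y (\<psi> z) c) (\<phi> p) (v c) \<bullet> b) *\<^sub>R e b p" by simp
  qed (simp add: f_def)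
  also have "\<dots> = e (dd (\<lambda>z. Y (\<psi> z) c) (\<phi> p) (v c)) p + conn K p v (e (Y p c))"
    unfolding sum.distrib linear_euclidean_expand[OF lift_linear[OF c], symmetric]
      linear_euclidean_expand[OF conn_linear2[OF p v], symmetric] ..
  also have "conn K p v (e (Y p c)) = e (G (\<phi> p) (v c) (Y p c)) p"
    using conn_e[OF p, of "v c"] tan_e[OF p v] by simp
  finally show ?thesis by (simp add: e_c[OF p])
qed

text \<open>Coordinate fields have constant components in the chart, so their bracket vanishes and
  freedom from torsion gives the symmetry.\<close>

lemma G_symmetric: assumes z: "z \<in> S" shows "G z x y = G z y x"
proof -
  note p = psi_in[OF z]
  have "conn K (\<psi> z) (e x (\<psi> z)) (e y) - conn K (\<psi> z) (e y (\<psi> z)) (e x) = lie_bracket K (e x) (e y) (\<psi> z)"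
    by (intro conn_torsion pts[OF p] e_near[OF p])
  then have "G z x y - G z y x = lie_bracket K (e x) (e y) (\<psi> z) c"
    unfolding G_def by (simp only: minus_apply[symmetric])
  also have "\<dots> = 0"
  proof -
    have "dd (\<lambda>z. e y (\<psi> z) c) z v = 0" for y v
    proof -
      have "dd (\<lambda>z. e y (\<psi> z) c) z v = dd (\<lambda>z. y) z v"
        by (rule dd_cong[OF S_open z]) (rule e_c[OF psi_in])
      then show ?thesis by (simp add: frechet_derivative_const)
    qed
    then show ?thesis using p c by (simp add: lie_bracket_def phi_psi[OF z])
  qed
  finally show ?thesis by simp
qed

lemma G_J: assumes z: "z \<in> S" shows "G z x (\<i> *s y) = \<i> *s G z x y"
proof -
  note p = psi_in[OF z]
  have "conn K (\<psi> z) (e x (\<psi> z)) (\<lambda>q. cstr (e y q)) = cstr (conn K (\<psi> z) (e x (\<psi> z)) (e y))"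
    by (intro conn_cstr pts[OF p] e_near[OF p] e_tan[OF p])
  moreover have "(\<lambda>q. cstr (e y q)) = e (\<i> *s y)" by (rule ext) (rule e_J)
  ultimately show ?thesis by (simp add: G_def) (simp add: cstr_def)
qed

lemma g_compat: assumes z: "z \<in> S" shows "dd (\<lambda>z. g z x y) z v = g z (G z v x) y + g z x (G z v y)"
proof -
  note p = psi_in[OF z]
  have sf: "smooth_fun K (fst c) (\<lambda>p. metric K p (e x p) (e y p))"
    by (rule metric_smooth[OF openin_chart[OF c] smooth_field_lift_const[OF c] smooth_field_lift_const[OF c]])
  have "dfun K (\<lambda>p. metric K p (e x p) (e y p)) (\<psi> z) (e v (\<psi> z))
    = metric K (\<psi> z) (conn K (\<psi> z) (e v (\<psi> z)) (e x)) (e y (\<psi> z))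
      + metric K (\<psi> z) (e x (\<psi> z)) (conn K (\<psi> z) (e v (\<psi> z)) (e y))"
    by (intro conn_metric pts[OF p] e_near[OF p] e_tan[OF p])
  then show ?thesis
    unfolding dfun_eq[OF smooth_fun_nearI[OF openin_chart[OF c] p sf] c p e_tan[OF p]]
    by (simp add: conn_e[OF p] metric_e[OF p] phi_psi[OF z] e_c[OF p] flip: g_def)
qed

definition h :: "complex^'n \<Rightarrow> complex^'n \<Rightarrow> complex^'n \<Rightarrow> complex" where
  "h z x y = complex_of_real (g z x y) + \<i> * complex_of_real (g z x (\<i> *s y))"

text \<open>Since \<open>G\<close> commutes with \<i> in its second vector argument, the derivative
  of the imaginary part involves \<open>G z v y\<close> again, and both parts recombine into
  \<open>h\<close>.\<close>

lemma dd_h: assumes z: "z \<in> S" shows "dd (\<lambda>z. h z x y) z v = h z (G z v x) y + h z x (G z v y)"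
proof (rule dd_eqI)
  have "((\<lambda>z. g z x y) has_derivative (\<lambda>v. g z (G z v x) y + g z x (G z v y))) (at z)" for x y
    using smooth_on_has_derivative[OF g_smooth z] g_compat[OF z] by simp
  from has_derivative_add[OF has_derivative_of_real[OF this] has_derivative_mult_right[OF has_derivative_of_real[OF this]]]
  have "((\<lambda>z. h z x y) has_derivative (\<lambda>v. complex_of_real (g z (G z v x) y + g z x (G z v y)) +
       \<i> * complex_of_real (g z (G z v x) (\<i> *s y) + g z x (G z v (\<i> *s y))))) (at z)"
    unfolding h_def .
  then show "((\<lambda>z. h z x y) has_derivative (\<lambda>v. h z (G z v x) y + h z x (G z v y))) (at z)"
    by (simp add: h_def G_J[OF z] algebra_simps)
qed

lemma G_J1: "z \<in> S \<Longrightarrow> G z (\<i> *s x) y = \<i> *s G z x y"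
  using G_J[of z y x] by (simp add: G_symmetric[of z y])

lemma h_clin': assumes z: "z \<in> S" shows "clin (\<lambda>x. h z x y)"
  unfolding clin_def
proof (intro conjI allI)
  fix x x' a
  show "h z (x + x') y = h z x y + h z x' y" by (simp add: h_def g_add[OF z] algebra_simps)
  have "h z (\<i> *s x) y = \<i> * h z x y" for x
    by (simp add: h_def g_J2[OF z] smult_i_i g_minus[OF z] algebra_simps)
  moreover have "h z (t *\<^sub>R x) y = complex_of_real t * h z x y" for t x
    by (simp add: h_def g_scale[OF z] algebra_simps)
  moreover have "h z (x + x') y = h z x y + h z x' y" for x x'
    by (simp add: h_def g_add[OF z] algebra_simps)
  ultimately have "h z (a *s x) y = complex_of_real (Re a) * h z x y + complex_of_real (Im a) * (\<i> * h z x y)"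
    by (subst smult_decomp) simp
  also have "\<dots> = (complex_of_real (Re a) + \<i> * complex_of_real (Im a)) * h z x y" by (simp add: algebra_simps)
  finally show "h z (a *s x) y = a * h z x y" using complex_eq[of a] by simp
qed

lemma h_herm': assumes z: "z \<in> S" shows "h z y x = cnj (h z x y)"
  using g_sym[OF z, of y x] g_sym[OF z, of y "\<i> *s x"] g_J2[OF z, of x y]
  by (simp add: h_def)

lemma h_alin': assumes z: "z \<in> S" shows "h z x (\<i> *s y) = - \<i> * h z x y"
  by (simp add: h_def smult_i_i g_minus[OF z] algebra_simps)

end

sublocale kaehler_chart \<subseteq> kd: kaehler_domain S h G
proof unfold_locales
  show "open S" by (rule S_open)
next
  fix x y
  show "smooth_on S (\<lambda>z. h z x y)"
    unfolding h_def
    by (intro smooth_on_add smooth_on_mult smooth_on_const S_open smooth_on_linear[OF bounded_linear_of_real] g_smooth)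
  show "smooth_on S (\<lambda>z. G z x y $ b)" for b
    by (rule smooth_on_linear[OF bounded_linear_vec_nth S_open G_smooth])
  fix z assume z: "z \<in> S"
  show "clin (\<lambda>x. h z x y)" by (rule h_clin'[OF z])
  show "h z y x = cnj (h z x y)" by (rule h_herm'[OF z])
  show "Re (h z x x) > 0" if "x \<noteq> 0" using g_pos[OF z that] by (simp add: h_def)
  show "G z x y = G z y x" by (rule G_symmetric[OF z])
  show "clin (\<lambda>x. G z x y $ b)" for b
    unfolding clin_def
  proof (intro conjI allI)
    note l = G_linear(2)[OF z, of y]
    fix x x' a
    show "G z (x + x') y $ b = G z x y $ b + G z x' y $ b" using linear_add[OF l] by simp
    have "G z (a *s x) y = Re a *\<^sub>R G z x y + Im a *\<^sub>R (\<i> *s G z x y)"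
      by (subst smult_decomp) (simp add: linear_add[OF l] linear_cmul[OF l] G_J1[OF z])
    then show "G z (a *s x) y $ b = a * G z x y $ b" by (simp flip: smult_decomp)
  qed
  fix v
  \<comment> \<open>As functions of \<open>v\<close>, the two terms of \<open>dd_h\<close> are
    complex linear and antilinear, respectively; \<open>del\<close> keeps the first and cancels the
    second.\<close>
  have "h z x (\<i> *s w) = - \<i> * h z x w" "h z (\<i> *s x) w = \<i> * h z x w" for x w
    using h_alin'[OF z] clin_scale[OF h_clin'[OF z]] by auto
  then show "del v (\<lambda>z. h z x y) z = h z (G z v x) y"
    by (simp add: pd_def dd_h[OF z] G_J1[OF z] field_simps)
qed

section \<open>Curvature in coordinates\<close>

context kaehler_chart
begin

text \<open>Freedom from torsion writes the bracket as a difference of covariant derivatives, which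
  are tangent; no change of charts has to be computed.\<close>

lemma lie_bracket_tangent:
  assumes p: "p \<in> points K" and X: "smooth_field_near K p X" and Y: "smooth_field_near K p Y"
  shows "lie_bracket K X Y p \<in> tangent_space K p"
  unfolding conn_torsion[OF assms, symmetric]
  by (intro subspace_diff[OF subspace_tangent[OF p]] conn_tangent p smooth_field_near_tangent X Y)

text \<open>The second covariant derivative of \<open>Z\<close>; the terms other than derivatives of \<open>G\<close> and products of
  two \<open>G\<close> are symmetric or cancel against the bracket in the curvature.\<close>

lemma second_conn:
  assumes p: "p \<in> fst c" and X: "smooth_field_near K p X" and Y: "smooth_field_near K p Y" and Z: "smooth_field_near K p Z"
  defines "z \<equiv> \<phi> p" and "x \<equiv> X p c" and "y \<equiv> Y p c" and "w \<equiv> Z p c"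
    and "X' \<equiv> \<lambda>z. X (\<psi> z) c" and "Y' \<equiv> \<lambda>z. Y (\<psi> z) c" and "Z' \<equiv> \<lambda>z. Z (\<psi> z) c"
  shows "conn K p (X p) (\<lambda>q. conn K q (Y q) Z) c =
    dd (\<lambda>z. dd Z' z y) z x + dd Z' z (dd Y' z x) + dd (\<lambda>z. G z y w) z x + G z (dd Y' z x) w + G z y (dd Z' z x)
     + G z x (dd Z' z y + G z y w)"
proof -
  obtain V2 where V2: "openin (space_of K) V2" "p \<in> V2" "V2 \<subseteq> fst c" "smooth_field K V2 Y" "smooth_on (\<phi> ` V2) Y'"
    using smooth_field_nearE[OF Y c p] unfolding Y'_def by metis
  obtain V3 where V3: "openin (space_of K) V3" "p \<in> V3" "V3 \<subseteq> fst c" "smooth_field K V3 Z" "smooth_on (\<phi> ` V3) Z'"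
    using smooth_field_nearE[OF Z c p] unfolding Z'_def by metis
  define V where "V = V2 \<inter> V3"
  have V: "openin (space_of K) V" "p \<in> V" "V \<subseteq> fst c" "smooth_field K V Y" "smooth_field K V Z"
    using V2 V3 by (auto simp: V_def intro: smooth_field_mono)
  have "\<phi> ` V \<subseteq> \<phi> ` V2" "\<phi> ` V \<subseteq> \<phi> ` V3" by (auto simp: V_def)
  then have sm: "smooth_on (\<phi> ` V) Y'" "smooth_on (\<phi> ` V) Z'"
    using V2 V3 smooth_on_subset by blast+
  have o: "open (\<phi> ` V)" by (rule open_chart_image[OF c V(1,3)])
  have z: "z \<in> \<phi> ` V" "z \<in> S" "\<psi> z = p" using V p in_S psi_phi by (auto simp: z_def)
  have VS: "\<phi> ` V \<subseteq> S" using V by (auto simp: S_def)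
  have vals: "Y' z = y" "Z' z = w" using z by (auto simp: Y'_def Z'_def y_def w_def)
  have W: "smooth_field_near K p (\<lambda>q. conn K q (Y q) Z)"
    by (rule smooth_field_near_conn[OF Y Z])
  have Weq: "conn K q (Y q) Z c = dd Z' (\<phi> q) (Y' (\<phi> q)) + G (\<phi> q) (Y' (\<phi> q)) (Z' (\<phi> q))" if "q \<in> V" for q
  proof -
    have q: "q \<in> fst c" using that V by blast
    have "Y q \<in> tangent_space K q" "smooth_field_near K q Z"
      using V that by (auto simp: smooth_field_def intro: smooth_field_nearI)
    from conn_eq[OF q this] show ?thesis using q by (simp add: Y'_def Z'_def psi_phi)
  qed
  have "dd (\<lambda>z. conn K (\<psi> z) (Y (\<psi> z)) Z c) z x = dd (\<lambda>z. dd Z' z (Y' z) + G z (Y' z) (Z' z)) z x"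
    by (rule dd_cong[OF o z(1)]) (use Weq V(3) psi_phi in auto)
  also have "\<dots> = dd (\<lambda>z. dd Z' z y) z x + dd Z' z (dd Y' z x) + (dd (\<lambda>z. G z y w) z x + G z (dd Y' z x) w + G z y (dd Z' z x))"
  proof (rule dd_eqI, rule has_derivative_add)
    note dY = smooth_on_differentiable[OF sm(1) z(1)] and dZ = smooth_on_differentiable[OF sm(2) z(1)]
    show "((\<lambda>z. dd Z' z (Y' z)) has_derivative (\<lambda>x. dd (\<lambda>z. dd Z' z y) z x + dd Z' z (dd Y' z x))) (at z)"
      unfolding vals[symmetric]
      by (rule has_derivative_linear_family[OF o z(1), where F = "\<lambda>z. dd Z' z"])
        (auto intro!: linear_frechet_derivative smooth_on_differentiable[OF sm(2)] dY smooth_on_differentiable[OF smooth_on_dd[OF sm(2)] z(1)])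
    have dG: "(\<lambda>z. G z y w) differentiable at z" for y w
      by (rule smooth_on_differentiable[OF G_smooth z(2)])
    have GY: "((\<lambda>z. G z (Y' z) w') has_derivative (\<lambda>x. dd (\<lambda>z. G z y w') z x + G z (dd Y' z x) w')) (at z)" for w'
      unfolding vals[symmetric]
      by (rule has_derivative_linear_family[OF o z(1), where F = "\<lambda>z y. G z y w'", OF _ dG dY])
        (use G_linear(2) VS in blast)
    have "((\<lambda>z. G z (Y' z) (Z' z)) has_derivative (\<lambda>x. dd (\<lambda>z'. G z' (Y' z') (Z' z)) z x + G z (Y' z) (dd Z' z x))) (at z)"
      by (rule has_derivative_linear_family[OF o z(1), where F = "\<lambda>z. G z (Y' z)", OF _ _ dZ])
        (use G_linear(1) VS differentiableI[OF GY] in auto)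
    then show "((\<lambda>z. G z (Y' z) (Z' z)) has_derivative (\<lambda>x. dd (\<lambda>z. G z y w) z x + G z (dd Y' z x) w + G z y (dd Z' z x))) (at z)"
      unfolding vals dd_eqI[OF GY] .
  qed
  finally have 1: "dd (\<lambda>z. conn K (\<psi> z) (Y (\<psi> z)) Z c) z x = \<dots>" .
  from conn_eq[OF p smooth_field_near_tangent[OF X] W] show ?thesis
    using Weq[OF V(2)] 1 vals unfolding z_def[symmetric] x_def[symmetric] by simp
qed

text \<open>Second derivatives of \<open>Z\<close> cancel by symmetry and first-order terms against
  the bracket, leaving derivatives and products of \<open>G\<close>. Split by type, the
  (1,0)-derivatives cancel with the products by \<open>flat\<close>, and the conjugate derivatives
  are \<open>C\<close>.\<close>

lemma curv_field_eq:
  assumes p: "p \<in> fst c" and X: "smooth_field_near K p X" and Y: "smooth_field_near K p Y" and Z: "smooth_field_near K p Z"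
  shows "curv_field K X Y Z p c = kd.C (\<phi> p) (X p c) (Y p c) (Z p c) - kd.C (\<phi> p) (Y p c) (X p c) (Z p c)"
proof -
  define z x y w where "z = \<phi> p" and "x = X p c" and "y = Y p c" and "w = Z p c"
  define X' Y' Z' where "X' = (\<lambda>z. X (\<psi> z) c)" and "Y' = (\<lambda>z. Y (\<psi> z) c)" and "Z' = (\<lambda>z. Z (\<psi> z) c)"
  note defs = z_def x_def y_def w_def X'_def Y'_def Z'_def
  have z: "z \<in> S" using in_S p by (simp add: z_def)
  obtain V3 where V3: "openin (space_of K) V3" "p \<in> V3" "V3 \<subseteq> fst c" "smooth_field K V3 Z" "smooth_on (\<phi> ` V3) Z'"
    using smooth_field_nearE[OF Z c p] unfolding Z'_def by metis
  have zV: "open (\<phi> ` V3)" "z \<in> \<phi> ` V3" using open_chart_image[OF c V3(1,3)] V3(2) by (auto simp: z_def)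
  have sec: "dd (\<lambda>z. dd Z' z y) z x = dd (\<lambda>z. dd Z' z x) z y"
    by (rule dd_commute[OF V3(5) zV])
  have lZ: "linear (dd Z' z)" by (rule linear_frechet_derivative[OF smooth_on_differentiable[OF V3(5) zV(2)]])
  have br: "lie_bracket K X Y p c = dd Y' z x - dd X' z y"
    using p c by (simp add: lie_bracket_def defs)
  have cb: "conn K p (lie_bracket K X Y p) Z c = dd Z' z (dd Y' z x - dd X' z y) + G z (dd Y' z x - dd X' z y) w"
    using conn_eq[OF p lie_bracket_tangent[OF pts[OF p] X Y] Z] unfolding br by (simp add: defs)
  have fl: "curv_field K X Y Z p c = dd (\<lambda>z. G z y w) z x - dd (\<lambda>z. G z x w) z y + G z x (G z y w) - G z y (G z x w)"
    unfolding curv_field_def minus_apply cb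
      second_conn[OF p X Y Z, folded defs] second_conn[OF p Y X Z, folded defs]
    using sec by (simp add: linear_diff[OF lZ] linear_diff[OF G_linear(2)[OF z]] linear_add[OF G_linear(1)[OF z]])
  have "curv_field K X Y Z p c $ b = (kd.C z x y w - kd.C z y x w) $ b" for b
  proof -
    have "dd (\<lambda>z. G z y w) z x $ b = del x (\<lambda>z. G z y w $ b) z + delb x (\<lambda>z. G z y w $ b) z" for x y
      using dd_linear_image[OF bounded_linear_vec_nth[of b] smooth_on_differentiable[OF G_smooth z], of y w x]
        dd_split[of "\<lambda>z. G z y w $ b" z x] by simp
    moreover have "del x (\<lambda>z. G z y w $ b) z + G z x (G z y w) $ b = del y (\<lambda>z. G z x w $ b) z + G z y (G z x w) $ b"
      using kd.flat[OF z, of x y w] by (simp add: vec_eq_iff pdv_def)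
    ultimately show ?thesis unfolding fl by (simp add: kd.C_def pdv_def algebra_simps)
  qed
  then show ?thesis by (simp add: vec_eq_iff defs)
qed

lemma curv_eq:
  assumes p: "p \<in> fst c"
  shows "curv K p (e x p) (e y p) (e w p) c = kd.C (\<phi> p) x y w - kd.C (\<phi> p) y x w"
  using curv_field_eq[OF p extend_props(1)[OF pts[OF p] e_tan[OF p]] extend_props(1)[OF pts[OF p] e_tan[OF p]]
    extend_props(1)[OF pts[OF p] e_tan[OF p]]] extend_props(2)[OF pts[OF p] e_tan[OF p]]
  by (simp add: curv_def e_c[OF p])

end

section \<open>Ricci tensor and complex components in a chart\<close>

context kaehler_chart
begin

lemma curv_field_tangent:
  assumes p: "p \<in> points K" and X: "smooth_field_near K p X" and Y: "smooth_field_near K p Y" and Z: "smooth_field_near K p Z"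
  shows "curv_field K X Y Z p \<in> tangent_space K p"
  unfolding curv_field_def
  by (intro subspace_diff[OF subspace_tangent[OF p]] conn_tangent p smooth_field_near_tangent smooth_field_near_conn
      X Y Z lie_bracket_tangent)

lemma riem_eq:
  assumes p: "p \<in> fst c"
  shows "riem K p (e x p) (e y p) (e w p) (e u p) = Re (kd.k (\<phi> p) y x w u - kd.k (\<phi> p) x y w u)"
proof -
  note P = pts[OF p]
  have "curv K p (e x p) (e y p) (e w p) \<in> tangent_space K p"
    unfolding curv_def by (intro curv_field_tangent P extend_props(1) e_tan p)
  then have "riem K p (e x p) (e y p) (e w p) (e u p) = g (\<phi> p) (kd.C (\<phi> p) x y w - kd.C (\<phi> p) y x w) u"
    unfolding riem_def using metric_eq[OF p _ e_tan[OF p]] by (simp add: curv_eq[OF p] e_c[OF p])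
  also have "\<dots> = Re (h (\<phi> p) (kd.C (\<phi> p) x y w - kd.C (\<phi> p) y x w) u)" by (simp add: h_def)
  finally show ?thesis by (simp add: kd.k_def clin_diff[OF kd.h_clin[OF in_S[OF p]]])
qed

section \<open>Real orthonormal frames and complex traces\<close>

lemma g_sum: assumes z: "z \<in> S" shows "g z (\<Sum>i\<in>I. f i) w = (\<Sum>i\<in>I. g z (f i) w)"
proof -
  have "g z 0 w = 0" using g_scale[OF z, of 0] by simp
  then show ?thesis by (induction I rule: infinite_finite_induct) (auto simp: g_add[OF z])
qed

lemma g_diff: "z \<in> S \<Longrightarrow> g z (x - y) w = g z x w - g z y w"
  using g_add[of z x "- y"] g_minus by simp

lemma g_span_zero:
  assumes z: "z \<in> S" and B: "\<And>b. b \<in> B \<Longrightarrow> g z b w = 0" and x: "x \<in> span B"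
  shows "g z x w = 0"
proof -
  have "subspace {x. g z x w = 0}"
    unfolding subspace_def using g_scale[OF z, of 0 0 w] by (auto simp: g_add[OF z] g_scale[OF z])
  from span_induct[OF x this] B show ?thesis by auto
qed

definition orthonormal :: "complex^'n \<Rightarrow> nat \<Rightarrow> (nat \<Rightarrow> complex^'n) \<Rightarrow> bool" where
  "orthonormal z k f \<longleftrightarrow> (\<forall>i<k. \<forall>j<k. g z (f i) (f j) = (if i = j then 1 else 0))"

text \<open>A Gram-Schmidt step: the components of \<open>x\<close> along the given vectors are
  subtracted and the nonzero rest is normalised.\<close>

lemma orthonormal_extend:
  assumes z: "z \<in> S" and f: "orthonormal z k f" and x: "x \<notin> span (f ` {..<k})"
  shows "\<exists>f. orthonormal z (Suc k) f"
proof -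
  define y where "y = x - (\<Sum>i<k. g z x (f i) *\<^sub>R f i)"
  have "(\<Sum>i<k. g z x (f i) *\<^sub>R f i) \<in> span (f ` {..<k})"
    by (intro span_sum span_scale span_base) auto
  then have "y \<noteq> 0" using x by (auto simp: y_def)
  then have pos: "g z y y > 0" by (rule g_pos[OF z])
  have y0: "g z y (f j) = 0" if "j < k" for j
  proof -
    have "g z y (f j) = g z x (f j) - (\<Sum>i<k. g z x (f i) * g z (f i) (f j))"
      by (simp add: y_def g_diff[OF z] g_sum[OF z] g_scale[OF z])
    also have "(\<Sum>i<k. g z x (f i) * g z (f i) (f j)) = (\<Sum>i<k. if i = j then g z x (f i) else 0)"
      using f that by (intro sum.cong) (auto simp: orthonormal_def)
    finally show ?thesis using that by simp
  qed
  define r where "r = sqrt (g z y y)"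
  have r: "r > 0" "g z y y = r * r" using pos by (simp_all add: r_def)
  define w where "w = (1 / r) *\<^sub>R y"
  have w1: "g z w w = 1" using r by (simp add: w_def g_scale[OF z] g_scale2[OF z])
  have w2: "g z w (f j) = 0" if "j < k" for j using y0[OF that] by (simp add: w_def g_scale[OF z])
  have w3: "g z (f j) w = 0" if "j < k" for j using w2[OF that] g_sym[OF z, of w "f j"] by simp
  note w1 w2 w3
  then have "orthonormal z (Suc k) (f(k := w))"
    using f by (auto simp: orthonormal_def less_Suc_eq)
  then show ?thesis by blast
qed

lemma orthonormal_independent:
  assumes z: "z \<in> S" and f: "orthonormal z k f"
  shows "inj_on f {..<k}" "independent (f ` {..<k})"
proof -
  show inj: "inj_on f {..<k}"
    using f unfolding inj_on_def orthonormal_def by (metis lessThan_iff zero_neq_one)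
  have "f j \<notin> span (f ` {..<k} - {f j})" if j: "j < k" for j
  proof
    assume "f j \<in> span (f ` {..<k} - {f j})"
    then have "g z (f j) (f j) = 0"
      by (rule g_span_zero[OF z, rotated]) (use f j in \<open>auto simp: orthonormal_def\<close>)
    then show False using f j by (auto simp: orthonormal_def)
  qed
  then show "independent (f ` {..<k})" by (auto simp: dependent_def)
qed

lemma ex_orthonormal: assumes z: "z \<in> S" shows "k \<le> DIM(complex^'n) \<Longrightarrow> \<exists>f. orthonormal z k f"
proof (induction k)
  case 0
  then show ?case by (auto simp: orthonormal_def)
next
  case (Suc k)
  then obtain f where f: "orthonormal z k f" by auto
  have "dim (f ` {..<k}) \<le> card (f ` {..<k})" by (rule dim_le_card') simp
  also have "\<dots> \<le> k" using card_image_le[of "{..<k}" f] by simp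
  finally have "dim (f ` {..<k}) \<noteq> DIM(complex^'n)" using Suc by linarith
  then have "span (f ` {..<k}) \<noteq> UNIV" by (metis dim_UNIV dim_span)
  then show ?case using orthonormal_extend[OF z f] by blast
qed

lemma orthonormal_span:
  assumes z: "z \<in> S" and f: "orthonormal z (2 * CARD('n)) f"
  shows "span (f ` {..<2 * CARD('n)}) = UNIV"
proof -
  note i = orthonormal_independent[OF z f]
  have "card (f ` {..<2 * CARD('n)}) = DIM(complex^'n)" using card_image[OF i(1)] by simp
  then have "dim (f ` {..<2 * CARD('n)}) = DIM(complex^'n)" using dim_eq_card_independent[OF i(2)] by simp
  then show ?thesis using dim_eq_full[of "f ` {..<2 * CARD('n)}"] by simp
qed

definition E :: "'a \<Rightarrow> nat \<Rightarrow> complex^'n" where "E p i = frame K p i c"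

text \<open>\<open>frame\<close> is an arbitrary choice, so an orthonormal basis must be exhibited;
  it comes from Gram-Schmidt in coordinates.\<close>

lemma frame_props:
  assumes p: "p \<in> fst c"
  shows "i < 2 * CARD('n) \<Longrightarrow> frame K p i = e (E p i) p" "orthonormal (\<phi> p) (2 * CARD('n)) (E p)"
proof -
  obtain f where f: "orthonormal (\<phi> p) (2 * CARD('n)) f"
    using ex_orthonormal[OF in_S[OF p], of "2 * CARD('n)"] by auto
  have "orthonormal_basis K p (\<lambda>i. e (f i) p)"
    unfolding orthonormal_basis_def
  proof (intro conjI allI impI)
    have "tangent_space K p = (\<lambda>w. e w p) ` span (f ` {..<2 * CARD('n)})"
      using tangent_iff[OF c p] orthonormal_span[OF in_S[OF p] f] by auto
    also have "\<dots> = span ((\<lambda>w. e w p) ` f ` {..<2 * CARD('n)})"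
      by (rule linear_span_image[OF lift_linear[OF c], symmetric])
    finally show "tangent_space K p = span ((\<lambda>i. e (f i) p) ` {..<2 * CARD('n)})" by (simp add: image_image)
  qed (use f in \<open>simp add: orthonormal_def metric_e[OF p]\<close>)
  then have fr: "orthonormal_basis K p (frame K p)" unfolding frame_def by (rule someI[of "orthonormal_basis K p"])
  have eq: "frame K p i = e (E p i) p" if "i < 2 * CARD('n)" for i
    unfolding E_def
    by (rule tan_e[OF p]) (use fr that in \<open>auto simp: orthonormal_basis_def intro: span_base\<close>)
  then show "i < 2 * CARD('n) \<Longrightarrow> frame K p i = e (E p i) p" .
  show "orthonormal (\<phi> p) (2 * CARD('n)) (E p)"
    unfolding orthonormal_def
  proof (intro allI impI)
    fix i j assume ij: "i < 2 * CARD('n)" "j < 2 * CARD('n)"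
    then have "metric K p (frame K p i) (frame K p j) = (if i = j then 1 else 0)"
      using fr by (simp add: orthonormal_basis_def)
    then show "g (\<phi> p) (E p i) (E p j) = (if i = j then 1 else 0)"
      unfolding eq[OF ij(1)] eq[OF ij(2)] metric_e[OF p] .
  qed
qed

lemma orthonormal_expand:
  assumes z: "z \<in> S" and f: "orthonormal z (2 * CARD('n)) f"
  shows "(\<Sum>i<2 * CARD('n). g z x (f i) *\<^sub>R f i) = x"
proof -
  have l: "linear (\<lambda>x. \<Sum>i<2 * CARD('n). g z x (f i) *\<^sub>R f i)"
    by (rule linearI) (simp_all add: g_add[OF z] g_scale[OF z] scaleR_add_left sum.distrib scaleR_right.sum)
  have "(\<Sum>i<2 * CARD('n). g z x (f i) *\<^sub>R f i) = (\<lambda>x. x) x"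
  proof (rule linear_eq_on_span[OF l linear_ident])
    fix y assume "y \<in> f ` {..<2 * CARD('n)}"
    then obtain j where j: "j < 2 * CARD('n)" "y = f j" by auto
    have "(\<Sum>i<2 * CARD('n). g z y (f i) *\<^sub>R f i) = (\<Sum>i<2 * CARD('n). if j = i then f i else 0)"
      using f j by (intro sum.cong) (auto simp: orthonormal_def)
    then show "(\<Sum>i<2 * CARD('n). g z y (f i) *\<^sub>R f i) = y" using j by simp
  qed (use orthonormal_span[OF z f] in auto)
  then show ?thesis .
qed

text \<open>The real part of \<open>h\<close> reproduces \<open>x\<close>, and so does \<i> times
  its imaginary part because J is skew for \<open>g\<close>. The two contributions add up in the
  first sum and, after conjugation, cancel in the second.\<close>

lemma sum_h_expand:
  assumes z: "z \<in> S" and f: "orthonormal z (2 * CARD('n)) f"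
  shows "(\<Sum>i<2 * CARD('n). h z x (f i) *s f i) = 2 *s x"
    and "(\<Sum>i<2 * CARD('n). cnj (h z x (f i)) *s f i) = 0"
proof -
  have j: "(\<Sum>i<2 * CARD('n). (\<i> * complex_of_real (g z x (\<i> *s f i))) *s f i) = x"
  proof -
    have "(\<Sum>i<2 * CARD('n). (\<i> * complex_of_real (g z x (\<i> *s f i))) *s f i)
      = - \<i> *s (\<Sum>i<2 * CARD('n). g z (\<i> *s x) (f i) *\<^sub>R f i)"
      by (simp add: vec_eq_iff g_J2[OF z] scaleR_conv_of_real[where 'a = complex] sum_distrib_left sum_negf mult.assoc)
    then show ?thesis by (simp add: orthonormal_expand[OF z f] smult_i_i)
  qed
  have r: "(\<Sum>i<2 * CARD('n). complex_of_real (g z x (f i)) *s f i) = x"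
    using orthonormal_expand[OF z f, of x] by (simp add: scaleR_eq_vector_smult)
  show "(\<Sum>i<2 * CARD('n). h z x (f i) *s f i) = 2 *s x"
    using r j by (simp add: h_def vector_sadd_rdistrib sum.distrib vec_eq_iff)
  have "(\<Sum>i<2 * CARD('n). cnj (h z x (f i)) *s f i) = (\<Sum>i<2 * CARD('n). complex_of_real (g z x (f i)) *s f i)
    - (\<Sum>i<2 * CARD('n). (\<i> * complex_of_real (g z x (\<i> *s f i))) *s f i)"
    by (simp add: h_def vec_eq_iff left_diff_distrib sum_subtractf)
  then show "(\<Sum>i<2 * CARD('n). cnj (h z x (f i)) *s f i) = 0" unfolding r j by simp
qed

text \<open>A real frame counts each complex direction twice, which doubles the trace of a
  sesquilinear form; for a complex bilinear form the contributions of x and Jx are opposite.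
  \<open>sum_h_expand\<close> makes this precise for frames not adapted to J.\<close>

lemma trace_orthonormal:
  assumes z: "z \<in> S" and f: "orthonormal z (2 * CARD('n)) f" and B1: "\<And>y. clin (\<lambda>x. B x y)"
  shows "(\<And>x. alin (B x)) \<Longrightarrow> (\<Sum>i<2 * CARD('n). B (f i) (f i)) = 2 * (\<Sum>b\<in>UNIV. B (ax b) (kd.eps z b))"
    and "(\<And>x. clin (B x)) \<Longrightarrow> (\<Sum>i<2 * CARD('n). B (f i) (f i)) = 0"
proof -
  have *: "(\<Sum>i<2 * CARD('n). B (f i) (f i)) = (\<Sum>b\<in>UNIV. \<Sum>i<2 * CARD('n). cnj (h z (kd.eps z b) (f i)) * B (ax b) (f i))"
  proof -
    have "(\<Sum>i<2 * CARD('n). B (f i) (f i)) = (\<Sum>i<2 * CARD('n). \<Sum>b\<in>UNIV. f i $ b * B (ax b) (f i))"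
      by (intro sum.cong refl clin_expand[OF B1])
    also have "\<dots> = (\<Sum>b\<in>UNIV. \<Sum>i<2 * CARD('n). h z (f i) (kd.eps z b) * B (ax b) (f i))"
      by (subst sum.swap) (simp add: kd.h_eps[OF z])
    finally show ?thesis by (simp only: h_herm'[OF z, symmetric])
  qed
  show "(\<Sum>i<2 * CARD('n). B (f i) (f i)) = 2 * (\<Sum>b\<in>UNIV. B (ax b) (kd.eps z b))" if B2: "\<And>x. alin (B x)"
  proof -
    have "(\<Sum>i<2 * CARD('n). cnj (h z y (f i)) * B x (f i)) = 2 * B x y" for x y
    proof -
      have "(\<Sum>i<2 * CARD('n). cnj (h z y (f i)) * B x (f i)) = B x (\<Sum>i<2 * CARD('n). h z y (f i) *s f i)"
        by (simp add: alin_sum[OF B2] alin_scale[OF B2])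
      then show ?thesis by (simp add: sum_h_expand[OF z f] alin_scale[OF B2])
    qed
    then show ?thesis unfolding * by (simp add: sum_distrib_left)
  qed
  show "(\<Sum>i<2 * CARD('n). B (f i) (f i)) = 0" if B2: "\<And>x. clin (B x)"
  proof -
    have "(\<Sum>i<2 * CARD('n). cnj (h z y (f i)) * B x (f i)) = 0" for x y
    proof -
      have "(\<Sum>i<2 * CARD('n). cnj (h z y (f i)) * B x (f i)) = B x (\<Sum>i<2 * CARD('n). cnj (h z y (f i)) *s f i)"
        by (simp add: clin_sum[OF B2] clin_scale[OF B2])
      then show ?thesis by (simp add: sum_h_expand[OF z f] clin_zero[OF B2])
    qed
    then show ?thesis unfolding * by simp
  qed
qed

lemma sum_frame: "p \<in> fst c \<Longrightarrow> (\<Sum>i<2 * CARD('n). F (frame K p i)) = (\<Sum>i<2 * CARD('n). F (e (E p i) p))"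
  using frame_props(1) by (intro sum.cong) auto

lemma C_vec:
  assumes z: "z \<in> S"
  shows "kd.C z y x (w + w') = kd.C z y x w + kd.C z y x w'" "kd.C z y x (a *s w) = a *s kd.C z y x w"
    "kd.C z y (w + w') x = kd.C z y w x + kd.C z y w' x" "kd.C z y (a *s w) x = a *s kd.C z y w x"
    "kd.C z (w + w') y x = kd.C z w y x + kd.C z w' y x" "kd.C z (a *s w) y x = cnj a *s kd.C z w y x"
  using kd.C_clin3[OF z] kd.C_clin2[OF z] kd.C_alin[OF z]
  by (auto simp: vec_eq_iff clin_def alin_def)

lemma k_lin:
  assumes z: "z \<in> S"
  shows "clin (\<lambda>x. kd.k z x y a u)" "alin (\<lambda>y. kd.k z x y a u)" "clin (\<lambda>a. kd.k z x y a u)" "alin (\<lambda>u. kd.k z x y a u)"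
  by (auto simp: kd.k_def clin_def alin_def C_vec[OF z] clin_add[OF h_clin'[OF z]] clin_scale[OF h_clin'[OF z]]
    alin_add[OF kd.h_alin[OF z]] alin_scale[OF kd.h_alin[OF z]])

text \<open>The contraction meets two antilinear slots in one term of \<open>riem_eq\<close>, which
  gives 0; the other term is twice a complex trace, brought to the shape of \<open>r\<close> by
  \<open>k_sym\<close>.\<close>

lemma ricci_eq:
  assumes p: "p \<in> fst c"
  shows "ricci K p (e y p) (e w p) = Re (2 * kd.r (\<phi> p) y w)"
proof -
  let ?z = "\<phi> p"
  note z = in_S[OF p] and o = frame_props(2)[OF p]
  have "ricci K p (e y p) (e w p) = (\<Sum>i<2 * CARD('n). riem K p (e (E p i) p) (e y p) (e w p) (e (E p i) p))"
    unfolding ricci_def by (rule sum_frame[OF p])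
  also have "\<dots> = Re ((\<Sum>i<2 * CARD('n). kd.k ?z y (E p i) w (E p i)) - (\<Sum>i<2 * CARD('n). kd.k ?z (E p i) y w (E p i)))"
    by (simp add: riem_eq[OF p] sum_subtractf)
  also have "(\<Sum>i<2 * CARD('n). kd.k ?z y (E p i) w (E p i)) = 0"
  proof -
    have "(\<Sum>i<2 * CARD('n). cnj (kd.k ?z y (E p i) w (E p i))) = 0"
      by (rule trace_orthonormal(2)[OF z o, where B = "\<lambda>x x'. cnj (kd.k ?z y x w x')"])
       (use k_lin[OF z] in \<open>auto intro: alin_clin_cnj\<close>)
    then show ?thesis by (metis cnj_sum complex_cnj_zero_iff)
  qed
  also have "(\<Sum>i<2 * CARD('n). kd.k ?z (E p i) y w (E p i)) = 2 * (\<Sum>b\<in>UNIV. kd.k ?z (ax b) y w (kd.eps ?z b))"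
    by (rule trace_orthonormal(1)[OF z o, where B = "\<lambda>x x'. kd.k ?z x y w x'"]) (use k_lin[OF z] in auto)
  also have "(\<Sum>b\<in>UNIV. kd.k ?z (ax b) y w (kd.eps ?z b)) = - kd.r ?z w y"
    unfolding kd.r_eq_k[OF z] by (simp add: kd.k_sym[OF z, of w])
  also have "kd.r ?z w y = cnj (kd.r ?z y w)" by (rule kd.r_herm[OF z])
  finally show ?thesis by simp
qed

lemma scal_eq:
  assumes p: "p \<in> fst c"
  shows "complex_of_real (scal K p) = 4 * kd.t (\<phi> p)"
proof -
  let ?z = "\<phi> p"
  note z = in_S[OF p] and o = frame_props(2)[OF p]
  have "scal K p = (\<Sum>i<2 * CARD('n). ricci K p (e (E p i) p) (e (E p i) p))"
    unfolding scal_def by (rule sum_frame[OF p])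
  also have "\<dots> = 2 * Re (\<Sum>i<2 * CARD('n). kd.r ?z (E p i) (E p i))"
    by (simp add: ricci_eq[OF p] sum_distrib_left)
  also have "(\<Sum>i<2 * CARD('n). kd.r ?z (E p i) (E p i)) = 2 * kd.t ?z"
    unfolding kd.t_def by (rule trace_orthonormal(1)[OF z o]) (use kd.r_clin[OF z] kd.r_alin[OF z] in auto)
  finally show ?thesis using kd.t_real[OF z] by (simp add: complex_eq_iff)
qed

text \<open>The (1,0)-vector \<open>x - \<i> J x\<close>.\<close>

definition ZZ :: "'a \<Rightarrow> complex^'n \<Rightarrow> ('a, 'n) ctvec" where "ZZ p x = (e x p, e (- \<i> *s x) p)"

lemma e_neg: "e (- x) p = - e x p"
  using e_scale[of "-1" x p] by simp

lemma T10_iff: assumes p: "p \<in> fst c" shows "W \<in> T10 K p \<longleftrightarrow> (\<exists>x. W = ZZ p x)"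
proof
  assume "W \<in> T10 K p"
  then have W: "fst W \<in> tangent_space K p" "cstr (fst W) = - snd W"
    by (auto simp: T10_def cscale_def prod_eq_iff)
  then obtain x where x: "fst W = e x p" using tangent_iff[OF c p] by blast
  have "snd W = - e (\<i> *s x) p" using W(2) x e_J[of x p] by simp
  then have "W = ZZ p x" using x by (simp add: ZZ_def prod_eq_iff e_neg)
  then show "\<exists>x. W = ZZ p x" by blast
next
  assume "\<exists>x. W = ZZ p x"
  then obtain x where "W = ZZ p x" by blast
  then show "W \<in> T10 K p"
    by (simp add: T10_def ZZ_def e_tan[OF p] cscale_def e_J smult_i_i flip: e_neg)
qed

lemma cconj_ZZ: "cconj (ZZ p x) = (e x p, e (\<i> *s x) p)"
  by (simp add: cconj_def ZZ_def e_neg)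

lemma cscale_ZZ: "cscale a (ZZ p x) = ZZ p (a *s x)"
proof -
  have 1: "e (a *s x) p = Re a *\<^sub>R e x p + Im a *\<^sub>R e (\<i> *s x) p" for x
    by (subst smult_decomp) (simp only: e_add e_scale)
  show ?thesis
    using 1[of x] 1[of "- \<i> *s x"] by (simp add: ZZ_def cscale_def e_neg smult_i_i vector_smult_assoc mult.commute)
qed

lemma ZZ_add: "ZZ p (x + y) = ZZ p x + ZZ p y"
  by (simp only: ZZ_def vector_add_ldistrib e_add add_Pair)

lemma ZZ_sum: "ZZ p (\<Sum>i\<in>I. f i) = (\<Sum>i\<in>I. ZZ p (f i))"
proof -
  have "e 0 p = 0" using e_scale[of 0 0 p] by simp
  then have "ZZ p 0 = 0" by (simp add: ZZ_def zero_prod_def)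
  then show ?thesis by (induction I rule: infinite_finite_induct) (simp_all add: ZZ_add)
qed

lemma ZZ_inj: "p \<in> fst c \<Longrightarrow> ZZ p x = ZZ p y \<Longrightarrow> x = y"
  using e_c[of p] by (metis ZZ_def prod.inject)

text \<open>Re s is half the sum of s and its conjugate. On x - \<i>Jx and y + \<i>Jy the part s is
  doubled in each slot and the conjugate part vanishes.\<close>

lemma cext2_ZZ:
  assumes B: "\<And>x y. B (e x p) (e y p) = Re (s x y)" and s: "\<And>y. clin (\<lambda>x. s x y)" "\<And>x. alin (s x)"
  shows "cext2 B (ZZ p x) (cconj (ZZ p y)) = 2 * s x y"
proof -
  have s': "s (- \<i> *s x) y = - \<i> * s x y" "s x (\<i> *s y) = - \<i> * s x y" for x y
    using clin_scale[OF s(1), of "- \<i>"] alin_scale[OF s(2)] by auto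
  show ?thesis
    unfolding cconj_ZZ unfolding cext2_def cext_def ZZ_def fst_conv snd_conv B s' by (simp add: complex_eq_iff)
qed

lemma mixed_eq:
  assumes "\<And>x y. B (e x p) (e y p) = Re (s x y)" "\<And>y. clin (\<lambda>x. s x y)" "\<And>x. alin (s x)"
    and "\<And>\<alpha>. Z \<alpha> = ZZ p (a \<alpha>)"
  shows "mixed B Z $ \<alpha> $ \<beta> = 2 * s (a \<alpha>) (a \<beta>)"
  using cext2_ZZ[OF assms(1-3)] assms(4) by (simp add: mixed_def)

lemma Re_h: "Re (h z x y) = g z x y"
  by (simp add: h_def)

lemma mixed_metric: "p \<in> fst c \<Longrightarrow> (\<And>\<alpha>. Z \<alpha> = ZZ p (a \<alpha>)) \<Longrightarrow> mixed (metric K p) Z $ \<alpha> $ \<beta> = 2 * h (\<phi> p) (a \<alpha>) (a \<beta>)"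
  by (rule mixed_eq[where s = "h (\<phi> p)"]) (auto simp: metric_e Re_h intro: h_clin' kd.h_alin in_S)

lemma mixed_ricci: "p \<in> fst c \<Longrightarrow> (\<And>\<alpha>. Z \<alpha> = ZZ p (a \<alpha>)) \<Longrightarrow> mixed (ricci K p) Z $ \<alpha> $ \<beta> = 4 * kd.r (\<phi> p) (a \<alpha>) (a \<beta>)"
  using mixed_eq[where s = "\<lambda>x y. 2 * kd.r (\<phi> p) x y" and B = "ricci K p" and Z = Z and a = a and p = p and \<alpha> = \<alpha> and \<beta> = \<beta>]
    ricci_eq[of p] kd.r_clin[OF in_S, of p] kd.r_alin[OF in_S, of p]
  by (simp add: clin_def alin_def distrib_left mult.left_commute)

text \<open>The last two slots contribute the factor 2 of \<open>cext2_ZZ\<close>. Each of the first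
  two doubles the term with \<open>x\<close> in the linear slot and kills the one with
  \<open>x\<close> and \<open>y\<close> exchanged; the sign comes from
  \<open>riem_eq\<close>.\<close>

lemma cext4_riem:
  assumes p: "p \<in> fst c"
  shows "cext4 (riem K p) (ZZ p x) (cconj (ZZ p y)) (ZZ p a) (cconj (ZZ p u)) = - 8 * kd.k (\<phi> p) x y a u"
proof -
  note z = in_S[OF p]
  let ?k = "kd.k (\<phi> p)"
  have "cext2 (riem K p (e x p) (e y p)) (ZZ p a) (cconj (ZZ p u)) = 2 * (?k y x a u - ?k x y a u)" for x y
    by (rule cext2_ZZ[where s = "\<lambda>a u. ?k y x a u - ?k x y a u", OF riem_eq[OF p]])
      (use k_lin[OF z] in \<open>auto simp: clin_def alin_def algebra_simps\<close>)
  note * = this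
  have s: "?k (- \<i> *s x) y a u = - \<i> * ?k x y a u" "?k x (- \<i> *s y) a u = \<i> * ?k x y a u"
     "?k (\<i> *s x) y a u = \<i> * ?k x y a u" "?k x (\<i> *s y) a u = - \<i> * ?k x y a u" for x y
    using clin_scale[OF k_lin(1)[OF z], of "- \<i>"] alin_scale[OF k_lin(2)[OF z], of _ "- \<i>"]
      clin_scale[OF k_lin(1)[OF z], of "\<i>"] alin_scale[OF k_lin(2)[OF z], of _ "\<i>"] by auto
  show ?thesis
    unfolding cext4_def cconj_ZZ[of p y] ZZ_def[of p x] unfolding cext_def[of _ "(_, _)"] fst_conv snd_conv * s
    by (simp add: algebra_simps)
qed

lemma standard_basis: assumes p: "p \<in> fst c" shows "complex_basis K p (\<lambda>\<alpha>. ZZ p (ax \<alpha>))"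
  unfolding complex_basis_def
proof (intro conjI allI ballI)
  show "ZZ p (ax \<alpha>) \<in> T10 K p" for \<alpha> using T10_iff[OF p] by blast
  fix W assume "W \<in> T10 K p"
  then obtain x where x: "W = ZZ p x" using T10_iff[OF p] by blast
  have s: "(\<Sum>\<alpha>\<in>UNIV. cscale (k \<alpha>) (ZZ p (ax \<alpha>))) = ZZ p (\<chi> \<alpha>. k \<alpha>)" for k
    using axis_expand[of "\<chi> \<alpha>. k \<alpha>"] by (simp add: cscale_ZZ flip: ZZ_sum)
  show "\<exists>!k. W = (\<Sum>\<alpha>\<in>UNIV. cscale (k \<alpha>) (ZZ p (ax \<alpha>)))"
  proof
    show "W = (\<Sum>\<alpha>\<in>UNIV. cscale (x $ \<alpha>) (ZZ p (ax \<alpha>)))" unfolding s x by simp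
    fix k assume "W = (\<Sum>\<alpha>\<in>UNIV. cscale (k \<alpha>) (ZZ p (ax \<alpha>)))"
    then have "x = (\<chi> \<alpha>. k \<alpha>)" unfolding s x by (rule ZZ_inj[OF p])
    then show "k = ($) x" by (simp add: fun_eq_iff)
  qed
qed

end

section \<open>The Bochner condition in a chart\<close>

lemma clin_eqI: "clin F \<Longrightarrow> clin F' \<Longrightarrow> (\<And>b. F (ax b) = F' (ax b)) \<Longrightarrow> F x = F' x"
  using clin_expand[of F x] clin_expand[of F' x] by simp

lemma alin_eqI: "alin F \<Longrightarrow> alin F' \<Longrightarrow> (\<And>b. F (ax b) = F' (ax b)) \<Longrightarrow> F x = F' x"
  using alin_expand[of F x] alin_expand[of F' x] by simp

lemma clin_intros:
  "clin F \<Longrightarrow> clin F' \<Longrightarrow> clin (\<lambda>x. F x + F' x)" "clin F \<Longrightarrow> clin F' \<Longrightarrow> clin (\<lambda>x. F x - F' x)"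
  "clin F \<Longrightarrow> clin (\<lambda>x. a * F x)" "clin F \<Longrightarrow> clin (\<lambda>x. F x * a)" "clin F \<Longrightarrow> clin (\<lambda>x. - F x)"
  by (auto simp: clin_def algebra_simps)

lemma alin_intros:
  "alin F \<Longrightarrow> alin F' \<Longrightarrow> alin (\<lambda>x. F x + F' x)" "alin F \<Longrightarrow> alin F' \<Longrightarrow> alin (\<lambda>x. F x - F' x)"
  "alin F \<Longrightarrow> alin (\<lambda>x. a * F x)" "alin F \<Longrightarrow> alin (\<lambda>x. F x * a)" "alin F \<Longrightarrow> alin (\<lambda>x. - F x)"
  by (auto simp: alin_def algebra_simps)

lemma bounded_linear_cRe: "bounded_linear (\<lambda>w. a * Re w)"
  by (rule bounded_linear_compose[OF bounded_linear_mult_right bounded_linear_Re])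

lemma dd_Re: "f differentiable (at x) \<Longrightarrow> dd (\<lambda>z. a * Re (f z)) x v = a * Re (dd f x v)"
  by (rule dd_linear_image[OF bounded_linear_cRe])

context kaehler_chart
begin

lemma smooth_fun_eqI:
  assumes V: "openin (space_of K) V" "V \<subseteq> fst c" and F: "smooth_on (\<phi> ` V) F" and eq: "\<And>p. p \<in> V \<Longrightarrow> f p = F (\<phi> p)"
  shows "smooth_fun K V f"
  by (rule smooth_fun_cong[OF V(1) _ smooth_fun_chart[OF c V F]]) (simp add: eq)

lemma dfun_chart:
  assumes V: "openin (space_of K) V" "V \<subseteq> fst c" and F: "smooth_on (\<phi> ` V) F" and eq: "\<And>p. p \<in> V \<Longrightarrow> f p = F (\<phi> p)"
    and p: "p \<in> V" and v: "v \<in> tangent_space K p"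
  shows "dfun K f p v = dd F (\<phi> p) (v c)"
proof -
  have pc: "p \<in> fst c" using V p by blast
  have "dfun K f p v = dd (\<lambda>z. f (\<psi> z)) (\<phi> p) (v c)"
    by (rule dfun_eq[OF smooth_fun_nearI[OF V(1) p smooth_fun_eqI[OF V F eq]] c pc v])
  also have "\<dots> = dd F (\<phi> p) (v c)"
    by (rule dd_cong[OF open_chart_image[OF c V]]) (use p V(2) in \<open>auto simp: eq psi_phi subset_iff\<close>)
  finally show ?thesis .
qed

text \<open>The derivative of the chosen extension of \<open>w\<close> enters both terms of the
  Hessian and cancels, so the choice does not matter.\<close>

lemma hessian_chart:
  assumes F: "smooth_on S F" and eq: "\<And>p. p \<in> fst c \<Longrightarrow> f p = F (\<phi> p)" and p: "p \<in> fst c"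
  shows "hessian K f p (e v p) (e w p) = dd (\<lambda>z. dd F z w) (\<phi> p) v - dd F (\<phi> p) (G (\<phi> p) v w)"
proof -
  define W where "W = extend K p (e w p)"
  define z where "z = \<phi> p"
  note P = pts[OF p]
  have W: "smooth_field_near K p W" "W p = e w p"
    using extend_props[OF P e_tan[OF p]] by (auto simp: W_def)
  define W' where "W' z = W (\<psi> z) c" for z
  obtain V where V: "openin (space_of K) V" "p \<in> V" "V \<subseteq> fst c" "smooth_field K V W" "smooth_on (\<phi> ` V) W'"
    using smooth_field_nearE[OF W(1) c p] unfolding W'_def by metis
  have VS: "\<phi> ` V \<subseteq> S" using V by (auto simp: S_def)
  have o: "open (\<phi> ` V)" by (rule open_chart_image[OF c V(1,3)])
  have z: "z \<in> \<phi> ` V" "z \<in> S" using V p in_S by (auto simp: z_def)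
  have W'z: "W' z = w" using W(2) p by (simp add: W'_def z_def e_c psi_phi)
  have lin: "linear (dd F z)" if "z \<in> \<phi> ` V" for z
    using linear_frechet_derivative[OF smooth_on_differentiable[OF F]] VS that by blast
  have sF: "smooth_on (\<phi> ` V) (\<lambda>z. dd F z w)" for w
    by (rule smooth_on_subset[OF smooth_on_dd[OF F] VS])
  have df: "dfun K f q u = dd F (\<phi> q) (u c)" if "q \<in> fst c" "u \<in> tangent_space K q" for q u
    by (rule dfun_chart[where V = "fst c"]) (use F eq that openin_chart[OF c] in \<open>auto simp: S_def\<close>)
  have "dfun K (\<lambda>q. dfun K f q (W q)) p (e v p) = dd (\<lambda>z. dd F z (W' z)) (\<phi> p) (e v p c)"
  proof (rule dfun_chart[OF V(1,3) _ _ V(2) e_tan[OF p]])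
    show "smooth_on (\<phi> ` V) (\<lambda>z. dd F z (W' z))"
      by (rule smooth_on_linear_family[OF o, where F = "\<lambda>z. dd F z", OF lin sF V(5)])
    fix q assume q: "q \<in> V"
    then have "q \<in> fst c" "W q \<in> tangent_space K q" using V by (auto simp: smooth_field_def)
    then show "dfun K f q (W q) = dd F (\<phi> q) (W' (\<phi> q))"
      by (simp add: df W'_def psi_phi)
  qed
  also have "\<dots> = dd (\<lambda>z. dd F z w) z v + dd F z (dd W' z v)"
    unfolding z_def[symmetric] e_c[OF p]
  proof (rule dd_eqI)
    show "((\<lambda>z. dd F z (W' z)) has_derivative (\<lambda>v. dd (\<lambda>z. dd F z w) z v + dd F z (dd W' z v))) (at z)"
      unfolding W'z[symmetric]
      by (rule has_derivative_linear_family[OF o z(1), where F = "\<lambda>z. dd F z", OF lin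
          smooth_on_differentiable[OF sF z(1)] smooth_on_differentiable[OF V(5) z(1)]])
  qed
  finally have 1: "dfun K (\<lambda>q. dfun K f q (W q)) p (e v p) = dd (\<lambda>z. dd F z w) z v + dd F z (dd W' z v)" .
  have "conn K p (e v p) W c = dd W' z v + G z v w"
    using conn_eq[OF p e_tan[OF p] W(1), of v] W(2) by (simp add: e_c[OF p] z_def W'_def [abs_def])
  then have "dfun K f p (conn K p (e v p) W) = dd F z (dd W' z v) + dd F z (G z v w)"
    using df[OF p conn_tangent[OF P e_tan[OF p] W(1)]] linear_add[OF lin[OF z(1)]] by (simp add: z_def)
  then show ?thesis
    unfolding hessian_def Let_def W_def[symmetric] 1 by (simp add: z_def)
qed

end

locale bochner_chart = kaehler_chart K c for K :: "('a, 'n::finite) geometry" and c +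
  assumes bk: "bochner_kaehler K" and dim2: "CARD('n) \<ge> 2"
begin

lemma bochner_axis:
  assumes z: "z \<in> S"
  shows "- kd.k z (ax \<alpha>) (ax \<beta>) (ax \<gamma>) (ax \<delta>) =
      1 / (of_nat CARD('n) + 2) * (h z (ax \<alpha>) (ax \<beta>) * kd.r z (ax \<gamma>) (ax \<delta>) + h z (ax \<gamma>) (ax \<beta>) * kd.r z (ax \<alpha>) (ax \<delta>)
        + h z (ax \<gamma>) (ax \<delta>) * kd.r z (ax \<alpha>) (ax \<beta>) + h z (ax \<alpha>) (ax \<delta>) * kd.r z (ax \<gamma>) (ax \<beta>))
      - kd.t z / ((of_nat CARD('n) + 1) * (of_nat CARD('n) + 2))
        * (h z (ax \<alpha>) (ax \<beta>) * h z (ax \<gamma>) (ax \<delta>) + h z (ax \<gamma>) (ax \<beta>) * h z (ax \<alpha>) (ax \<delta>))"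
proof -
  define p where "p = \<psi> z"
  have p: "p \<in> fst c" "\<phi> p = z" using psi_in[OF z] phi_psi[OF z] by (auto simp: p_def)
  define Z where "Z = (\<lambda>\<alpha>. ZZ p (ax \<alpha>))"
  have Z: "Z \<alpha> = ZZ p (ax \<alpha>)" for \<alpha> by (simp add: Z_def)
  have "complex_basis K p Z" unfolding Z_def by (rule standard_basis[OF p(1)])
  then have "cext4 (riem K p) (Z \<alpha>) (cconj (Z \<beta>)) (Z \<gamma>) (cconj (Z \<delta>)) =
     1 / (of_nat CARD('n) + 2) * (mixed (metric K p) Z $ \<alpha> $ \<beta> * mixed (ricci K p) Z $ \<gamma> $ \<delta>
       + mixed (metric K p) Z $ \<gamma> $ \<beta> * mixed (ricci K p) Z $ \<alpha> $ \<delta>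
       + mixed (metric K p) Z $ \<gamma> $ \<delta> * mixed (ricci K p) Z $ \<alpha> $ \<beta>
       + mixed (metric K p) Z $ \<alpha> $ \<delta> * mixed (ricci K p) Z $ \<gamma> $ \<beta>)
     - complex_of_real (scal K p) / (2 * (of_nat CARD('n) + 1) * (of_nat CARD('n) + 2))
       * (mixed (metric K p) Z $ \<alpha> $ \<beta> * mixed (metric K p) Z $ \<gamma> $ \<delta>
        + mixed (metric K p) Z $ \<gamma> $ \<beta> * mixed (metric K p) Z $ \<alpha> $ \<delta>)"
    using bk pts[OF p(1)] unfolding bochner_kaehler_def Let_def by blast
  then have main: "- 8 * kd.k z (ax \<alpha>) (ax \<beta>) (ax \<gamma>) (ax \<delta>) =
      1 / (of_nat CARD('n) + 2) * (2 * h z (ax \<alpha>) (ax \<beta>) * (4 * kd.r z (ax \<gamma>) (ax \<delta>)) + 2 * h z (ax \<gamma>) (ax \<beta>) * (4 * kd.r z (ax \<alpha>) (ax \<delta>))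
        + 2 * h z (ax \<gamma>) (ax \<delta>) * (4 * kd.r z (ax \<alpha>) (ax \<beta>)) + 2 * h z (ax \<alpha>) (ax \<delta>) * (4 * kd.r z (ax \<gamma>) (ax \<beta>)))
      - 4 * kd.t z / (2 * (of_nat CARD('n) + 1) * (of_nat CARD('n) + 2))
        * (2 * h z (ax \<alpha>) (ax \<beta>) * (2 * h z (ax \<gamma>) (ax \<delta>)) + 2 * h z (ax \<gamma>) (ax \<beta>) * (2 * h z (ax \<alpha>) (ax \<delta>)))"
    unfolding mixed_metric[OF p(1) Z] mixed_ricci[OF p(1) Z] scal_eq[OF p(1)] unfolding Z cext4_riem[OF p(1)] p(2) .
  \<comment> \<open>A common factor 8 is removed: -8 on the left, 2 * 4 in the Ricci terms and 4 * 2
    * 2 / 2 in the scalar term.\<close>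
  have cancel: "- k = 1 / n * (a * a' + b * b' + d * d' + f * f') - t / (m * n) * (x * x' + y * y')"
    if "- 8 * k = 1 / n * (2 * a * (4 * a') + 2 * b * (4 * b') + 2 * d * (4 * d') + 2 * f * (4 * f'))
      - 4 * t / (2 * m * n) * (2 * x * (2 * x') + 2 * y * (2 * y'))" for k n a a' b b' d d' f f' t m x x' y y' :: complex
  proof -
    have "8 * (- k) = 8 * (1 / n * (a * a' + b * b' + d * d' + f * f') - t / (m * n) * (x * x' + y * y'))"
      using that by (simp add: algebra_simps)
    then show ?thesis by (simp only: mult_cancel_left) simp
  qed
  show ?thesis by (rule cancel[OF main])
qed

text \<open>Both sides are complex linear in \<open>x\<close> and \<open>a\<close> and antilinear in
  \<open>y\<close> and \<open>u\<close>, so basis vectors are replaced by arbitrary ones slot by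
  slot, from the last to the first.\<close>

lemma bochner_all:
  assumes z: "z \<in> S"
  shows "- kd.k z x y a u =
      1 / (of_nat CARD('n) + 2) * (h z x y * kd.r z a u + h z a y * kd.r z x u + h z a u * kd.r z x y + h z x u * kd.r z a y)
      - kd.t z / ((of_nat CARD('n) + 1) * (of_nat CARD('n) + 2)) * (h z x y * h z a u + h z a y * h z x u)"
    (is "?l x y a u = ?r x y a u")
proof -
  note li = k_lin[OF z] h_clin'[OF z] kd.h_alin[OF z] kd.r_clin[OF z] kd.r_alin[OF z]
  have 1: "?l (ax \<alpha>) (ax \<beta>) (ax \<gamma>) u = ?r (ax \<alpha>) (ax \<beta>) (ax \<gamma>) u" for \<alpha> \<beta> \<gamma>
    by (rule alin_eqI[where x = u]) (intro alin_intros li bochner_axis[OF z])+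
  have 2: "?l (ax \<alpha>) (ax \<beta>) a u = ?r (ax \<alpha>) (ax \<beta>) a u" for \<alpha> \<beta>
    by (rule clin_eqI[where x = a]) (intro clin_intros li 1)+
  have 3: "?l (ax \<alpha>) y a u = ?r (ax \<alpha>) y a u" for \<alpha>
    by (rule alin_eqI[where x = y]) (intro alin_intros li 2)+
  show ?thesis
    by (rule clin_eqI[where x = x]) (intro clin_intros li 3)+
qed

end

sublocale bochner_chart \<subseteq> bd: bochner_domain S h G "of_nat CARD('n)"
  by unfold_locales (use bochner_all dim2 in auto)

section \<open>Scalar curvature: Hessian, Laplacian and the factor in (ii)\<close>

context bochner_chart
begin

definition sc :: "complex^'n \<Rightarrow> real" where "sc z = 4 * Re (kd.t z)"

lemma sc_smooth: "smooth_on S sc"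
  unfolding sc_def [abs_def] by (rule smooth_on_linear[OF bounded_linear_cRe S_open kd.t_sm])

lemma scal_sc: "p \<in> fst c \<Longrightarrow> scal K p = sc (\<phi> p)"
  using scal_eq[of p] by (simp add: sc_def complex_eq_iff)

lemma dd_sc: assumes z: "z \<in> S" shows "dd sc z v = 4 * Re (bd.T1 z v + bd.T1b z v)"
  unfolding sc_def [abs_def] dd_Re[OF kd.sm_diff[OF kd.t_sm z]]
  by (simp add: dd_split bd.T1_def bd.T1b_def)

lemma dfun_scal: "p \<in> fst c \<Longrightarrow> v \<in> tangent_space K p \<Longrightarrow> dfun K (scal K) p v = dd sc (\<phi> p) (v c)"
  by (rule dfun_chart[where F = sc and V = "fst c"]) (use sc_smooth openin_chart[OF c] scal_sc in \<open>auto simp: S_def\<close>)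

text \<open>The (2,0)-part and its conjugate are exactly the connection term, by
  \<open>P_zero\<close>. The mixed part occurs together with its conjugate, which turns the 4 of 4
  \<open>t\<close> into 8.\<close>

lemma hessian_scal:
  assumes p: "p \<in> fst c"
  shows "hessian K (scal K) p (e v p) (e w p) = Re (8 * bd.L (\<phi> p) v w)"
proof -
  define z where "z = \<phi> p"
  have z: "z \<in> S" using in_S[OF p] by (simp add: z_def)
  have sm: "kd.sm (\<lambda>z. bd.T1 z w + bd.T1b z w)" by (intro kd.sm_intros bd.T1_sm bd.T1b_sm)
  have "dd (\<lambda>z. dd sc z w) z v = dd (\<lambda>z. 4 * Re (bd.T1 z w + bd.T1b z w)) z v"
    by (rule dd_cong[OF S_open z]) (rule dd_sc)
  also have "\<dots> = 4 * Re (dd (\<lambda>z. bd.T1 z w + bd.T1b z w) z v)"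
    by (rule dd_Re[OF kd.sm_diff[OF sm z]])
  also have "dd (\<lambda>z. bd.T1 z w + bd.T1b z w) z v =
      (del v (\<lambda>z. bd.T1 z w) z + del v (\<lambda>z. bd.T1b z w) z) + (delb v (\<lambda>z. bd.T1 z w) z + delb v (\<lambda>z. bd.T1b z w) z)"
    unfolding dd_split pd_add[OF kd.sm_diff[OF bd.T1_sm z] kd.sm_diff[OF bd.T1b_sm z]] by simp
  also have "del v (\<lambda>z. bd.T1 z w) z = bd.T1 z (G z v w)"
    using bd.P_zero[OF z, of v w] by (simp add: bd.P_def)
  also have "del v (\<lambda>z. bd.T1b z w) z = bd.L z v w" by (simp add: bd.L_def)
  also have "delb v (\<lambda>z. bd.T1 z w) z = cnj (bd.L z v w)"
    using bd.L_alt[OF z, of v w] bd.L_herm[OF z, of w v] by simp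
  also have "delb v (\<lambda>z. bd.T1b z w) z = bd.T1b z (G z v w)"
  proof -
    have "delb v (\<lambda>z. bd.T1b z w) z = delb v (\<lambda>z. cnj (bd.T1 z w)) z"
      by (rule pd_cong[OF S_open z]) (rule bd.T1b_cnj)
    then show ?thesis
      using pd_cnj[OF kd.sm_diff[OF bd.T1_sm z], of \<i> v w] bd.P_zero[OF z, of v w]
      by (simp add: bd.P_def bd.T1b_cnj[OF z])
  qed
  finally have 1: "dd (\<lambda>z. dd sc z w) z v = 4 * Re (bd.T1 z (G z v w) + bd.L z v w + (cnj (bd.L z v w) + bd.T1b z (G z v w)))" .
  have "hessian K (scal K) p (e v p) (e w p) = dd (\<lambda>z. dd sc z w) z v - dd sc z (G z v w)"
    unfolding z_def by (rule hessian_chart[OF sc_smooth scal_sc p])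
  then show ?thesis unfolding 1 dd_sc[OF z] z_def[symmetric] by simp
qed

lemma laplacian_scal:
  assumes p: "p \<in> fst c"
  shows "laplacian K (scal K) p = Re (16 * (\<Sum>b\<in>UNIV. bd.L (\<phi> p) (ax b) (kd.eps (\<phi> p) b)))"
    and "(\<Sum>i<2 * CARD('n). bd.L (\<phi> p) (E p i) (E p i)) = 2 * (\<Sum>b\<in>UNIV. bd.L (\<phi> p) (ax b) (kd.eps (\<phi> p) b))"
proof -
  note z = in_S[OF p] and o = frame_props(2)[OF p]
  show 1: "(\<Sum>i<2 * CARD('n). bd.L (\<phi> p) (E p i) (E p i)) = 2 * (\<Sum>b\<in>UNIV. bd.L (\<phi> p) (ax b) (kd.eps (\<phi> p) b))"
    by (rule trace_orthonormal(1)[OF z o]) (use bd.L_clin[OF z] bd.L_alin[OF z] in auto)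
  have "laplacian K (scal K) p = (\<Sum>i<2 * CARD('n). hessian K (scal K) p (e (E p i) p) (e (E p i) p))"
    unfolding laplacian_def by (rule sum_frame[OF p])
  also have "\<dots> = Re (8 * (\<Sum>i<2 * CARD('n). bd.L (\<phi> p) (E p i) (E p i)))"
    by (simp add: hessian_scal[OF p] sum_distrib_left)
  finally show "laplacian K (scal K) p = Re (16 * (\<Sum>b\<in>UNIV. bd.L (\<phi> p) (ax b) (kd.eps (\<phi> p) b)))"
    unfolding 1 by simp
qed

text \<open>A row of the Ricci matrix lists the components of 2 \<open>Q\<close> applied to a frame
  vector, so Parseval turns its sum of squares into a squared length, which is 4 Re
  \<open>q\<close>.\<close>

lemma ricci_norm2_eq:
  assumes p: "p \<in> fst c"
  shows "ricci_norm2 K p = Re (4 * (\<Sum>i<2 * CARD('n). bd.q (\<phi> p) (E p i) (E p i)))"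
proof -
  let ?z = "\<phi> p"
  note z = in_S[OF p] and o = frame_props(2)[OF p]
  have "ricci_norm2 K p = (\<Sum>i<2 * CARD('n). \<Sum>j<2 * CARD('n). (ricci K p (e (E p i) p) (frame K p j))\<^sup>2)"
    unfolding ricci_norm2_def by (rule sum_frame[OF p])
  also have "\<dots> = (\<Sum>i<2 * CARD('n). \<Sum>j<2 * CARD('n). (ricci K p (e (E p i) p) (e (E p j) p))\<^sup>2)"
    by (intro sum.cong refl sum_frame[OF p])
  also have "\<dots> = (\<Sum>i<2 * CARD('n). 4 * Re (bd.q ?z (E p i) (E p i)))"
  proof (rule sum.cong[OF refl])
    fix i
    define x where "x = kd.Q ?z (E p i)"
    have r: "ricci K p (e (E p i) p) (e (E p j) p) = 2 * g ?z x (E p j)" for j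
      unfolding ricci_eq[OF p] by (simp add: x_def Re_h flip: kd.h_Q[OF z])
    have "(\<Sum>j<2 * CARD('n). (ricci K p (e (E p i) p) (e (E p j) p))\<^sup>2)
       = 4 * (\<Sum>j<2 * CARD('n). g ?z x (E p j) * g ?z (E p j) x)"
      unfolding r using g_sym[OF z, of x] by (simp add: sum_distrib_left power2_eq_square)
    also have "(\<Sum>j<2 * CARD('n). g ?z x (E p j) * g ?z (E p j) x) = g ?z (\<Sum>j<2 * CARD('n). g ?z x (E p j) *\<^sub>R E p j) x"
      by (simp add: g_sum[OF z] g_scale[OF z])
    also have "\<dots> = g ?z x x" by (simp only: orthonormal_expand[OF z o])
    also have "g ?z x x = Re (bd.q ?z (E p i) (E p i))"
    proof -
      have "bd.q ?z (E p i) (E p i) = cnj (h ?z x x)"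
        unfolding bd.q_def x_def[symmetric] using kd.r_herm[OF z, of "E p i" x] kd.h_Q[OF z, of "E p i" x]
        by (simp add: x_def)
      then show ?thesis by (simp add: Re_h)
    qed
    finally show "(\<Sum>j<2 * CARD('n). (ricci K p (e (E p i) p) (e (E p j) p))\<^sup>2) = 4 * Re (bd.q ?z (E p i) (E p i))" .
  qed
  finally show ?thesis by (simp add: sum_distrib_left)
qed

text \<open>The factor \<open>k\<close> in \<open>M_eq\<close> is recovered from the frame trace 2 n
  k. The Laplacian and the norm determine only real parts, so \<open>M\<close> has to be seen to be
  real on the diagonal.\<close>

lemma M_constant:
  assumes p: "p \<in> fst c"
  shows "16 * bd.M (\<phi> p) x y = complex_of_real (((real CARD('n) + 2) * laplacian K (scal K) p
             + 2 * (real CARD('n) + 1) * ricci_norm2 K p - (scal K p)\<^sup>2) / (2 * real CARD('n))) * (2 * h (\<phi> p) x y)"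
proof -
  let ?z = "\<phi> p" and ?N = "of_nat CARD('n) :: complex"
  note z = in_S[OF p] and o = frame_props(2)[OF p]
  obtain k where k: "\<And>x y. bd.M ?z x y = k * h ?z x y" using bd.M_eq[OF z] by blast
  have hE: "h ?z (E p i) (E p i) = 1" if "i < 2 * CARD('n)" for i
  proof -
    have "h ?z (E p i) (E p i) = complex_of_real (Re (h ?z (E p i) (E p i)))"
      using h_herm'[OF z, of "E p i" "E p i"] by (simp add: complex_eq_iff)
    then show ?thesis using o that by (simp add: Re_h orthonormal_def)
  qed
  have s1: "(\<Sum>i<2 * CARD('n). bd.M ?z (E p i) (E p i)) = 2 * ?N * k"
    by (simp add: k hE)
  have "bd.M ?z x x \<in> \<real>" for x
  proof -
    have "bd.L ?z x x \<in> \<real>" "bd.q ?z x x \<in> \<real>" "kd.r ?z x x \<in> \<real>" "kd.t ?z \<in> \<real>"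
      using bd.L_herm[OF z, of x x] bd.q_herm[OF z, of x x] kd.r_herm[OF z, of x x] kd.t_real[OF z]
      by (auto simp: Reals_cnj_iff)
    then show ?thesis by (simp add: bd.M_def Reals_mult Reals_add Reals_diff)
  qed
  then have "(\<Sum>i<2 * CARD('n). bd.M ?z (E p i) (E p i)) \<in> \<real>" by (intro sum_in_Reals)
  then have kr: "2 * ?N * k = complex_of_real (Re (\<Sum>i<2 * CARD('n). bd.M ?z (E p i) (E p i)))"
    unfolding s1[symmetric] by (rule of_real_Re[symmetric])
  have tr: "Re (\<Sum>i<2 * CARD('n). bd.M ?z (E p i) (E p i)) = (real CARD('n) + 2) * laplacian K (scal K) p / 8
      + (real CARD('n) + 1) * ricci_norm2 K p / 4 - (scal K p)\<^sup>2 / 8"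
  proof -
    have t: "kd.t ?z = complex_of_real (scal K p / 4)" using scal_eq[OF p] by simp
    have r: "(\<Sum>i<2 * CARD('n). kd.r ?z (E p i) (E p i)) = complex_of_real (scal K p / 2)"
    proof -
      have "(\<Sum>i<2 * CARD('n). kd.r ?z (E p i) (E p i)) = 2 * kd.t ?z"
        unfolding kd.t_def by (rule trace_orthonormal(1)[OF z o]) (use kd.r_clin[OF z] kd.r_alin[OF z] in auto)
      then show ?thesis by (simp add: t)
    qed
    have "(\<Sum>i<2 * CARD('n). bd.M ?z (E p i) (E p i)) =
       (?N + 2) * (\<Sum>i<2 * CARD('n). bd.L ?z (E p i) (E p i)) + (?N + 1) * (\<Sum>i<2 * CARD('n). bd.q ?z (E p i) (E p i))
       - kd.t ?z * (\<Sum>i<2 * CARD('n). kd.r ?z (E p i) (E p i))"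
      by (simp add: bd.M_def sum.distrib sum_subtractf sum_distrib_left)
    moreover have "laplacian K (scal K) p = 8 * Re (\<Sum>i<2 * CARD('n). bd.L ?z (E p i) (E p i))"
      unfolding laplacian_scal[OF p] by (simp del: Re_sum)
    moreover have "ricci_norm2 K p = 4 * Re (\<Sum>i<2 * CARD('n). bd.q ?z (E p i) (E p i))"
      unfolding ricci_norm2_eq[OF p] by (simp del: Re_sum)
    ultimately show ?thesis unfolding r t by (simp add: power2_eq_square del: Re_sum)
  qed
  have n: "real CARD('n) > 0" by simp
  have "2 * ?N * (16 * bd.M ?z x y) = 16 * (2 * ?N * k) * h ?z x y" by (simp add: k)
  also have "\<dots> = complex_of_real ((real CARD('n) + 2) * laplacian K (scal K) p
             + 2 * (real CARD('n) + 1) * ricci_norm2 K p - (scal K p)\<^sup>2) * (2 * h ?z x y)"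
    unfolding kr tr by (simp add: field_simps)
  finally show ?thesis by (simp add: field_simps)
qed

text \<open>Existence of coefficients for every (1,0)-vector makes the \<open>a \<alpha>\<close>
  span; uniqueness for the zero vector makes them independent.\<close>

lemma complex_basis_ZZ:
  assumes p: "p \<in> fst c" and Z: "complex_basis K p Z"
  obtains a where "\<And>\<alpha>. Z \<alpha> = ZZ p (a \<alpha>)" "\<And>x. \<exists>k. x = (\<Sum>\<alpha>\<in>UNIV. k \<alpha> *s a \<alpha>)"
    "\<And>k. (\<Sum>\<alpha>\<in>UNIV. k \<alpha> *s a \<alpha>) = 0 \<Longrightarrow> k = (\<lambda>\<alpha>. 0)"
proof -
  have "\<forall>\<alpha>. \<exists>x. Z \<alpha> = ZZ p x" using Z T10_iff[OF p] by (auto simp: complex_basis_def)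
  then obtain a where a: "\<And>\<alpha>. Z \<alpha> = ZZ p (a \<alpha>)" by metis
  have s: "(\<Sum>\<alpha>\<in>UNIV. cscale (k \<alpha>) (Z \<alpha>)) = ZZ p (\<Sum>\<alpha>\<in>UNIV. k \<alpha> *s a \<alpha>)" for k
    by (simp add: a cscale_ZZ ZZ_sum)
  have u: "\<exists>!k. ZZ p x = ZZ p (\<Sum>\<alpha>\<in>UNIV. k \<alpha> *s a \<alpha>)" for x
  proof -
    have "ZZ p x \<in> T10 K p" using T10_iff[OF p] by blast
    then show ?thesis using Z s by (simp add: complex_basis_def)
  qed
  show thesis
  proof (rule that[OF a])
    show "\<exists>k. x = (\<Sum>\<alpha>\<in>UNIV. k \<alpha> *s a \<alpha>)" for x
      using u[of x] ZZ_inj[OF p] by blast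
    obtain k0 where k0: "\<And>k. ZZ p 0 = ZZ p (\<Sum>\<alpha>\<in>UNIV. k \<alpha> *s a \<alpha>) \<Longrightarrow> k = k0"
      using u[of 0] by (elim ex1E) (rule that, drule spec, erule mp, assumption)
    fix k assume "(\<Sum>\<alpha>\<in>UNIV. k \<alpha> *s a \<alpha>) = 0"
    then have z1: "ZZ p 0 = ZZ p (\<Sum>\<alpha>\<in>UNIV. k \<alpha> *s a \<alpha>)" by simp
    have z2: "ZZ p 0 = ZZ p (\<Sum>\<alpha>\<in>UNIV. (\<lambda>\<alpha>. 0) \<alpha> *s a \<alpha>)" by simp
    show "k = (\<lambda>\<alpha>. 0)" using k0[OF z1] k0[OF z2] by simp
  qed
qed

text \<open>A kernel vector of the transpose yields a combination of the \<open>a \<alpha>\<close>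
  orthogonal to a spanning family, hence zero. The transpose occurs because the first slot of
  \<open>h\<close> is the linear one.\<close>

lemma invertible_gram:
  assumes z: "z \<in> S" and ind: "\<And>k. (\<Sum>\<alpha>\<in>UNIV. k \<alpha> *s a \<alpha>) = 0 \<Longrightarrow> k = (\<lambda>\<alpha>. 0)"
    and span: "\<And>x. \<exists>k. x = (\<Sum>\<alpha>\<in>UNIV. k \<alpha> *s a \<alpha>)"
    and M: "\<And>\<alpha> \<beta>. (M :: complex^'n^'n) $ \<alpha> $ \<beta> = 2 * h z (a \<alpha>) (a \<beta>)"
  shows "invertible M"
proof -
  have "w = 0" if w: "transpose M *v w = 0" for w
  proof -
    let ?x = "\<Sum>\<alpha>\<in>UNIV. w $ \<alpha> *s a \<alpha>"
    have "h z ?x (a \<beta>) = 0" for \<beta>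
    proof -
      have "2 * h z ?x (a \<beta>) = (transpose M *v w) $ \<beta>"
        by (simp add: clin_sum[OF h_clin'[OF z]] clin_scale[OF h_clin'[OF z]] matrix_vector_mult_def
          transpose_def M sum_distrib_left mult.commute mult.left_commute)
      then show ?thesis using w by simp
    qed
    then have "h z ?x y = 0" for y
      using span[of y] by (auto simp: alin_sum[OF kd.h_alin[OF z]] alin_scale[OF kd.h_alin[OF z]])
    then have "?x = 0" using kd.h_pos[OF z, of ?x] by force
    from ind[OF this] show ?thesis by (simp add: vec_eq_iff fun_eq_iff)
  qed
  then have "invertible (transpose M)"
    using matrix_left_invertible_ker[of "transpose M"] invertible_left_inverse[of "transpose M"] by blast
  then show ?thesis by (simp add: invertible_det_nz)
qed

lemma ricci_square_eq:
  assumes p: "p \<in> fst c" and a: "\<And>\<alpha>. Z \<alpha> = ZZ p (a \<alpha>)" and span: "\<And>x. \<exists>k. x = (\<Sum>\<alpha>\<in>UNIV. k \<alpha> *s a \<alpha>)"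
    and ind: "\<And>k. (\<Sum>\<alpha>\<in>UNIV. k \<alpha> *s a \<alpha>) = 0 \<Longrightarrow> k = (\<lambda>\<alpha>. 0)"
  shows "ricci_square K p Z \<alpha> \<beta> = 8 * bd.q (\<phi> p) (a \<alpha>) (a \<beta>)"
proof -
  let ?z = "\<phi> p"
  note z = in_S[OF p]
  define M where "M = mixed (metric K p) Z"
  define R where "R = mixed (ricci K p) Z"
  have M: "M $ \<alpha> $ \<beta> = 2 * h ?z (a \<alpha>) (a \<beta>)" for \<alpha> \<beta> using mixed_metric[OF p a] by (simp add: M_def)
  have R: "R $ \<alpha> $ \<beta> = 4 * kd.r ?z (a \<alpha>) (a \<beta>)" for \<alpha> \<beta> using mixed_ricci[OF p a] by (simp add: R_def)
  have inv: "M ** matrix_inv M = mat 1"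
    using someI_ex[OF invertible_gram[OF z ind span M, unfolded invertible_def]]
    by (simp add: matrix_inv_def)
  have "\<forall>\<alpha>. \<exists>k. kd.Q ?z (a \<alpha>) = (\<Sum>\<mu>\<in>UNIV. k \<mu> *s a \<mu>)" using span by blast
  then obtain m where m: "\<And>\<alpha>. kd.Q ?z (a \<alpha>) = (\<Sum>\<mu>\<in>UNIV. m \<alpha> \<mu> *s a \<mu>)" by metis
  \<comment> \<open>The factor 2 is the quotient of the normalisations 4 \<open>r\<close> and 2
    \<open>h\<close>; with it, \<open>m'\<close> is the matrix of the raised Ricci tensor in the
    given basis.\<close>
  define m' :: "complex^'n^'n" where "m' = (\<chi> \<alpha> \<mu>. 2 * m \<alpha> \<mu>)"
  have "R = m' ** M"
  proof -
    have "R $ \<alpha> $ \<delta> = (m' ** M) $ \<alpha> $ \<delta>" for \<alpha> \<delta>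
      unfolding R kd.h_Q[OF z, symmetric] m
      by (simp add: clin_sum[OF h_clin'[OF z]] clin_scale[OF h_clin'[OF z]] matrix_matrix_mult_def M m'_def
        sum_distrib_left mult.left_commute)
    then show ?thesis by (simp add: vec_eq_iff)
  qed
  then have "R ** matrix_inv M = m'" using inv by (simp add: matrix_mul_assoc[symmetric])
  then have "ricci_raised K p Z \<alpha> \<epsilon> = 2 * m \<alpha> \<epsilon>" for \<epsilon>
    unfolding ricci_raised_def M_def[symmetric] R_def[symmetric]
    by (simp add: vec_eq_iff matrix_matrix_mult_def m'_def)
  then have "ricci_square K p Z \<alpha> \<beta> = 8 * (\<Sum>\<epsilon>\<in>UNIV. m \<alpha> \<epsilon> * kd.r ?z (a \<epsilon>) (a \<beta>))"
    unfolding ricci_square_def R_def[symmetric] by (simp add: R sum_distrib_left)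
  also have "(\<Sum>\<epsilon>\<in>UNIV. m \<alpha> \<epsilon> * kd.r ?z (a \<epsilon>) (a \<beta>)) = bd.q ?z (a \<alpha>) (a \<beta>)"
    unfolding bd.q_def m by (simp add: clin_sum[OF kd.r_clin[OF z]] clin_scale[OF kd.r_clin[OF z]])
  finally show ?thesis .
qed

lemma mixed_hessian_identity:
  assumes p: "p \<in> fst c" and Z: "complex_basis K p Z"
  shows "(of_nat CARD('n) + 2) * mixed (hessian K (scal K) p) Z $ \<alpha> $ \<beta>
         + 2 * (of_nat CARD('n) + 1) * ricci_square K p Z \<alpha> \<beta>
         - complex_of_real (scal K p) * mixed (ricci K p) Z $ \<alpha> $ \<beta>
       = complex_of_real (((real CARD('n) + 2) * laplacian K (scal K) p
             + 2 * (real CARD('n) + 1) * ricci_norm2 K p - (scal K p)\<^sup>2) / (2 * real CARD('n)))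
         * mixed (metric K p) Z $ \<alpha> $ \<beta>"
proof -
  note z = in_S[OF p]
  obtain a where a: "\<And>\<alpha>. Z \<alpha> = ZZ p (a \<alpha>)" "\<And>x. \<exists>k. x = (\<Sum>\<alpha>\<in>UNIV. k \<alpha> *s a \<alpha>)"
    "\<And>k. (\<Sum>\<alpha>\<in>UNIV. k \<alpha> *s a \<alpha>) = 0 \<Longrightarrow> k = (\<lambda>\<alpha>. 0)"
    by (rule complex_basis_ZZ[OF p Z]) (rule that)
  have hs: "mixed (hessian K (scal K) p) Z $ \<alpha> $ \<beta> = 2 * (8 * bd.L (\<phi> p) (a \<alpha>) (a \<beta>))"
    by (rule mixed_eq[where s = "\<lambda>x y. 8 * bd.L (\<phi> p) x y", OF hessian_scal[OF p] _ _ a(1)])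
      (intro clin_intros alin_intros bd.L_clin bd.L_alin z)+
  have rs: "ricci_square K p Z \<alpha> \<beta> = 8 * bd.q (\<phi> p) (a \<alpha>) (a \<beta>)"
    by (rule ricci_square_eq[where Z = Z and a = a, OF p a])
  show ?thesis
    unfolding hs rs mixed_metric[OF p a(1)] mixed_ricci[OF p a(1)] scal_eq[OF p] M_constant[OF p, symmetric]
    by (simp add: bd.M_def algebra_simps)
qed

text \<open>\<open>T\<close> satisfies the defining identity by \<open>h_T\<close>; uniqueness,
  needed for the definite description, is nondegeneracy of the metric.\<close>

lemma grad_scal:
  assumes p: "p \<in> fst c"
  shows "grad K (scal K) p = e (bd.T (\<phi> p)) p"
proof -
  let ?z = "\<phi> p"
  note z = in_S[OF p]
  have T: "g ?z (bd.T ?z) v = dd sc ?z v" for v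
  proof -
    have "g ?z (bd.T ?z) v = Re (8 * bd.T1b ?z v)" using bd.h_T[OF z, of v] by (simp flip: Re_h)
    also have "\<dots> = dd sc ?z v" unfolding dd_sc[OF z] by (simp add: bd.T1b_cnj[OF z])
    finally show ?thesis .
  qed
  show ?thesis
    unfolding grad_def
  proof (rule the_equality)
    show "e (bd.T ?z) p \<in> tangent_space K p \<and> (\<forall>v\<in>tangent_space K p. metric K p (e (bd.T ?z) p) v = dfun K (scal K) p v)"
      using metric_eq[OF p e_tan[OF p]] dfun_scal[OF p] T by (simp add: e_tan[OF p] e_c[OF p])
    fix t assume t: "t \<in> tangent_space K p \<and> (\<forall>v\<in>tangent_space K p. metric K p t v = dfun K (scal K) p v)"
    have "g ?z (t c - bd.T ?z) v = 0" for v
    proof -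
      have "metric K p t (e v p) = dfun K (scal K) p (e v p)" using t e_tan[OF p] by blast
      then have "g ?z (t c) v = g ?z (bd.T ?z) v"
        using metric_eq[OF p _ e_tan[OF p], of t v] dfun_scal[OF p e_tan[OF p], of v] t T by (simp add: e_c[OF p])
      then show ?thesis by (simp add: g_diff[OF z])
    qed
    then have "t c = bd.T ?z" using g_pos[OF z, of "t c - bd.T ?z"] by force
    then show "t = e (bd.T ?z) p" using tan_e[OF p, of t] t by simp
  qed
qed

lemma T10_half:
  assumes p: "p \<in> fst c"
  shows "cscale (1 / 2) (complexify (e x p) - cscale \<i> (complexify (cstr (e x p)))) = ZZ p ((1/2) *\<^sub>R x)"
proof -
  have "complexify (e x p) - cscale \<i> (complexify (cstr (e x p))) = ZZ p x"
    by (simp add: complexify_def cscale_def ZZ_def e_J e_neg)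
  moreover have "(1 / 2) *s x = (1 / 2) *\<^sub>R x"
    by (simp add: scaleR_eq_vector_smult)
  ultimately show ?thesis by (simp add: cscale_ZZ)
qed

lemma dz_ZZ: "p \<in> fst c \<Longrightarrow> dz c (ZZ p x) = 2 *s x"
  by (simp add: dz_def cext_def ZZ_def e_c vec_eq_iff)

lemma T_holomorphic_map: "holomorphic_map_on S bd.T"
  unfolding holomorphic_map_on_def
proof (intro conjI ballI allI)
  show sm: "smooth_on S bd.T" by (rule smooth_on_vecI[OF S_open bd.T_sm])
  fix z v assume z: "z \<in> S"
  have "dd bd.T z (\<i> *s v) $ b = (\<i> *s dd bd.T z v) $ b" for b
  proof -
    have nth: "dd bd.T z w $ b = dd (\<lambda>z. bd.T z $ b) z w" for w
      using dd_linear_image[OF bounded_linear_vec_nth[of b] smooth_on_differentiable[OF sm z], of w] by simp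
    have "delb v (\<lambda>z. bd.T z $ b) z = 0" using bd.T_holomorphic[OF z, of v] by (simp add: pdv_def vec_eq_iff)
    then have "\<i> * (dd (\<lambda>z. bd.T z $ b) z v + \<i> * dd (\<lambda>z. bd.T z $ b) z (\<i> *s v)) = 0" by (simp add: pd_def)
    then show ?thesis by (simp add: nth distrib_left)
  qed
  then show "dd bd.T z (\<i> *s v) = \<i> *s dd bd.T z v" by (simp add: vec_eq_iff)
qed

lemma holomorphic_gradient:
  defines "W \<equiv> \<lambda>p. cscale (1 / 2) (complexify (grad K (scal K) p) - cscale \<i> (complexify (cstr (grad K (scal K) p))))"
  shows "p \<in> fst c \<Longrightarrow> W p \<in> T10 K p" "holomorphic_map_on (snd c ` fst c) (\<lambda>z. dz c (W (chart_inv c z)))"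
proof -
  have W: "W p = ZZ p ((1/2) *\<^sub>R bd.T (\<phi> p))" if "p \<in> fst c" for p
    unfolding W_def grad_scal[OF that] by (rule T10_half[OF that])
  then show "p \<in> fst c \<Longrightarrow> W p \<in> T10 K p" using T10_iff[of p] by auto
  \<comment> \<open>The 2 of \<open>dz_ZZ\<close> offsets the half in the field, so its holomorphic
    components are those of \<open>T\<close> itself.\<close>
  have eq: "bd.T z = dz c (W (\<psi> z))" if "z \<in> S" for z
    using W[OF psi_in[OF that]] phi_psi[OF that] psi_in[OF that]
    by (simp add: dz_ZZ scaleR_eq_vector_smult vector_smult_assoc)
  have "dd (\<lambda>z. dz c (W (\<psi> z))) z v = dd bd.T z v" if "z \<in> S" for z v
    by (rule dd_cong[OF S_open that]) (rule eq[symmetric])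
  then show "holomorphic_map_on (snd c ` fst c) (\<lambda>z. dz c (W (\<psi> z)))"
    using T_holomorphic_map smooth_on_cong[OF S_open eq] unfolding holomorphic_map_on_def S_def[symmetric] by simp
qed

text \<open>The Laplacian is real, so its differential is twice the real part of its
  \<open>delb\<close>-derivative, which \<open>delb_trace_L\<close> expresses by
  \<open>r\<close>.\<close>

lemma ricci_gradient:
  assumes p: "p \<in> fst c" and v: "v \<in> tangent_space K p"
  shows "2 * ricci K p v (grad K (scal K) p) = - dfun K (laplacian K (scal K)) p v"
proof -
  let ?z = "\<phi> p"
  note z = in_S[OF p]
  define \<Lambda> where "\<Lambda> z = 16 * (\<Sum>b\<in>UNIV. bd.L z (ax b) (kd.eps z b))" for z
  \<comment> \<open>Smoothness of the Laplacian is read off from the divergence formula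
    \<open>trace_L\<close>.\<close>
  have sm: "kd.sm \<Lambda>"
  proof -
    have "kd.sm (\<lambda>z. 2 * ((\<Sum>b\<in>UNIV. del (ax b) (\<lambda>z. bd.T z $ b) z) + kd.gam z (bd.T z)))"
      using kd.sm_clin[of kd.gam bd.T] kd.gam_clin kd.gam_sm bd.T_sm by (intro kd.sm_intros) auto
    then show ?thesis
      by (rule smooth_on_cong[OF S_open, rotated]) (simp add: \<Lambda>_def flip: bd.trace_L)
  qed
  have real: "cnj (\<Lambda> z) = \<Lambda> z" if "z \<in> S" for z
  proof -
    have "cnj (\<Lambda> z) = 16 * (\<Sum>b\<in>UNIV. bd.L z (kd.eps z b) (ax b))"
      by (simp add: \<Lambda>_def bd.L_herm[OF that, symmetric])
    then show ?thesis
      using kd.trace_swap[OF that, of "bd.L z"] bd.L_clin[OF that] bd.L_alin[OF that] by (simp add: \<Lambda>_def)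
  qed
  have "dfun K (laplacian K (scal K)) p v = dd (\<lambda>z. 1 * Re (\<Lambda> z)) ?z (v c)"
  proof (rule dfun_chart[OF openin_chart[OF c] order_refl _ _ p v])
    show "smooth_on (\<phi> ` fst c) (\<lambda>z. 1 * Re (\<Lambda> z))"
      using smooth_on_linear[OF bounded_linear_cRe S_open sm, of 1] by (simp add: S_def)
  qed (simp add: laplacian_scal \<Lambda>_def)
  also have "\<dots> = Re (dd \<Lambda> ?z (v c))" using dd_Re[OF kd.sm_diff[OF sm z], of 1] by simp
  also have "dd \<Lambda> ?z (v c) = cnj (delb (v c) \<Lambda> ?z) + delb (v c) \<Lambda> ?z"
  proof -
    have "del (v c) \<Lambda> ?z = del (v c) (\<lambda>z. cnj (\<Lambda> z)) ?z"
      by (rule pd_cong[OF S_open z]) (simp add: real)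
    then show ?thesis using pd_cnj[OF kd.sm_diff[OF sm z], of "- \<i>"] by (simp add: dd_split)
  qed
  also have "delb (v c) \<Lambda> ?z = - 2 * kd.r ?z (bd.T ?z) (v c)"
    unfolding \<Lambda>_def [abs_def] by (rule bd.delb_trace_L[OF z])
  finally have d: "dfun K (laplacian K (scal K)) p v = - 4 * Re (kd.r ?z (bd.T ?z) (v c))" by simp
  have "ricci K p v (grad K (scal K) p) = ricci K p (e (v c) p) (e (bd.T ?z) p)"
    using tan_e[OF p v] by (simp add: grad_scal[OF p])
  also have "\<dots> = 2 * Re (kd.r ?z (bd.T ?z) (v c))"
    using kd.r_herm[OF z, of "v c" "bd.T ?z"] by (simp add: ricci_eq[OF p])
  finally show ?thesis using d by simp
qed

end

theorem proposition4p1: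
  fixes K :: "('a, 'n::finite) geometry"
    and T :: "('a, 'n) tfield"
  assumes dim: "CARD('n) \<ge> 2"
    and BK: "bochner_kaehler K"
    and T: "T = grad K (scal K)"
  shows
    "(holomorphic_field K
       (\<lambda>p. cscale (1 / 2) (complexify (T p) - cscale \<i> (complexify (cstr (T p)))))) \<and>
     (\<forall>p\<in>points K. \<forall>Z. complex_basis K p Z \<longrightarrow> (\<forall>\<alpha> \<beta>.
       (of_nat CARD('n) + 2) * mixed (hessian K (scal K) p) Z $ \<alpha> $ \<beta>
         + 2 * (of_nat CARD('n) + 1) * ricci_square K p Z \<alpha> \<beta>
         - complex_of_real (scal K p) * mixed (ricci K p) Z $ \<alpha> $ \<beta>
       = complex_of_real (((real CARD('n) + 2) * laplacian K (scal K) p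
             + 2 * (real CARD('n) + 1) * ricci_norm2 K p - (scal K p)\<^sup>2) / (2 * real CARD('n)))
         * mixed (metric K p) Z $ \<alpha> $ \<beta>)) \<and>
     (\<forall>X. smooth_field K (points K) X \<longrightarrow>
       (\<forall>p\<in>points K. 2 * ricci K p (X p) (T p) = - dfun K (laplacian K (scal K)) p (X p)))"
proof -
  have km: "kaehler_manifold K" and cm: "complex_manifold K"
    using BK by (auto simp: bochner_kaehler_def kaehler_manifold_def)
  have loc: "bochner_chart K c" if "c \<in> atlas K" for c
    using that km cm BK dim by unfold_locales
  have ex: "\<exists>c\<in>atlas K. p \<in> fst c" if "p \<in> points K" for p
    using cm that by (auto simp: complex_manifold_def)
  show ?thesis
    unfolding holomorphic_field_def T
  proof (intro conjI ballI allI impI, goal_cases)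
    case (1 p)
    then obtain c where "c \<in> atlas K" "p \<in> fst c" using ex by blast
    then show ?case by (rule bochner_chart.holomorphic_gradient(1)[OF loc])
  next
    case (2 c)
    then show ?case by (rule bochner_chart.holomorphic_gradient(2)[OF loc])
  next
    case (3 p Z \<alpha> \<beta>)
    then obtain c where c: "c \<in> atlas K" "p \<in> fst c" using ex by blast
    show ?case by (rule bochner_chart.mixed_hessian_identity[OF loc[OF c(1)] c(2) 3(2)])
  next
    case (4 X p)
    then obtain c where c: "c \<in> atlas K" "p \<in> fst c" using ex by blast
    have "X p \<in> tangent_space K p" using 4 by (simp add: smooth_field_def)
    then show ?case by (rule bochner_chart.ricci_gradient[OF loc[OF c(1)] c(2)])
  qed
qed

end
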